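(* Let $A(k)\in \mathrm{GL}(d,\mathbb{R})$ ($k\in\mathbb{Z}$) be a commuting family of self-adjoint matrices, let $c=(c(k))_{k\in\mathbb{Z}}$ be a sequence of complex numbers, and suppose $N_2(c,A)=\sum_{k\in\mathbb{Z}}|c(k)||\det A(k)|^{-1/2}<\infty$. Let $\mathcal{H}_{c,A}$ be the discrete Hausdorff operator $\mathcal{H}_{c,A}f(x)=\sum_{k=-\infty}^{\infty}c(k)f(A(k)x)$ in $L^2(\mathbb{R}^d)$. (i) Let $a(k)=(a_1(k),\dots,a_d(k))$ be the family of all eigenvalues (with their multiplicities) of the matrix $A(k)$. If for some $\nu\in\{1,\dots,d\}$ the numbers $\log|a_\nu(k)|$ ($k\in\mathbb{Z}$) are linearly independent over $\mathbb{Z}$, then the spectrum $\sigma(\mathcal{H}_{c,A})$ of $\mathcal{H}_{c,A}$ in $L^2(\mathbb{R}^d)$ is rotationally invariant. (ii) Let the matrix symbol $\Phi$ of $\mathcal{H}_{c,A}$ be a real analytic matrix function on $\mathbb{R}^d$. Then a complex number $\lambda$ belongs to the point spectrum $\sigma_p(\mathcal{H}_{c,A})$ if and only if $\lambda$ is a common eigenvalue of all the matrices $\Phi(s)$, $s\in\mathbb{R}^d$.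
   Context: The operator acts on $f\in L^2(\mathbb{R}^d)$ (complex-valued functions) by the displayed series, converging absolutely for almost every $x$; under $N_2(c,A)<\infty$ it is a bounded operator in $L^2(\mathbb{R}^d)$. Eigenvalues: since the $A(k)$ are commuting real symmetric matrices, there is an orthogonal $d\times d$ matrix $C$ (fixed, independent of $k$) such that $C^{-1}A(k)C=\mathrm{diag}(a_1(k),\dots,a_d(k))$ for all $k\in\mathbb{Z}$; the vector $a(k)=(a_1(k),\dots,a_d(k))$, with this ordering, is the family of eigenvalues of $A(k)$. All $a_l(k)$ are nonzero reals. A family of real numbers $(r_k)$ is linearly independent over $\mathbb{Z}$ if for every finite subfamily, $\sum l_k r_k=0$ with $l_k\in\mathbb{Z}$ implies all $l_k=0$. A set of complex numbers is rotationally invariant if it is invariant under all rotations $z\mapsto\zeta z$, $|\zeta|=1$. Matrix symbol: let $U_1,\dots,U_{2^d}$ be a fixed enumeration of all open hyperoctants of $\mathbb{R}^d$. For each pair $(i,j)$ let $\varepsilon(i;j)\in\{-1,1\}^d$ be the unique sign vector such that $\{(\varepsilon(i;j)_1x_1,\dots,\varepsilon(i;j)_dx_d):x\in U_i\}=U_j$. Put $\Omega_{ij}=\{k\in\mathbb{Z}:(\mathrm{sgn}(a_1(k)),\dots,\mathrm{sgn}(a_d(k)))=\varepsilon(i;j)\}$ and, for $s\in\mathbb{R}^d$, $$\varphi_{ij}(s)=\sum_{k\in\Omega_{ij}}\frac{c(k)}{\sqrt{|\det A(k)|}}\,e^{-\mathrm{i}\, s\cdot\log|a(k)|},$$ where $\log|a(k)|=(\log|a_1(k)|,\dots,\log|a_d(k)|)$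 and the dot is the inner product in $\mathbb{R}^d$. The matrix symbol is $\Phi=(\varphi_{ij})_{i,j=1}^{2^d}$. The point spectrum $\sigma_p$ is the set of eigenvalues. *)

theory Defs
  imports "HOL-Analysis.Analysis"
begin

text \<open>
  Elements of $L^2$ are handled as representatives: Lebesgue measurable, square integrable
  functions, with equality almost everywhere in place of equality.
\<close>

definition L2 :: "(real ^ 'd \<Rightarrow> complex) set" where
  "L2 = {f. f \<in> borel_measurable lebesgue \<and> integrable lebesgue (\<lambda>x. (cmod (f x))\<^sup>2)}"

definition L2_norm :: "(real ^ 'd \<Rightarrow> complex) \<Rightarrow> real" where
  "L2_norm f = sqrt (integral\<^sup>L lebesgue (\<lambda>x. (cmod (f x))\<^sup>2))"

text \<open>
  Linearity and boundedness together make such an operator respect equality almost everywhere,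
  so it descends to the quotient space.
\<close>

definition bounded_operator_L2 ::
  "((real ^ 'd \<Rightarrow> complex) \<Rightarrow> (real ^ 'd \<Rightarrow> complex)) \<Rightarrow> bool" where
  "bounded_operator_L2 T \<longleftrightarrow>
     (\<forall>f\<in>L2. T f \<in> L2) \<and>
     (\<forall>f\<in>L2. \<forall>g\<in>L2. \<forall>\<alpha> \<beta>. AE x in lebesgue.
        T (\<lambda>y. \<alpha> * f y + \<beta> * g y) x = \<alpha> * T f x + \<beta> * T g x) \<and>
     (\<exists>K. \<forall>f\<in>L2. L2_norm (T f) \<le> K * L2_norm f)"

definition resolvent_set_L2 ::
  "((real ^ 'd \<Rightarrow> complex) \<Rightarrow> (real ^ 'd \<Rightarrow> complex)) \<Rightarrow> complex set" where
  "resolvent_set_L2 T = {z. \<exists>R. bounded_operator_L2 R \<and>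
     (\<forall>f\<in>L2. (AE x in lebesgue. T (R f) x - z * R f x = f x) \<and>
             (AE x in lebesgue. R (\<lambda>y. T f y - z * f y) x = f x))}"

definition spectrum_L2 ::
  "((real ^ 'd \<Rightarrow> complex) \<Rightarrow> (real ^ 'd \<Rightarrow> complex)) \<Rightarrow> complex set" where
  "spectrum_L2 T = - resolvent_set_L2 T"

definition point_spectrum_L2 ::
  "((real ^ 'd \<Rightarrow> complex) \<Rightarrow> (real ^ 'd \<Rightarrow> complex)) \<Rightarrow> complex set" where
  "point_spectrum_L2 T = {z. \<exists>f\<in>L2. \<not> (AE x in lebesgue. f x = 0) \<and>
     (AE x in lebesgue. T f x = z * f x)}"

text \<open>
  For complex-valued families \<^const>\<open>infsum\<close> is the absolutely convergent sum; it is \<open>0\<close>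
  at the points where the series does not converge absolutely.
\<close>

definition hausdorff_op ::
  "(int \<Rightarrow> complex) \<Rightarrow> (int \<Rightarrow> real ^ 'd ^ 'd) \<Rightarrow> (real ^ 'd \<Rightarrow> complex) \<Rightarrow> (real ^ 'd \<Rightarrow> complex)" where
  "hausdorff_op c A f = (\<lambda>x. \<Sum>\<^sub>\<infinity>k. c k * f (A k *v x))"

definition diagonal_matrix :: "real ^ 'd \<Rightarrow> real ^ 'd ^ 'd" where
  "diagonal_matrix v = (\<chi> i j. if i = j then v $ i else 0)"

text \<open>
  \<open>a k\<close> lists the eigenvalues of \<open>A k\<close> with multiplicities, in the order given by one
  orthogonal matrix \<open>C\<close> that diagonalizes the whole family.
\<close>

definition eigenvalue_family ::
  "(int \<Rightarrow> real ^ 'd ^ 'd) \<Rightarrow> real ^ 'd ^ 'd \<Rightarrow> (int \<Rightarrow> real ^ 'd) \<Rightarrow> bool" where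
  "eigenvalue_family A C a \<longleftrightarrow> orthogonal_matrix C \<and>
     (\<forall>k. matrix_inv C ** A k ** C = diagonal_matrix (a k))"

definition log_abs :: "real ^ 'd \<Rightarrow> real ^ 'd" where
  "log_abs v = (\<chi> l. ln \<bar>v $ l\<bar>)"

definition sign_vectors :: "(real ^ 'd) set" where
  "sign_vectors = {e. \<forall>l. e $ l \<in> {-1, 1}}"

definition open_hyperoctants :: "(real ^ 'd) set set" where
  "open_hyperoctants = (\<lambda>e. {x. \<forall>l. e $ l * x $ l > 0}) ` sign_vectors"

definition octant_sign :: "(real ^ 'd) set \<Rightarrow> (real ^ 'd) set \<Rightarrow> real ^ 'd" where
  "octant_sign V W = (THE e. e \<in> sign_vectors \<and> (\<lambda>x. \<chi> l. e $ l * x $ l) ` V = W)"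

definition Omega ::
  "(int \<Rightarrow> real ^ 'd) \<Rightarrow> ('n \<Rightarrow> (real ^ 'd) set) \<Rightarrow> 'n \<Rightarrow> 'n \<Rightarrow> int set" where
  "Omega a U i j = {k. (\<chi> l. sgn (a k $ l)) = octant_sign (U i) (U j)}"

text \<open>
  The hyperoctants are enumerated by a finite index type \<open>'n\<close>, which has $2^d$ elements as soon
  as \<open>U\<close> is a bijection onto \<^const>\<open>open_hyperoctants\<close>.
\<close>

definition matrix_symbol ::
  "(int \<Rightarrow> complex) \<Rightarrow> (int \<Rightarrow> real ^ 'd ^ 'd) \<Rightarrow> (int \<Rightarrow> real ^ 'd) \<Rightarrow>
   ('n::finite \<Rightarrow> (real ^ 'd) set) \<Rightarrow> real ^ 'd \<Rightarrow> complex ^ 'n ^ 'n" where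
  "matrix_symbol c A a U s = (\<chi> i j. \<Sum>\<^sub>\<infinity>k\<in>Omega a U i j.
     c k / of_real (sqrt \<bar>det (A k)\<bar>) * exp (- (\<i> * of_real (s \<bullet> log_abs (a k)))))"

definition linearly_independent_over_int :: "('k \<Rightarrow> real) \<Rightarrow> bool" where
  "linearly_independent_over_int r \<longleftrightarrow>
     (\<forall>F (l :: 'k \<Rightarrow> int). finite F \<longrightarrow> (\<Sum>k\<in>F. of_int (l k) * r k) = 0 \<longrightarrow> (\<forall>k\<in>F. l k = 0))"

definition rotationally_invariant :: "complex set \<Rightarrow> bool" where
  "rotationally_invariant S \<longleftrightarrow> (\<forall>\<zeta>. cmod \<zeta> = 1 \<longrightarrow> (\<lambda>z. \<zeta> * z) ` S = S)"

text \<open>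
  Real analyticity on all of $\mathbb{R}^d$: near every point \<open>p\<close> the function is the sum of an
  (unconditionally convergent) power series in \<open>x - p\<close>, indexed by the multi-indices
  \<open>m :: 'd \<Rightarrow> nat\<close>.
\<close>

definition real_analytic :: "(real ^ 'd \<Rightarrow> complex) \<Rightarrow> bool" where
  "real_analytic f \<longleftrightarrow> (\<forall>p. \<exists>r>0. \<exists>b :: ('d \<Rightarrow> nat) \<Rightarrow> complex. \<forall>x\<in>ball p r.
     ((\<lambda>m. b m * of_real (\<Prod>l\<in>UNIV. (x $ l - p $ l) ^ m l)) has_sum f x) UNIV)"

definition real_analytic_matrix :: "(real ^ 'd \<Rightarrow> complex ^ 'n ^ 'n) \<Rightarrow> bool" where
  "real_analytic_matrix M \<longleftrightarrow> (\<forall>i j. real_analytic (\<lambda>s. M s $ i $ j))"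

definition matrix_eigenvalue :: "complex ^ 'n ^ 'n \<Rightarrow> complex \<Rightarrow> bool" where
  "matrix_eigenvalue M z \<longleftrightarrow> (\<exists>v. v \<noteq> 0 \<and> M *v v = z *s v)"

end

theory Submission
  imports Defs "HOL-Probability.Characteristic_Functions" "HOL-Complex_Analysis.Conformal_Mappings"
begin

no_notation fps_nth (infixl \<open>$\<close> 75)

text \<open>
  In the coordinates $y = C^T x$ every \<open>A k\<close> acts diagonally, $y_l \mapsto a_l(k)\, y_l$. Both parts
  use this.

  Rotational invariance. Multiplication by $|y_\nu|^{it}$ preserves the norm of $L^2$ and conjugates
  the Hausdorff operator $H$ with coefficients $c_k$ to the one with coefficients
  $c_k |a_\nu(k)|^{it}$. By Kronecker's theorem the independence of the numbers $\log|a_\nu(k)|$ lets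
  one choose $t$ such that $|a_\nu(k)|^{it}$ is close to a given unimodular $\zeta$ for finitely many
  prescribed $k$ at once; as the series \<open>N2\<close> converges, the conjugated operator is then close to
  $\zeta H$ in norm (\<open>N2_close\<close>). If $z$ is in the resolvent set of $H$, then $\zeta z$ is in that of
  $\zeta H$, by a Neumann series it is in that of the conjugated operator
  (\<open>bounded_below_onto_perturb\<close>), hence in that of $H$. One $t$ suffices, since the admissible
  distance depends only on the norm of the resolvent of $H$ at $z$.

  Point spectrum. On each open hyperoctant put $|y_l| = e^{u_l}$. Together with the square root of
  the Jacobian, this turns $f$ into $2^d$ functions on $\mathbb{R}^d$ and $H$ into a finite system of
  shifts, $(Hf)_i(u) = \sum_k w_k f_{p(i,k)}(u + b_k)$ with $b_k = \log|a(k)|$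
  (\<open>lift_hausdorff\<close>). The Fourier transform makes the shifts multiplications, and the resulting
  matrix function is the symbol $\Phi$.

  If $\det(\Phi - z)$ vanishes identically, there is a measurable field of null vectors that is not
  almost everywhere zero: a column of the lowest nonzero coefficient, in the variable $t$, of the
  adjugate of $\Phi - z + t$ (\<open>kernel_field\<close>). After multiplication by a Gaussian its Fourier transform
  is an eigenfunction (\<open>eigen_exists\<close>).

  If $\det(\Phi - z)$ does not vanish identically, it is nonzero almost everywhere: along each line
  through a point where it is nonzero it has countably many zeros, and a set that meets each such line
  in a countable set is null (\<open>real_analytic_det_dichotomy\<close>). An eigenfunction is paired with the
  Fourier transforms of functions $(\Phi - z)^{-1} G$, cut off where the inverse is large. Moving the
  operator to the other factor shows that each of its components is orthogonal to all modulated
  Gaussians, hence zero (\<open>eigen_unique\<close>).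

  Only two facts on the Fourier transform enter, injectivity on integrable functions
  (\<open>fourier_L1_unique\<close>) and the Plancherel inequality (\<open>plancherel_le\<close>). Both come from the transform
  of the Gaussian.
\<close>

section \<open>Gaussians and the Fourier transform of integrable functions\<close>

definition gaussian :: "'a::euclidean_space \<Rightarrow> real" where
  "gaussian v = exp (- (norm v)\<^sup>2 / 2)"

definition fourier :: "('a::euclidean_space \<Rightarrow> complex) \<Rightarrow> 'a \<Rightarrow> complex" where
  "fourier F u = (\<integral>s. F s * cis (s \<bullet> u) \<partial>lborel)"

lemma borel_measurable_cis [measurable]: "cis \<in> borel_measurable borel"
  by (intro borel_measurable_continuous_onI continuous_intros)

lemma borel_measurable_gaussian [measurable]: "gaussian \<in> borel_measurable borel"
  unfolding gaussian_def[abs_def] by measurable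

lemma gaussian_pos: "gaussian v > 0" and gaussian_le_1: "gaussian v \<le> 1"
  by (auto simp: gaussian_def)

lemma abs_gaussian [simp]: "\<bar>gaussian v\<bar> = gaussian v"
  by (simp add: gaussian_def)

lemma gaussian_square_le: "gaussian v * gaussian v \<le> gaussian v"
  using mult_left_mono[OF gaussian_le_1, of "gaussian v" v] gaussian_pos[of v] by simp

text \<open>
  Lebesgue measure on a Euclidean space is the image of a product measure, so functions that are
  products of functions of the coordinates integrate factor by factor.
\<close>

lemma integral_lborel_prod:
  fixes f :: "'a::euclidean_space \<Rightarrow> real \<Rightarrow> complex"
  assumes "\<And>b. b \<in> Basis \<Longrightarrow> integrable lborel (f b)"
  shows "integrable lborel (\<lambda>x::'a. \<Prod>b\<in>Basis. f b (x \<bullet> b))"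
    and "(\<integral>x. (\<Prod>b\<in>Basis. f b (x \<bullet> b)) \<partial>(lborel :: 'a measure)) = (\<Prod>b\<in>Basis. \<integral>x. f b x \<partial>lborel)"
proof -
  interpret finite_product_sigma_finite "\<lambda>_::'a. lborel :: real measure" "Basis :: 'a set"
    by standard simp
  note assms[THEN borel_measurable_integrable, measurable]
  have eq: "(\<Prod>b\<in>Basis. f b ((\<Sum>b'\<in>Basis. x b' *\<^sub>R b') \<bullet> b)) = (\<Prod>b\<in>Basis. f b (x b))"
    for x :: "'a \<Rightarrow> real"
    by (intro prod.cong refl) simp
  have int: "integrable (\<Pi>\<^sub>M b\<in>(Basis::'a set). lborel) (\<lambda>x. \<Prod>b\<in>Basis. f b (x b))"
    by (rule product_integrable_prod) (use assms in auto)
  have m1: "(\<lambda>g. \<Sum>b'\<in>Basis. g b' *\<^sub>R b') \<in> borel_measurable (\<Pi>\<^sub>M b\<in>(Basis::'a set). lborel)"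
    by measurable
  have m2: "(\<lambda>x::'a. \<Prod>b\<in>Basis. f b (x \<bullet> b)) \<in> borel_measurable borel"
    by (intro borel_measurable_prod) (use assms[THEN borel_measurable_integrable] in auto)
  show "integrable lborel (\<lambda>x::'a. \<Prod>b\<in>Basis. f b (x \<bullet> b))"
    by (subst lborel_eq, subst integrable_distr_eq[OF m1 m2]) (simp only: eq int)
  have "(\<integral>x. (\<Prod>b\<in>Basis. f b (x \<bullet> b)) \<partial>(lborel :: 'a measure)) =
    (\<integral>x. (\<Prod>b\<in>Basis. f b (x b)) \<partial>(\<Pi>\<^sub>M b\<in>(Basis::'a set). lborel))"
    by (subst lborel_eq, subst integral_distr[OF m1 m2]) (simp only: eq)
  also have "\<dots> = (\<Prod>b\<in>Basis. \<integral>x. f b x \<partial>lborel)"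
    by (rule product_integral_prod) (use assms in auto)
  finally show "(\<integral>x. (\<Prod>b\<in>Basis. f b (x \<bullet> b)) \<partial>(lborel :: 'a measure)) = (\<Prod>b\<in>Basis. \<integral>x. f b x \<partial>lborel)" .
qed

text \<open>
  This is the characteristic function of the standard normal distribution without its
  normalizing factor.
\<close>

lemma gaussian_fourier_real:
  "integrable lborel (\<lambda>x::real. of_real (exp (- x\<^sup>2 / 2)) * cis (t * x))"
  "(\<integral>x. of_real (exp (- x\<^sup>2 / 2)) * cis (t * x) \<partial>lborel) = of_real (sqrt (2 * pi) * exp (- t\<^sup>2 / 2))"
proof -
  have sd: "exp (- x\<^sup>2 / 2) = sqrt (2 * pi) * std_normal_density x" for x
    by (simp add: std_normal_density_def)
  have i0: "integrable lborel std_normal_density"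
    using integrable_normal_moment[of 1 0 0] by simp
  have i1: "integrable lborel (\<lambda>x::real. of_real (std_normal_density x) * cis (t * x))"
    by (rule Bochner_Integration.integrable_bound[OF i0]) (auto simp: norm_mult)
  have "(\<integral>x. of_real (std_normal_density x) * cis (t * x) \<partial>lborel) = char std_normal_distribution t"
    unfolding char_def
    by (subst integral_density) (auto simp: cis_conv_exp normal_density_nonneg mult_ac scaleR_conv_of_real)
  also have "\<dots> = of_real (exp (- t\<^sup>2 / 2))" by (simp add: char_std_normal_distribution)
  finally have 2: "(\<integral>x. of_real (std_normal_density x) * cis (t * x) \<partial>lborel) = complex_of_real (exp (- t\<^sup>2 / 2))" .
  show "integrable lborel (\<lambda>x::real. of_real (exp (- x\<^sup>2 / 2)) * cis (t * x))"
    using integrable_mult_right[OF i1, of "of_real (sqrt (2*pi))"]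
    by (simp only: sd of_real_mult mult.assoc)
  show "(\<integral>x. of_real (exp (- x\<^sup>2 / 2)) * cis (t * x) \<partial>lborel) = of_real (sqrt (2 * pi) * exp (- t\<^sup>2 / 2))"
    using 2 by (simp only: sd of_real_mult mult.assoc integral_mult_right_zero)
qed

lemma gaussian_eq_prod: "gaussian (v::'a::euclidean_space) = (\<Prod>b\<in>Basis. exp (- (v \<bullet> b)\<^sup>2 / 2))"
  by (simp add: gaussian_def norm_eq_sqrt_inner euclidean_inner[of v v] power2_eq_square
     sum_divide_distrib sum_negf sum_nonneg flip: exp_sum)

lemma cis_inner: "cis (s \<bullet> v) = (\<Prod>b\<in>Basis. cis ((s \<bullet> b) * (v \<bullet> b)))"
  for s :: "'a::euclidean_space"
  by (simp add: euclidean_inner[of s v] cis_conv_exp sum_distrib_left exp_sum)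

lemma fourier_gaussian:
  "integrable lborel (\<lambda>v::'a::euclidean_space. of_real (gaussian v) * cis (v \<bullet> s))"
  "fourier (\<lambda>v::'a. of_real (gaussian v)) s = of_real (sqrt (2 * pi) ^ DIM('a) * gaussian s)"
proof -
  have eq: "of_real (gaussian v) * cis (v \<bullet> s) =
     (\<Prod>b\<in>Basis. of_real (exp (- (v \<bullet> b)\<^sup>2 / 2)) * cis ((s \<bullet> b) * (v \<bullet> b)))" for v :: 'a
    by (subst inner_commute) (simp add: gaussian_eq_prod cis_inner prod.distrib)
  show "integrable lborel (\<lambda>v::'a. of_real (gaussian v) * cis (v \<bullet> s))"
    unfolding eq by (rule integral_lborel_prod) (rule gaussian_fourier_real)
  show "fourier (\<lambda>v::'a. of_real (gaussian v)) s = of_real (sqrt (2 * pi) ^ DIM('a) * gaussian s)"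
    unfolding eq fourier_def
    by (subst integral_lborel_prod)
       (simp_all only: gaussian_fourier_real gaussian_eq_prod of_real_mult prod.distrib of_real_prod prod_constant of_real_power)
qed

lemma integrable_gaussian: "integrable lborel (gaussian :: 'a::euclidean_space \<Rightarrow> real)"
  using integrable_norm[OF fourier_gaussian(1)[of "0::'a"]] by (simp add: norm_mult gaussian_pos less_imp_le)

lemma integral_gaussian: "(\<integral>v. gaussian (v::'a::euclidean_space) \<partial>lborel) = sqrt (2 * pi) ^ DIM('a)"
proof -
  have "complex_of_real (\<integral>v. gaussian (v::'a) \<partial>lborel) = fourier (\<lambda>v::'a. of_real (gaussian v)) 0"
    by (simp add: fourier_def)
  also have "\<dots> = of_real (sqrt (2 * pi) ^ DIM('a))"
    unfolding fourier_gaussian by (simp add: gaussian_def)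
  finally show ?thesis using of_real_eq_iff by blast
qed

lemma nn_integral_lborel_affine:
  fixes t :: "'a::euclidean_space"
  assumes [measurable]: "f \<in> borel_measurable borel" and c: "c \<noteq> 0"
  shows "(\<integral>\<^sup>+x. f x \<partial>lborel) = ennreal (\<bar>c\<bar> ^ DIM('a)) * (\<integral>\<^sup>+x. f (t + c *\<^sub>R x) \<partial>lborel)"
  by (subst lborel_affine[OF c, of t])
     (simp add: nn_integral_density nn_integral_distr nn_integral_cmult)

lemma lborel_integrable_affine:
  fixes t :: "'a::euclidean_space" and f :: "'a \<Rightarrow> 'b :: {banach, second_countable_topology}"
  assumes f: "integrable lborel f" and c: "c \<noteq> 0"
  shows "integrable lborel (\<lambda>x. f (t + c *\<^sub>R x))"
  using f f[THEN borel_measurable_integrable] c unfolding integrable_iff_bounded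
  by (subst (asm) nn_integral_lborel_affine[where c=c and t=t]) (auto simp: ennreal_mult_less_top)

lemma lborel_integral_affine:
  fixes t :: "'a::euclidean_space" and f :: "'a \<Rightarrow> 'b :: {banach, second_countable_topology}"
  assumes f: "integrable lborel f" and c: "c \<noteq> 0"
  shows "(\<integral>x. f x \<partial>lborel) = \<bar>c\<bar> ^ DIM('a) *\<^sub>R (\<integral>x. f (t + c *\<^sub>R x) \<partial>lborel)"
  using f c f[THEN borel_measurable_integrable] lborel_integrable_affine[OF f c, of t]
  by (subst lborel_affine[OF c, of t]) (simp add: integral_density integral_distr)

text \<open>
  The positive and the negative part of \<open>h\<close> are densities of two finite measures that agree on
  boxes, which generate the Borel sets; so the measures, and with them the densities, agree.
\<close>

lemma AE_zero_if_box_integrals_zero_real: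
  fixes h :: "'a::euclidean_space \<Rightarrow> real"
  assumes h: "integrable lborel h"
    and z: "\<And>a b. (\<integral>x. indicator (box a b) x * h x \<partial>lborel) = 0"
  shows "AE x in lborel. h x = 0"
proof -
  note [measurable] = h[THEN borel_measurable_integrable]
  let ?p = "\<lambda>x. ennreal (h x)" and ?n = "\<lambda>x. ennreal (- h x)"
  have fin: "(\<integral>\<^sup>+x. ?p x \<partial>lborel) \<noteq> \<infinity>" "(\<integral>\<^sup>+x. ?n x \<partial>lborel) \<noteq> \<infinity>"
    using h by (auto simp: real_integrable_def)
  have box_eq: "emeasure (density lborel ?p) (box a b) = emeasure (density lborel ?n) (box a b)" for a b
  proof -
    have i: "integrable lborel (\<lambda>x. indicator (box a b) x * h x)"
      using integrable_mult_indicator[OF _ h, of "box a b"] by simp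
    have "enn2real (\<integral>\<^sup>+x. ennreal (indicator (box a b) x * h x) \<partial>lborel) =
          enn2real (\<integral>\<^sup>+x. ennreal (- (indicator (box a b) x * h x)) \<partial>lborel)"
      using z[of a b] by (simp add: real_lebesgue_integral_def[OF i])
    moreover have "(\<integral>\<^sup>+x. ennreal (indicator (box a b) x * h x) \<partial>lborel) < top"
      "(\<integral>\<^sup>+x. ennreal (- (indicator (box a b) x * h x)) \<partial>lborel) < top"
      using i unfolding real_integrable_def by (simp_all add: less_top)
    ultimately have "(\<integral>\<^sup>+x. ennreal (indicator (box a b) x * h x) \<partial>lborel) =
          (\<integral>\<^sup>+x. ennreal (- (indicator (box a b) x * h x)) \<partial>lborel)"
      by (metis ennreal_enn2real)
    moreover have "ennreal (indicator (box a b) x * h x) = ?p x * indicator (box a b) x"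
      "ennreal (- (indicator (box a b) x * h x)) = ?n x * indicator (box a b) x" for x
      by (auto split: split_indicator)
    ultimately show ?thesis
      by (simp add: emeasure_density)
  qed
  have "density lborel ?p = density lborel ?n"
  proof (rule measure_eqI_generator_eq)
    let ?E = "range (\<lambda>(a, b). box a b::'a set)"
    show "Int_stable ?E"
      by (auto simp: Int_stable_def box_Int_box)
    show "?E \<subseteq> Pow UNIV" "sets (density lborel ?p) = sigma_sets UNIV ?E" "sets (density lborel ?n) = sigma_sets UNIV ?E"
      by (simp_all add: borel_eq_box)
    let ?A = "\<lambda>n::nat. box (- (real n *\<^sub>R One)) (real n *\<^sub>R One) :: 'a set"
    show "range ?A \<subseteq> ?E" "(\<Union>i. ?A i) = UNIV"
      unfolding UN_box_eq_UNIV by auto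
    show "emeasure (density lborel ?p) (?A i) \<noteq> \<infinity>" for i
    proof -
      have "emeasure (density lborel ?p) (?A i) \<le> emeasure (density lborel ?p) UNIV"
        by (rule emeasure_mono) auto
      also have "\<dots> < \<infinity>" using fin(1) by (simp add: emeasure_density less_top)
      finally show ?thesis by auto
    qed
    show "emeasure (density lborel ?p) X = emeasure (density lborel ?n) X" if "X \<in> ?E" for X
      using that box_eq by auto
  qed
  then have "AE x in lborel. ?p x = ?n x"
    by (intro sigma_finite_measure.density_unique_iff[OF sigma_finite_lborel, THEN iffD1]) auto 
  then show ?thesis
  proof eventually_elim
    case (elim x)
    then show ?case by (cases "h x \<ge> 0") (auto simp: ennreal_neg ennreal_eq_0_iff)
  qed
qed

lemma AE_zero_if_box_integrals_zero:
  fixes h :: "'a::euclidean_space \<Rightarrow> complex"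
  assumes h: "integrable lborel h"
    and z: "\<And>a b. (\<integral>x. indicator (box a b) x * h x \<partial>lborel) = 0"
  shows "AE x in lborel. h x = 0"
proof -
  have i: "integrable lborel (\<lambda>x. indicator (box a b) x * h x)" for a b
    using integrable_mult_indicator[OF _ h, of "box a b"]
    by (rule Bochner_Integration.integrable_cong[OF refl, THEN iffD1, rotated]) (auto split: split_indicator)
  have *: "indicator (box a b) x * Re (h x) = Re (indicator (box a b) x * h x)"
    "indicator (box a b) x * Im (h x) = Im (indicator (box a b) x * h x)" for a b x
    by (auto simp: indicator_def)
  have "AE x in lborel. Re (h x) = 0"
    by (rule AE_zero_if_box_integrals_zero_real) (use h i z in \<open>simp_all only: * integrable_Re integral_Re zero_complex.sel\<close>)
  moreover have "AE x in lborel. Im (h x) = 0"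
    by (rule AE_zero_if_box_integrals_zero_real) (use h i z in \<open>simp_all only: * integrable_Im integral_Im zero_complex.sel\<close>)
  ultimately show ?thesis by eventually_elim (simp add: complex_eq_iff)
qed

lemma integrable_cis_mult:
  fixes F :: "'a::euclidean_space \<Rightarrow> complex"
  assumes F: "integrable lborel F" and [measurable]: "\<theta> \<in> borel_measurable borel"
  shows "integrable lborel (\<lambda>s. F s * cis (\<theta> s))"
  using F borel_measurable_integrable[OF F]
  by (intro Bochner_Integration.integrable_bound[OF F]) (auto simp: norm_mult)

lemma fourier_measurable [measurable]:
  assumes [measurable]: "F \<in> borel_measurable borel"
  shows "fourier F \<in> borel_measurable (borel :: 'a::euclidean_space measure)"
  unfolding fourier_def[abs_def] by measurable

lemma norm_fourier_le:
  assumes F: "integrable lborel F"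
  shows "cmod (fourier F u) \<le> (\<integral>s. cmod (F s) \<partial>lborel)"
  unfolding fourier_def
  by (rule order_trans[OF integral_norm_bound]) (simp add: norm_mult)

lemma lborel_fubini:
  fixes f :: "'a::euclidean_space \<Rightarrow> 'b::euclidean_space \<Rightarrow> complex"
  assumes f: "integrable (lborel \<Otimes>\<^sub>M lborel) (\<lambda>(x, y). f x y)"
  shows "(\<integral>x. (\<integral>y. f x y \<partial>lborel) \<partial>lborel) = (\<integral>y. (\<integral>x. f x y \<partial>lborel) \<partial>lborel)"
proof -
  show ?thesis using lborel_pair.Fubini_integral[OF f] by simp
qed

lemma integrable_tensor:
  fixes f :: "'a::euclidean_space \<Rightarrow> complex" and g :: "'b::euclidean_space \<Rightarrow> complex"
  assumes f: "integrable lborel f" and g: "integrable lborel g"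
    and [measurable]: "w \<in> borel_measurable (borel \<Otimes>\<^sub>M borel)"
    and w: "\<And>x y. cmod (w (x, y)) \<le> 1"
  shows "integrable (lborel \<Otimes>\<^sub>M lborel) (\<lambda>(x, y). f x * g y * w (x, y))"
proof -
  note [measurable] = f[THEN borel_measurable_integrable] g[THEN borel_measurable_integrable]
  have "integrable (lborel \<Otimes>\<^sub>M lborel) (\<lambda>z. f (fst z) * g (snd z))"
    by (rule lborel_pair.Fubini_integrable) (use f g in \<open>auto simp: norm_mult\<close>)
  then show ?thesis
  proof (rule Bochner_Integration.integrable_bound)
    show "AE z in lborel \<Otimes>\<^sub>M lborel. norm (case z of (x, y) \<Rightarrow> f x * g y * w (x, y)) \<le> norm (f (fst z) * g (snd z))"
      using w by (auto simp: norm_mult mult_left_le intro!: AE_I2)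
  qed (simp add: split_beta')
qed

text \<open>
  The kernel \<open>cis (s \<bullet> u)\<close> is symmetric and bounded, so this is Fubini's theorem. It is the only
  way in which the Fourier transform is moved between factors below.
\<close>

lemma fourier_parts:
  fixes f g :: "'a::euclidean_space \<Rightarrow> complex"
  assumes f: "integrable lborel f" and g: "integrable lborel g"
  shows "(\<integral>u. f u * fourier g u \<partial>lborel) = (\<integral>s. g s * fourier f s \<partial>lborel)"
proof -
  have "(\<integral>u. f u * fourier g u \<partial>lborel) = (\<integral>u. (\<integral>s. f u * g s * cis (s \<bullet> u) \<partial>lborel) \<partial>lborel)"
    unfolding fourier_def by (simp add: mult.assoc)
  also have "\<dots> = (\<integral>s. (\<integral>u. f u * g s * cis (s \<bullet> u) \<partial>lborel) \<partial>lborel)"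
    using integrable_tensor[OF f g, of "\<lambda>(u,s). cis (s \<bullet> u)"]
    by (intro lborel_fubini) simp
  also have "\<dots> = (\<integral>s. g s * fourier f s \<partial>lborel)"
    unfolding fourier_def by (simp add: mult_ac inner_commute flip: integral_mult_right_zero)
  finally show ?thesis .
qed

lemma fourier_gaussian_shift_eq:
  fixes y u :: "'a::euclidean_space"
  assumes "t > 0"
  shows "fourier (\<lambda>v. of_real (gaussian v) * cis (- (v \<bullet> y) / t)) (u /\<^sub>R t) =
    of_real (sqrt (2 * pi) ^ DIM('a) * gaussian ((u - y) /\<^sub>R t))"
proof -
  have "cis (- (v \<bullet> y) / t) * cis (v \<bullet> (u /\<^sub>R t)) = cis (v \<bullet> ((u - y) /\<^sub>R t))" for v
    by (simp add: cis_mult inner_diff_right algebra_simps divide_inverse)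
  then show ?thesis
    unfolding fourier_gaussian(2)[symmetric] by (simp only: fourier_def mult.assoc)
qed

text \<open>
  Since rescaled Gaussians are themselves Fourier transforms, \<open>fourier_parts\<close> shows that the
  convolution of \<open>h\<close> with every Gaussian vanishes. Integrated over a box, this says that \<open>h\<close> is
  orthogonal to the convolution of the indicator of the box with a Gaussian of width \<open>t\<close>. For
  \<open>t \<rightarrow> 0\<close> these convolutions stay bounded and converge to a multiple of the indicator off the
  boundary of the box, so all integrals of \<open>h\<close> over boxes vanish.
\<close>

lemma fourier_L1_unique:
  fixes h :: "'a::euclidean_space \<Rightarrow> complex"
  assumes h: "integrable lborel h" and z: "\<And>s. fourier h s = 0"
  shows "AE x in lborel. h x = 0"
proof (rule AE_zero_if_box_integrals_zero[OF h])
  fix a b :: 'a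
  define B where "B = box a b"
  have [measurable]: "B \<in> sets borel" by (simp add: B_def)
  note [measurable] = h[THEN borel_measurable_integrable]
  define c where "c = sqrt (2 * pi) ^ DIM('a)"
  have c: "c > 0" by (simp add: c_def)
  have iB: "integrable lborel (indicator B :: 'a \<Rightarrow> complex)"
  proof -
    have "integrable lborel (\<lambda>x. complex_of_real (indicator B x))"
      by (intro integrable_of_real integrable_real_indicator) (auto simp: B_def emeasure_lborel_box_eq)
    then show ?thesis
      by (rule Bochner_Integration.integrable_cong[OF refl, THEN iffD1, rotated]) (auto split: split_indicator)
  qed
  \<comment> \<open>the convolution of \<open>h\<close> with a Gaussian of width \<open>t\<close> vanishes\<close>
  have gauss0: "(\<integral>u. h u * of_real (gaussian ((u - y) /\<^sub>R t)) \<partial>lborel) = 0" if t: "t > 0" for t y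
  proof -
    let ?g = "\<lambda>v. of_real (gaussian v) * cis (- (v \<bullet> y) / t)"
    have ig: "integrable lborel ?g"
      by (rule integrable_cis_mult) (use integrable_gaussian in auto)
    have ht: "integrable lborel (\<lambda>u. h (t *\<^sub>R u))"
      using lborel_integrable_affine[OF h, of t 0] t by simp
    have ft: "fourier (\<lambda>u. h (t *\<^sub>R u)) s = 0" for s
    proof -
      have "0 = fourier h (s /\<^sub>R t)" by (simp add: z)
      also have "\<dots> = t ^ DIM('a) *\<^sub>R fourier (\<lambda>u. h (t *\<^sub>R u)) s"
        unfolding fourier_def
        by (subst lborel_integral_affine[where c=t and t=0])
             (use t h in \<open>auto intro!: integrable_cis_mult simp flip: mult.assoc\<close>)
      finally show ?thesis using t by simp
    qed
    have iw: "integrable lborel (\<lambda>u. h u * of_real (gaussian ((u - y) /\<^sub>R t)))"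
      using gaussian_le_1 gaussian_pos
      by (intro Bochner_Integration.integrable_bound[OF h])
         (auto simp: norm_mult less_imp_le intro!: mult_left_le AE_I2)
    have "(\<integral>u. h u * of_real (gaussian ((u - y) /\<^sub>R t)) \<partial>lborel) =
       t ^ DIM('a) *\<^sub>R (\<integral>u. h (t *\<^sub>R u) * of_real (gaussian ((t *\<^sub>R u - y) /\<^sub>R t)) \<partial>lborel)"
      by (subst lborel_integral_affine[OF iw, where c=t and t=0]) (use t in auto)
    also have "(\<integral>u. h (t *\<^sub>R u) * of_real (gaussian ((t *\<^sub>R u - y) /\<^sub>R t)) \<partial>lborel) =
        (\<integral>u. h (t *\<^sub>R u) * (fourier ?g u / of_real c) \<partial>lborel)"
      using fourier_gaussian_shift_eq[OF t, of y "t *\<^sub>R u" for u] t c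
      by (intro Bochner_Integration.integral_cong refl) (simp add: c_def)
    also have "\<dots> = (\<integral>u. h (t *\<^sub>R u) * fourier ?g u \<partial>lborel) / of_real c"
      by simp
    also have "\<dots> = 0"
      by (subst fourier_parts[OF ht ig]) (simp add: ft)
    finally show ?thesis by simp
  qed
  have smooth0: "(\<integral>u. h u * (\<integral>v. indicator B (u - t *\<^sub>R v) * of_real (gaussian v) \<partial>lborel) \<partial>lborel) = 0"
    if t: "t > 0" for t
  proof -
    have m: "integrable (lborel \<Otimes>\<^sub>M lborel) (\<lambda>(y, u). indicator B y * h u * of_real (gaussian ((u - y) /\<^sub>R t)))"
      using integrable_tensor[OF iB h, of "\<lambda>(y,u). of_real (gaussian ((u - y) /\<^sub>R t))"]
      by (simp add: gaussian_le_1)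
    have "0 = (\<integral>y. indicator B y * (\<integral>u. h u * of_real (gaussian ((u - y) /\<^sub>R t)) \<partial>lborel) \<partial>lborel)"
      by (simp add: gauss0[OF t])
    also have "\<dots> = (\<integral>y. (\<integral>u. indicator B y * h u * of_real (gaussian ((u - y) /\<^sub>R t)) \<partial>lborel) \<partial>lborel)"
      by (simp add: mult.assoc)
    also have "\<dots> = (\<integral>u. (\<integral>y. indicator B y * h u * of_real (gaussian ((u - y) /\<^sub>R t)) \<partial>lborel) \<partial>lborel)"
      by (rule lborel_fubini[OF m])
    also have "\<dots> = (\<integral>u. h u * (\<integral>y. indicator B y * of_real (gaussian ((u - y) /\<^sub>R t)) \<partial>lborel) \<partial>lborel)"
      by (simp add: mult_ac flip: integral_mult_right_zero)
    also have "\<dots> = (\<integral>u. h u * (t ^ DIM('a) *\<^sub>R (\<integral>v. indicator B (u - t *\<^sub>R v) * of_real (gaussian v) \<partial>lborel)) \<partial>lborel)"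
    proof -
      have "(\<integral>y. indicator B y * complex_of_real (gaussian ((u - y) /\<^sub>R t)) \<partial>lborel) =
         t ^ DIM('a) *\<^sub>R (\<integral>v. indicator B (u - t *\<^sub>R v) * of_real (gaussian v) \<partial>lborel)" for u
      proof -
        have "integrable lborel (\<lambda>y. indicator B y * complex_of_real (gaussian ((u - y) /\<^sub>R t)))"
          by (intro Bochner_Integration.integrable_bound[OF iB])
             (auto simp: norm_mult less_imp_le gaussian_pos gaussian_le_1 indicator_def intro!: AE_I2)
        from lborel_integral_affine[OF this, of "-t" u] t
        show ?thesis by simp
      qed
      then show ?thesis by simp
    qed
    also have "\<dots> = t ^ DIM('a) *\<^sub>R (\<integral>u. h u * (\<integral>v. indicator B (u - t *\<^sub>R v) * of_real (gaussian v) \<partial>lborel) \<partial>lborel)"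
      by simp
    finally show ?thesis using t by simp
  qed
  define \<psi> where "\<psi> n u = (\<integral>v. indicator B (u - (1 / Suc n) *\<^sub>R v) * complex_of_real (gaussian v) \<partial>lborel)"
    for n :: nat and u :: 'a
  have [measurable]: "\<psi> n \<in> borel_measurable borel" for n
    unfolding \<psi>_def[abs_def] by measurable
  have cint: "(\<integral>v. complex_of_real (gaussian (v::'a)) \<partial>lborel) = of_real c"
    by (simp add: integral_gaussian c_def)
  have \<psi>_le: "cmod (\<psi> n u) \<le> c" for n u
  proof -
    have "cmod (\<psi> n u) \<le> (\<integral>v. gaussian (v::'a) \<partial>lborel)"
      unfolding \<psi>_def
      by (rule order_trans[OF integral_norm_bound], rule integral_mono')
         (auto simp: norm_mult less_imp_le gaussian_pos indicator_def integrable_gaussian)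
    then show ?thesis by (simp add: integral_gaussian c_def)
  qed
  have \<psi>_lim: "(\<lambda>n. \<psi> n u) \<longlonglongrightarrow> indicator B u * of_real c" if u: "u \<notin> frontier B" for u
  proof -
    have "(\<lambda>n. \<psi> n u) \<longlonglongrightarrow> (\<integral>v. indicator B u * complex_of_real (gaussian (v::'a)) \<partial>lborel)"
      unfolding \<psi>_def
    proof (rule integral_dominated_convergence[where w="gaussian"])
      show "AE v in lborel. (\<lambda>n. indicator B (u - (1 / Suc n) *\<^sub>R v) * complex_of_real (gaussian (v::'a)))
         \<longlonglongrightarrow> indicator B u * complex_of_real (gaussian v)"
      proof (intro AE_I2 tendsto_mult tendsto_const)
        fix v :: 'a
        have lim: "(\<lambda>n. u - (1 / Suc n) *\<^sub>R v) \<longlonglongrightarrow> u - 0 *\<^sub>R v"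
          by (intro tendsto_intros LIMSEQ_Suc[OF lim_1_over_n])
        have "\<forall>\<^sub>F n in sequentially. indicator B (u - (1 / Suc n) *\<^sub>R v) = (indicator B u :: complex)"
        proof (cases "u \<in> B")
          case True
          have "open B" by (simp add: B_def open_box)
          from topological_tendstoD[OF lim[simplified] this True]
          show ?thesis by eventually_elim (use True in simp)
        next
          case False
          then have "u \<in> - closure B" using u interior_subset[of B] by (auto simp: frontier_def)
          from topological_tendstoD[OF lim[simplified] open_Compl[OF closed_closure] this]
          have "\<forall>\<^sub>F n in sequentially. u - (1 / Suc n) *\<^sub>R v \<in> - closure B" by simp
          then show ?thesis by eventually_elim (use False closure_subset in \<open>auto simp: indicator_def\<close>)
        qed
        then show "(\<lambda>n. indicator B (u - (1 / Suc n) *\<^sub>R v)) \<longlonglongrightarrow> (indicator B u :: complex)"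
          by (rule tendsto_eventually)
      qed
      show "AE v in lborel. norm (indicator B (u - (1 / real (Suc n)) *\<^sub>R v) * complex_of_real (gaussian v)) \<le> gaussian v" for n
        by (auto simp: norm_mult less_imp_le gaussian_pos indicator_def intro!: AE_I2)
    qed (auto simp: integrable_gaussian)
    then show ?thesis by (simp add: integral_gaussian c_def)
  qed
  have "(\<lambda>n. \<integral>u. h u * \<psi> n u \<partial>lborel) \<longlonglongrightarrow> (\<integral>u. h u * (indicator B u * of_real c) \<partial>lborel)"
  proof (rule integral_dominated_convergence[where w="\<lambda>u. cmod (h u) * c"])
    have "frontier B \<in> null_sets lborel"
      using negligible_convex_frontier[of B] frontier_closed[of B]
      by (auto simp: B_def negligible_iff_null_sets null_sets_completion_iff)
    then have "AE u in lborel. u \<notin> frontier B" by (rule AE_not_in)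
    then show "AE u in lborel. (\<lambda>n. h u * \<psi> n u) \<longlonglongrightarrow> h u * (indicator B u * of_real c)"
      by eventually_elim (intro tendsto_mult tendsto_const \<psi>_lim)
    show "AE u in lborel. norm (h u * \<psi> n u) \<le> cmod (h u) * c" for n
      using \<psi>_le by (auto simp: norm_mult intro!: AE_I2 mult_left_mono)
  qed (use h in auto)
  moreover have "(\<integral>u. h u * \<psi> n u \<partial>lborel) = 0" for n
    unfolding \<psi>_def by (rule smooth0) simp
  ultimately have "(\<integral>u. h u * (indicator B u * of_real c) \<partial>lborel) = 0"
    by (simp add: LIMSEQ_const_iff)
  then have "(\<integral>u. (indicator B u * h u) * of_real c \<partial>lborel) = 0"
    by (simp add: mult_ac)
  then show "(\<integral>x. indicator (box a b) x * h x \<partial>lborel) = 0"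
    using c by (simp add: B_def)
qed

lemma fourier_cnj: "cnj (fourier F u) = fourier (\<lambda>s. cnj (F s)) (- u)"
  unfolding fourier_def Bochner_Integration.integral_cnj[symmetric]
  by (simp add: cis_cnj del: Bochner_Integration.integral_cnj)

lemma fourier_scaled_gaussian:
  fixes v :: "'a::euclidean_space"
  assumes "t > 0"
  shows "fourier (\<lambda>u::'a. of_real (gaussian (t *\<^sub>R u))) v =
    of_real (sqrt (2 * pi) ^ DIM('a) * gaussian (v /\<^sub>R t) / t ^ DIM('a))"
proof -
  have "fourier (\<lambda>u::'a. of_real (gaussian u)) (v /\<^sub>R t) = t ^ DIM('a) *\<^sub>R fourier (\<lambda>u::'a. of_real (gaussian (t *\<^sub>R u))) v"
  proof -
    have [simp]: "inverse t * (t * x) = x" for x using assms by simp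
    show ?thesis
      unfolding fourier_def
      by (subst lborel_integral_affine[where c=t and t=0]) (use assms fourier_gaussian(1)[of "v /\<^sub>R t"] in auto)
  qed
  then show ?thesis using assms
    by (simp add: fourier_gaussian(2) field_simps scaleR_conv_of_real)
qed

lemma norm_integral_le_nn_integral: "ennreal (norm (\<integral>x. f x \<partial>M)) \<le> (\<integral>\<^sup>+x. norm (f x) \<partial>M)"
proof (cases "integrable M f")
  case True then show ?thesis by (rule integral_norm_bound_ennreal)
qed (simp add: not_integrable_integral_eq)

text \<open>
  Weighting the square of the transform with \<open>gaussian (t *\<^sub>R u)\<close> makes all integrals absolutely
  convergent. By \<open>fourier_parts\<close> the weighted integral is a double integral of \<open>F\<close> against a positive
  kernel in the difference of the variables, whose total mass \<open>(2 * pi) ^ DIM('a)\<close> does not depend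
  on \<open>t\<close>. The inequality \<open>2 * a * b \<le> a\<^sup>2 + b\<^sup>2\<close> bounds it, and Fatou's lemma removes the weight.
\<close>

lemma plancherel_le:
  fixes F :: "'a::euclidean_space \<Rightarrow> complex"
  assumes F: "integrable lborel F"
  shows "(\<integral>\<^sup>+u. (cmod (fourier F u))\<^sup>2 \<partial>lborel) \<le> ennreal ((2 * pi) ^ DIM('a)) * (\<integral>\<^sup>+s. (cmod (F s))\<^sup>2 \<partial>lborel)"
proof -
  note [measurable] = F[THEN borel_measurable_integrable]
  define c where "c = sqrt (2 * pi) ^ DIM('a)"
  have c: "c > 0" "c * c = (2 * pi) ^ DIM('a)" unfolding c_def power_mult_distrib[symmetric] by simp_all
  define M where "M = (\<integral>s. cmod (F s) \<partial>lborel)"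
  \<comment> \<open>the function whose transform is the complex conjugate of that of \<open>F\<close>\<close>
  define G where "G r = cnj (F (- r))" for r
  have [measurable]: "G \<in> borel_measurable borel"
  proof -
    have "cnj \<in> borel_measurable borel"
      by (intro borel_measurable_continuous_onI continuous_intros)
    then show ?thesis unfolding G_def[abs_def] by measurable
  qed
  have G: "integrable lborel G"
    using lborel_integrable_affine[OF F, of "-1" 0] unfolding G_def[abs_def] by simp
  have FG: "fourier G u = cnj (fourier F u)" for u
  proof -
    have "fourier (\<lambda>s. cnj (F s)) (- u) = fourier G u"
      unfolding fourier_def
      by (subst lborel_integral_affine[where c="-1" and t=0])
         (use F in \<open>auto simp: G_def intro!: integrable_cis_mult\<close>)
    then show ?thesis by (simp add: fourier_cnj)
  qed
  have G2: "(\<integral>\<^sup>+s. (cmod (G s))\<^sup>2 \<partial>lborel) = (\<integral>\<^sup>+s. (cmod (F s))\<^sup>2 \<partial>lborel)"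
    by (subst (2) nn_integral_lborel_affine[where c="-1" and t=0]) (auto simp: G_def)
  have smooth: "(\<integral>\<^sup>+u. ennreal (gaussian (t *\<^sub>R u) * (cmod (fourier F u))\<^sup>2) \<partial>lborel) \<le>
     ennreal ((2 * pi) ^ DIM('a)) * (\<integral>\<^sup>+s. (cmod (F s))\<^sup>2 \<partial>lborel)" if t: "t > 0" for t
  proof -
    define K where "K v = c * gaussian (v /\<^sub>R t) / t ^ DIM('a)" for v :: 'a
    have [measurable]: "K \<in> borel_measurable borel" unfolding K_def[abs_def] by measurable
    have K0: "K v \<ge> 0" for v using c t by (simp add: K_def gaussian_pos less_imp_le)
    have Kint: "(\<integral>\<^sup>+r. ennreal (K (s + r)) \<partial>lborel) = ennreal (c * c)" for s
    proof -
      have "(\<integral>\<^sup>+r. ennreal (K (s + r)) \<partial>lborel) = (\<integral>\<^sup>+r. ennreal (K r) \<partial>lborel)"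
        by (subst (2) nn_integral_lborel_affine[where c=1 and t=s]) auto
      also have "\<dots> = ennreal (t ^ DIM('a)) * (\<integral>\<^sup>+r. ennreal (c / t ^ DIM('a)) * ennreal (gaussian (r::'a)) \<partial>lborel)"
        by (subst nn_integral_lborel_affine[where c=t and t=0])
           (use t c in \<open>auto simp: K_def gaussian_pos less_imp_le simp flip: ennreal_mult\<close>)
      also have "\<dots> = ennreal (t ^ DIM('a)) * (ennreal (c / t ^ DIM('a)) * ennreal c)"
        by (simp add: nn_integral_cmult nn_integral_eq_integral integrable_gaussian gaussian_pos less_imp_le integral_gaussian c_def)
      also have "\<dots> = ennreal (c * c)"
        using t c by (simp flip: ennreal_mult)
      finally show ?thesis .
    qed
    define Q where "Q u = of_real (gaussian (t *\<^sub>R u)) * fourier G u" for u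
    have ig: "integrable lborel (\<lambda>u::'a. complex_of_real (gaussian (t *\<^sub>R u)))"
      using lborel_integrable_affine[OF integrable_gaussian, of t "0::'a"] t by (intro integrable_of_real) simp
    have Q: "integrable lborel Q"
      unfolding Q_def[abs_def]
    proof (rule Bochner_Integration.integrable_bound[OF integrable_mult_right[OF ig, of "of_real M"]])
      show "AE u in lborel. norm (of_real (gaussian (t *\<^sub>R u)) * fourier G u) \<le>
         norm (complex_of_real M * of_real (gaussian (t *\<^sub>R u)))"
      proof (rule AE_I2)
        fix u :: 'a
        have "cmod (fourier F u) \<le> \<bar>M\<bar>" using norm_fourier_le[OF F, of u] by (simp add: M_def)
        then show "norm (of_real (gaussian (t *\<^sub>R u)) * fourier G u) \<le>
          norm (complex_of_real M * of_real (gaussian (t *\<^sub>R u)))"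
          by (simp add: norm_mult FG mult.commute[of "\<bar>M\<bar>"] mult_left_mono gaussian_pos less_imp_le)
      qed
    qed measurable
    have FQ: "fourier Q s = (\<integral>r. G r * of_real (K (s + r)) \<partial>lborel)" for s
    proof -
      have "fourier Q s = (\<integral>u. (of_real (gaussian (t *\<^sub>R u)) * cis (u \<bullet> s)) * fourier G u \<partial>lborel)"
        unfolding fourier_def[of Q] Q_def by (simp add: mult_ac)
      also have "\<dots> = (\<integral>r. G r * fourier (\<lambda>u. of_real (gaussian (t *\<^sub>R u)) * cis (u \<bullet> s)) r \<partial>lborel)"
        by (rule fourier_parts) (auto intro!: integrable_cis_mult ig G)
      also have "\<dots> = (\<integral>r. G r * of_real (K (s + r)) \<partial>lborel)"
      proof -
        have "fourier (\<lambda>u. of_real (gaussian (t *\<^sub>R u)) * cis (u \<bullet> s)) r = of_real (K (s + r))" for r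
          using fourier_scaled_gaussian[OF t, of "s + r"] unfolding fourier_def K_def c_def
          by (simp only: mult.assoc cis_mult inner_add_right)
        then show ?thesis by simp
      qed
      finally show ?thesis .
    qed
    have "(\<integral>\<^sup>+u. ennreal (gaussian (t *\<^sub>R u) * (cmod (fourier F u))\<^sup>2) \<partial>lborel) =
       ennreal (\<integral>u. gaussian (t *\<^sub>R u) * (cmod (fourier F u))\<^sup>2 \<partial>lborel)"
    proof (rule nn_integral_eq_integral)
      have "integrable lborel (\<lambda>u. cmod (Q u) * cmod (fourier F u))"
        using norm_fourier_le[OF F]
        by (intro Bochner_Integration.integrable_bound[OF integrable_mult_right[OF integrable_norm[OF Q], of M]])
           (use Q in \<open>auto intro!: AE_I2 mult_right_mono simp: M_def[symmetric] abs_mult mult.commute[of _ "cmod (fourier F _)"]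
               intro: order_trans[OF _ abs_ge_self]\<close>)
      then show "integrable lborel (\<lambda>u. gaussian (t *\<^sub>R u) * (cmod (fourier F u))\<^sup>2)"
        by (simp add: Q_def norm_mult FG gaussian_pos less_imp_le power2_eq_square mult.assoc)
    qed (simp add: gaussian_pos less_imp_le)
    also have "\<dots> \<le> ennreal (cmod (\<integral>u. Q u * fourier F u \<partial>lborel))"
    proof -
      have "Q u * fourier F u = of_real (gaussian (t *\<^sub>R u) * (cmod (fourier F u))\<^sup>2)" for u
        by (simp add: Q_def FG complex_norm_square mult_ac del: of_real_power)
      then have "(\<integral>u. Q u * fourier F u \<partial>lborel) =
          of_real (\<integral>u. gaussian (t *\<^sub>R u) * (cmod (fourier F u))\<^sup>2 \<partial>lborel)"
        by (simp only: integral_complex_of_real)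
      then show ?thesis by (simp add: ennreal_leI)
    qed
    also have "(\<integral>u. Q u * fourier F u \<partial>lborel) = (\<integral>s. F s * fourier Q s \<partial>lborel)"
      by (rule fourier_parts[OF Q F])
    also have "ennreal (cmod \<dots>) \<le> (\<integral>\<^sup>+s. ennreal (cmod (F s)) * ennreal (cmod (fourier Q s)) \<partial>lborel)"
      by (rule order_trans[OF norm_integral_le_nn_integral]) (simp add: norm_mult ennreal_mult)
    also have "\<dots> \<le> (\<integral>\<^sup>+s. ennreal (cmod (F s)) * (\<integral>\<^sup>+r. ennreal (cmod (G r) * K (s + r)) \<partial>lborel) \<partial>lborel)"
      unfolding FQ
      by (intro nn_integral_mono mult_left_mono order_trans[OF norm_integral_le_nn_integral]) (auto simp: norm_mult K0)
    also have "\<dots> = (\<integral>\<^sup>+s. (\<integral>\<^sup>+r. ennreal (cmod (F s) * (cmod (G r) * K (s + r))) \<partial>lborel) \<partial>lborel)"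
      by (simp add: ennreal_mult K0 flip: nn_integral_cmult)
    also have "\<dots> \<le> (\<integral>\<^sup>+s. (\<integral>\<^sup>+r. ennreal ((cmod (F s))\<^sup>2 / 2) * ennreal (K (s + r)) +
         ennreal ((cmod (G r))\<^sup>2 / 2) * ennreal (K (s + r)) \<partial>lborel) \<partial>lborel)"
    proof (intro nn_integral_mono)
      fix s r :: 'a
      have "cmod (F s) * cmod (G r) \<le> (cmod (F s))\<^sup>2 / 2 + (cmod (G r))\<^sup>2 / 2"
        using sum_squares_bound[of "cmod (F s)" "cmod (G r)"] by (simp add: field_simps)
      from mult_right_mono[OF this K0[of "s + r"]]
      have "cmod (F s) * (cmod (G r) * K (s + r)) \<le> (cmod (F s))\<^sup>2 / 2 * K (s + r) + (cmod (G r))\<^sup>2 / 2 * K (s + r)"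
        by (simp add: algebra_simps)
      then show "ennreal (cmod (F s) * (cmod (G r) * K (s + r))) \<le> ennreal ((cmod (F s))\<^sup>2 / 2) * ennreal (K (s + r)) +
         ennreal ((cmod (G r))\<^sup>2 / 2) * ennreal (K (s + r))"
        using K0[of "s + r"] by (simp flip: ennreal_mult ennreal_plus)
    qed
    also have "\<dots> = (\<integral>\<^sup>+s. ennreal ((cmod (F s))\<^sup>2 / 2) * (\<integral>\<^sup>+r. ennreal (K (s + r)) \<partial>lborel) \<partial>lborel) +
        (\<integral>\<^sup>+s. (\<integral>\<^sup>+r. ennreal ((cmod (G r))\<^sup>2 / 2) * ennreal (K (s + r)) \<partial>lborel) \<partial>lborel)"
      by (simp add: nn_integral_add nn_integral_cmult)
    also have "(\<integral>\<^sup>+s. (\<integral>\<^sup>+r. ennreal ((cmod (G r))\<^sup>2 / 2) * ennreal (K (s + r)) \<partial>lborel) \<partial>lborel) =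
       (\<integral>\<^sup>+r. (\<integral>\<^sup>+s. ennreal ((cmod (G r))\<^sup>2 / 2) * ennreal (K (s + r)) \<partial>lborel) \<partial>lborel)"
      by (rule lborel_pair.Fubini'[symmetric]) measurable
    also have "\<dots> = (\<integral>\<^sup>+r. ennreal ((cmod (G r))\<^sup>2 / 2) * (\<integral>\<^sup>+s. ennreal (K (r + s)) \<partial>lborel) \<partial>lborel)"
      by (simp add: nn_integral_cmult add.commute)
    also have "(\<integral>\<^sup>+s. ennreal ((cmod (F s))\<^sup>2 / 2) * (\<integral>\<^sup>+r. ennreal (K (s + r)) \<partial>lborel) \<partial>lborel) + \<dots> =
       ennreal (c * c) * ((\<integral>\<^sup>+s. ennreal ((cmod (F s))\<^sup>2 / 2) \<partial>lborel) + (\<integral>\<^sup>+s. ennreal ((cmod (G s))\<^sup>2 / 2) \<partial>lborel))"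
      unfolding Kint by (simp add: nn_integral_multc distrib_left mult.commute[of _ "ennreal (c * c)"] nn_integral_cmult)
    also have "(\<integral>\<^sup>+s. ennreal ((cmod (F s))\<^sup>2 / 2) \<partial>lborel) + (\<integral>\<^sup>+s. ennreal ((cmod (G s))\<^sup>2 / 2) \<partial>lborel) =
       (\<integral>\<^sup>+s. ennreal ((cmod (F s))\<^sup>2) \<partial>lborel)"
    proof -
      have h: "ennreal (x\<^sup>2 / 2) = ennreal (1/2) * ennreal (x\<^sup>2)" for x :: real
        by (subst ennreal_mult[symmetric]) simp_all
      have "ennreal (1/2) * x + ennreal (1/2) * x = x" for x
        unfolding distrib_right[symmetric] by (subst ennreal_plus[symmetric]) simp_all
      then show ?thesis by (simp only: h nn_integral_cmult G2 measurable_lborel1) (simp add: nn_integral_cmult G2)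
    qed
    finally show ?thesis by (simp add: c)
  qed
  have "(\<integral>\<^sup>+u. (cmod (fourier F u))\<^sup>2 \<partial>lborel) =
     (\<integral>\<^sup>+u. liminf (\<lambda>n. ennreal (gaussian ((1 / Suc n) *\<^sub>R u) * (cmod (fourier F u))\<^sup>2)) \<partial>lborel)"
  proof (intro nn_integral_cong)
    fix u :: 'a
    have "(\<lambda>n. gaussian ((1 / Suc n) *\<^sub>R u)) \<longlonglongrightarrow> exp (- (norm (0 *\<^sub>R u))\<^sup>2 / 2)"
      unfolding gaussian_def by (intro tendsto_intros LIMSEQ_Suc[OF lim_1_over_n]) simp
    then have "(\<lambda>n. ennreal (gaussian ((1 / Suc n) *\<^sub>R u) * (cmod (fourier F u))\<^sup>2)) \<longlonglongrightarrow> ennreal (1 * (cmod (fourier F u))\<^sup>2)"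
      by (intro tendsto_ennrealI tendsto_mult tendsto_const) simp
    then show "ennreal ((cmod (fourier F u))\<^sup>2) = liminf (\<lambda>n. ennreal (gaussian ((1 / Suc n) *\<^sub>R u) * (cmod (fourier F u))\<^sup>2))"
      by (simp add: lim_imp_Liminf)
  qed
  also have "\<dots> \<le> liminf (\<lambda>n. \<integral>\<^sup>+u. ennreal (gaussian ((1 / Suc n) *\<^sub>R u) * (cmod (fourier F u))\<^sup>2) \<partial>lborel)"
    by (rule nn_integral_liminf) measurable
  also have "\<dots> \<le> ennreal ((2 * pi) ^ DIM('a)) * (\<integral>\<^sup>+s. (cmod (F s))\<^sup>2 \<partial>lborel)"
    by (rule Liminf_le[OF sequentially_bot], rule always_eventually, rule allI, rule smooth) simp
  finally show ?thesis .
qed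

section \<open>Orthogonal maps and logarithmic coordinates\<close>

text \<open>
  The image measure \<open>\<nu>\<close> is again invariant under translations. Evaluating the double integral of
  \<open>g y * indicator A (x + y)\<close> in both orders, for \<open>g\<close> the indicator of the unit ball, shows that \<open>\<nu>\<close>
  and Lebesgue measure are proportional. The constant is one since \<open>T\<close> preserves the unit ball.
\<close>

lemma lborel_orthogonal:
  fixes T :: "'a::euclidean_space \<Rightarrow> 'a"
  assumes lin: "linear T" and nrm: "\<And>x. norm (T x) = norm x" and surj: "surj T"
  shows "distr lborel borel T = lborel"
proof (rule measure_eqI)
  define \<nu> where "\<nu> = distr lborel borel T"
  have T[measurable]: "T \<in> borel_measurable borel"
    by (intro borel_measurable_continuous_onI linear_continuous_on_compose[OF continuous_on_id lin, simplified])
  \<comment> \<open>the image measure is translation invariant because \<open>T\<close> is onto\<close>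
  have shift: "(\<integral>\<^sup>+x. f x \<partial>\<nu>) = (\<integral>\<^sup>+x. f (x + y) \<partial>\<nu>)" if [measurable]: "f \<in> borel_measurable borel" for f and y :: 'a
  proof -
    obtain z where z: "y = T z" using surj by (metis surjD)
    have "(\<integral>\<^sup>+x. f x \<partial>\<nu>) = (\<integral>\<^sup>+x. f (T x) \<partial>lborel)"
      by (simp add: \<nu>_def nn_integral_distr)
    also have "\<dots> = (\<integral>\<^sup>+x. f (T (z + x)) \<partial>lborel)"
      by (subst nn_integral_lborel_affine[where c=1 and t=z]) auto
    also have "\<dots> = (\<integral>\<^sup>+x. f (T x + y) \<partial>lborel)"
      by (simp add: linear_add[OF lin] z add.commute)
    also have "\<dots> = (\<integral>\<^sup>+x. f (x + y) \<partial>\<nu>)"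
      by (simp add: \<nu>_def nn_integral_distr)
    finally show ?thesis .
  qed
  define g where "g = (indicator (cball 0 1) :: 'a \<Rightarrow> ennreal)"
  have [measurable]: "g \<in> borel_measurable borel" unfolding g_def by (intro borel_measurable_indicator borel_closed) simp
  have gT: "(\<integral>\<^sup>+x. g x \<partial>\<nu>) = (\<integral>\<^sup>+x. g x \<partial>lborel)"
    by (simp add: \<nu>_def nn_integral_distr g_def indicator_def nrm)
  have g_fin: "(\<integral>\<^sup>+x. g x \<partial>lborel) \<noteq> \<infinity>"
    using emeasure_compact_finite[of "cball 0 1 :: 'a set"] by (simp add: g_def)
  have "emeasure lborel (ball 0 1 :: 'a set) \<noteq> 0"
    using content_ball_pos[of 1 "0::'a"] by (auto simp: measure_def)
  then have g_pos: "(\<integral>\<^sup>+x. g x \<partial>lborel) \<noteq> 0"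
    using emeasure_mono[OF ball_subset_cball[of "0::'a" 1], of lborel] by (auto simp: g_def)
  fix A :: "'a set" assume "A \<in> sets (distr lborel borel T)"
  then have [measurable]: "A \<in> sets borel" by simp
  have sf: "sigma_finite_measure \<nu>"
  proof (rule sigma_finite_measure.intro, intro exI conjI)
    show "countable (range (\<lambda>n::nat. ball (0::'a) (real n)))" by simp
    show "range (\<lambda>n::nat. ball (0::'a) (real n)) \<subseteq> sets \<nu>" by (auto simp: \<nu>_def)
    have "\<exists>n::nat. norm x < real n" for x :: 'a using reals_Archimedean2 by blast
    then show "(\<Union>n. ball (0::'a) (real n)) = space \<nu>" by (auto simp: \<nu>_def)
    have "emeasure \<nu> (ball 0 (real n)) = emeasure lborel (ball (0::'a) (real n))" for n
      by (simp add: \<nu>_def emeasure_distr vimage_def nrm ball_def)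
    then show "\<forall>a\<in>range (\<lambda>n::nat. ball (0::'a) (real n)). emeasure \<nu> a \<noteq> \<infinity>"
      using emeasure_lborel_ball_finite[of "0::'a"] by (auto simp: less_top)
  qed
  interpret P: pair_sigma_finite \<nu> "lborel :: 'a measure" using sf sigma_finite_lborel by (simp add: pair_sigma_finite_def)
  have [measurable_cong]: "sets \<nu> = sets borel" by (simp add: \<nu>_def)
  have "emeasure \<nu> A * (\<integral>\<^sup>+y. g y \<partial>lborel) = (\<integral>\<^sup>+y. g y * emeasure \<nu> A \<partial>lborel)"
    by (simp add: nn_integral_multc mult.commute)
  also have "\<dots> = (\<integral>\<^sup>+y. (\<integral>\<^sup>+x. g y * indicator A (x + y) \<partial>\<nu>) \<partial>lborel)"
    using shift[of "indicator A"] by (simp add: nn_integral_cmult)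
  also have "\<dots> = (\<integral>\<^sup>+x. (\<integral>\<^sup>+y. g y * indicator A (x + y) \<partial>lborel) \<partial>\<nu>)"
    by (rule P.Fubini') measurable
  also have "\<dots> = (\<integral>\<^sup>+x. (\<integral>\<^sup>+y. g (y - x) * indicator A y \<partial>lborel) \<partial>\<nu>)"
  proof (rule nn_integral_cong)
    fix x :: 'a
    show "(\<integral>\<^sup>+y. g y * indicator A (x + y) \<partial>lborel) = (\<integral>\<^sup>+y. g (y - x) * indicator A y \<partial>lborel)"
      using nn_integral_lborel_affine[of "\<lambda>y. g (y - x) * indicator A y" 1 x] by simp
  qed
  also have "\<dots> = (\<integral>\<^sup>+y. (\<integral>\<^sup>+x. g (y - x) * indicator A y \<partial>\<nu>) \<partial>lborel)"
    by (rule P.Fubini'[symmetric]) measurable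
  also have "\<dots> = (\<integral>\<^sup>+y. (\<integral>\<^sup>+x. g x \<partial>\<nu>) * indicator A y \<partial>lborel)"
  proof (intro nn_integral_cong)
    fix y :: 'a
    have "(\<integral>\<^sup>+x. g (y - x) * indicator A y \<partial>\<nu>) = (\<integral>\<^sup>+x. g (x - y) \<partial>\<nu>) * indicator A y"
      by (simp add: nn_integral_multc g_def norm_minus_commute indicator_def)
    also have "(\<integral>\<^sup>+x. g (x - y) \<partial>\<nu>) = (\<integral>\<^sup>+x. g x \<partial>\<nu>)"
      by (subst shift[of _ y]) auto
    finally show "(\<integral>\<^sup>+x. g (y - x) * indicator A y \<partial>\<nu>) = (\<integral>\<^sup>+x. g x \<partial>\<nu>) * indicator A y" .
  qed
  also have "\<dots> = emeasure lborel A * (\<integral>\<^sup>+y. g y \<partial>lborel)"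
    by (subst nn_integral_cmult) (simp_all add: gT mult.commute)
  finally have "(\<integral>\<^sup>+y. g y \<partial>lborel) * emeasure \<nu> A = (\<integral>\<^sup>+y. g y \<partial>lborel) * emeasure lborel A"
    by (simp only: mult.commute)
  then show "emeasure (distr lborel borel T) A = emeasure lborel A"
    using g_fin g_pos by (simp add: \<nu>_def ennreal_mult_cancel_left)
qed simp

text \<open>
  The substitution rule on compact intervals and monotone convergence.
\<close>

lemma nn_integral_exp_subst:
  fixes h :: "real \<Rightarrow> ennreal"
  assumes [measurable]: "h \<in> borel_measurable borel"
  shows "(\<integral>\<^sup>+y. h y * indicator {0<..} y \<partial>lborel) = (\<integral>\<^sup>+x. h (exp x) * ennreal (exp x) \<partial>lborel)"
proof -
  have 1: "(\<integral>\<^sup>+y. h y * indicator {exp (- real (Suc n))..exp (real (Suc n))} y \<partial>lborel) =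
      (\<integral>\<^sup>+x. h (exp x) * ennreal (exp x) * indicator {- real (Suc n)..real (Suc n)} x \<partial>lborel)" for n
    by (rule nn_integral_substitution_aux[where f=h and g=exp and g'=exp and a="- real (Suc n)" and b="real (Suc n)"])
       (auto intro!: derivative_eq_intros continuous_intros)
  have l: "(\<lambda>n. \<integral>\<^sup>+y. h y * indicator {exp (- real (Suc n))..exp (real (Suc n))} y \<partial>lborel) \<longlonglongrightarrow> (\<integral>\<^sup>+y. h y * indicator {0<..} y \<partial>lborel)"
  proof (rule nn_integral_LIMSEQ)
    show "incseq (\<lambda>n y. h y * indicator {exp (- real (Suc n))..exp (real (Suc n))} y)"
    proof (unfold incseq_def le_fun_def, intro allI impI mult_left_mono)
      fix m n :: nat and y :: real assume "m \<le> n"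
      then have "{exp (- real (Suc m))..exp (real (Suc m))} \<subseteq> {exp (- real (Suc n))..exp (real (Suc n))}"
        by (simp add: atLeastatMost_subset_iff)
      moreover have "A \<subseteq> B \<Longrightarrow> indicator A y \<le> (indicator B y :: ennreal)" for A B
        by (auto simp: indicator_def)
      ultimately show "indicator {exp (- real (Suc m))..exp (real (Suc m))} y \<le> (indicator {exp (- real (Suc n))..exp (real (Suc n))} y :: ennreal)"
        by blast
    qed simp
    show "(\<lambda>n. h y * indicator {exp (- real (Suc n))..exp (real (Suc n))} y) \<longlonglongrightarrow> h y * indicator {0<..} y" for y
    proof (cases "y > 0")
      case True
      obtain N where N: "real N \<ge> \<bar>ln y\<bar>" using real_arch_simple by blast
      have "exp (- real (Suc n)) \<le> y" "y \<le> exp (real (Suc n))" if "n \<ge> N" for n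
      proof -
        have "- real (Suc n) \<le> ln y" "ln y \<le> real (Suc n)" using N that by auto
        then show "exp (- real (Suc n)) \<le> y" "y \<le> exp (real (Suc n))"
          using True by (simp_all only: ln_ge_iff) (metis exp_le_cancel_iff exp_ln)
      qed
      then have "\<forall>\<^sub>F n in sequentially. h y * indicator {exp (- real (Suc n))..exp (real (Suc n))} y = h y * indicator {0<..} y"
        using True by (auto intro!: eventually_sequentiallyI[of N])
      then show ?thesis by (rule tendsto_eventually)
    next
      case False
      then have "y \<notin> {exp (- real (Suc n))..exp (real (Suc n))}" for n using exp_gt_zero[of "- real (Suc n)"] by (auto simp del: exp_gt_zero of_nat_Suc)
      then show ?thesis using False by simp
    qed
  qed simp
  have r: "(\<lambda>n. \<integral>\<^sup>+x. h (exp x) * ennreal (exp x) * indicator {- real (Suc n)..real (Suc n)} x \<partial>lborel) \<longlonglongrightarrow> (\<integral>\<^sup>+x. h (exp x) * ennreal (exp x) \<partial>lborel)"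
  proof (rule nn_integral_LIMSEQ)
    show "incseq (\<lambda>n x. h (exp x) * ennreal (exp x) * indicator {- real (Suc n)..real (Suc n)} x)"
      by (auto simp: incseq_def le_fun_def intro!: mult_left_mono split: split_indicator)
    show "(\<lambda>n. h (exp x) * ennreal (exp x) * indicator {- real (Suc n)..real (Suc n)} x) \<longlonglongrightarrow> h (exp x) * ennreal (exp x)" for x
    proof -
      obtain N where N: "real N \<ge> \<bar>x\<bar>" using real_arch_simple by blast
      have "\<forall>\<^sub>F n in sequentially. h (exp x) * ennreal (exp x) * indicator {- real (Suc n)..real (Suc n)} x = h (exp x) * ennreal (exp x)"
        by (rule eventually_sequentiallyI[of N]) (use N in \<open>auto split: split_indicator\<close>)
      then show ?thesis by (rule tendsto_eventually)
    qed
  qed simp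
  show ?thesis using l r unfolding 1 by (rule LIMSEQ_unique)
qed

lemma Basis_vec_real: "(Basis :: (real^'d) set) = (\<lambda>l. axis l 1) ` UNIV"
  by (auto simp: Basis_vec_def)

lemma prod_Basis_vec: "(\<Prod>b\<in>(Basis :: (real^'d) set). F b) = (\<Prod>l\<in>UNIV. F (axis l 1))"
  unfolding Basis_vec_real by (subst prod.reindex) (auto simp: inj_on_def axis_eq_axis)

lemma nn_integral_vec_prod:
  fixes f :: "'d::finite \<Rightarrow> real \<Rightarrow> ennreal"
  assumes [measurable]: "\<And>l. f l \<in> borel_measurable borel"
  shows "(\<integral>\<^sup>+x. (\<Prod>l\<in>UNIV. f l (x $ l)) \<partial>(lborel :: (real^'d) measure)) = (\<Prod>l\<in>UNIV. \<integral>\<^sup>+x. f l x \<partial>lborel)"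
proof -
  define ix where "ix b = (THE l. b = axis l (1::real))" for b :: "real^'d"
  have ix: "ix (axis l 1) = l" for l
    unfolding ix_def by (rule the_equality) (auto simp: axis_eq_axis)
  have "(\<integral>\<^sup>+x. (\<Prod>b\<in>Basis. f (ix b) (x \<bullet> b)) \<partial>(lborel :: (real^'d) measure)) = (\<Prod>b\<in>(Basis::(real^'d) set). \<integral>\<^sup>+x. f (ix b) x \<partial>lborel)"
    by (rule nn_integral_lborel_prod) auto
  then show ?thesis by (simp add: prod_Basis_vec ix inner_axis)
qed

definition exp_vec :: "real^'d \<Rightarrow> real^'d" where
  "exp_vec u = (\<chi> l. exp (u $ l))"

text \<open>
  The Jacobian determinant of \<open>exp_vec\<close>.
\<close>

definition jac :: "real^'d \<Rightarrow> real" where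
  "jac u = exp (\<Sum>l\<in>UNIV. u $ l)"

lemma exp_vec_measurable [measurable]: "exp_vec \<in> borel_measurable borel"
  unfolding exp_vec_def[abs_def] by (intro borel_measurable_continuous_onI continuous_intros)

lemma jac_measurable [measurable]: "jac \<in> borel_measurable borel"
  unfolding jac_def[abs_def] by (intro borel_measurable_continuous_onI continuous_intros)

lemma box_vec: "box a (b::real^'d) = {x. \<forall>l. a $ l < x $ l \<and> x $ l < b $ l}"
  by (auto simp: mem_box_cart)

lemma indicator_box_vec:
  "indicator (box a (b::real^'d)) x = (\<Prod>l\<in>UNIV. indicator {a $ l<..<b $ l} (x $ l) :: ennreal)"
  by (auto simp: box_vec indicator_def prod_zero_iff)

text \<open>
  Both sides define measures on the Borel sets. On boxes they are products of one-dimensional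
  integrals, to which \<open>nn_integral_exp_subst\<close> applies.
\<close>

lemma nn_integral_positive_orthant:
  fixes h :: "real^'d \<Rightarrow> ennreal"
  assumes [measurable]: "h \<in> borel_measurable borel"
  shows "(\<integral>\<^sup>+x. h x * indicator {x. \<forall>l. x $ l > 0} x \<partial>lborel) = (\<integral>\<^sup>+u. h (exp_vec u) * ennreal (jac u) \<partial>lborel)"
proof -
  let ?P = "{x::real^'d. \<forall>l. x $ l > 0}"
  have [measurable]: "?P \<in> sets borel" by measurable
  define M1 where "M1 = density lborel (indicator ?P :: _ \<Rightarrow> ennreal)"
  define M2 where "M2 = distr (density lborel (\<lambda>u. ennreal (jac u))) borel (exp_vec :: real^'d \<Rightarrow> _)"
  have box_eq: "emeasure M1 (box a b) = emeasure M2 (box a b)" for a b :: "real^'d"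
  proof -
    have "emeasure M1 (box a b) = (\<integral>\<^sup>+x. (\<Prod>l\<in>UNIV. indicator {a $ l<..<b $ l} (x $ l) * indicator {0<..} (x $ l)) \<partial>lborel)"
      unfolding M1_def
    proof (subst emeasure_density)
      have "indicator ?P x = (\<Prod>l\<in>UNIV. indicator {0<..} (x $ l) :: ennreal)" for x
        by (auto simp: indicator_def prod_zero_iff)
      then show "(\<integral>\<^sup>+x. indicator ?P x * indicator (box a b) x \<partial>lborel) =
        (\<integral>\<^sup>+x. (\<Prod>l\<in>UNIV. indicator {a $ l<..<b $ l} (x $ l) * indicator {0<..} (x $ l)) \<partial>lborel)"
        by (simp only: prod.distrib indicator_box_vec mult.commute)
    qed auto
    also have "\<dots> = (\<Prod>l\<in>UNIV. \<integral>\<^sup>+x. indicator {a $ l<..<b $ l} x * indicator {0<..} x \<partial>lborel)"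
      by (rule nn_integral_vec_prod) measurable
    also have "\<dots> = (\<Prod>l\<in>UNIV. \<integral>\<^sup>+x. indicator {a $ l<..<b $ l} (exp x) * ennreal (exp x) \<partial>lborel)"
      by (subst nn_integral_exp_subst) auto
    also have "\<dots> = (\<integral>\<^sup>+x. (\<Prod>l\<in>UNIV. indicator {a $ l<..<b $ l} (exp (x $ l)) * ennreal (exp (x $ l))) \<partial>lborel)"
      by (rule nn_integral_vec_prod[symmetric]) measurable
    also have "\<dots> = (\<integral>\<^sup>+x. ennreal (jac x) * indicator (box a b) (exp_vec x) \<partial>lborel)"
      by (simp add: prod.distrib indicator_box_vec exp_vec_def jac_def exp_sum prod_ennreal mult.commute)
    also have "\<dots> = emeasure M2 (box a b)"
    proof -
      have "exp_vec -` box a b \<in> sets borel" by (rule measurable_sets_borel[OF exp_vec_measurable]) simp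
      then show ?thesis unfolding M2_def by (simp add: emeasure_distr emeasure_density indicator_vimage)
    qed
    finally show ?thesis .
  qed
  have "M1 = M2"
  proof (rule measure_eqI_generator_eq)
    let ?E = "range (\<lambda>(a, b). box a b::(real^'d) set)"
    show "Int_stable ?E"
      by (auto simp: Int_stable_def box_Int_box)
    show "?E \<subseteq> Pow UNIV" "sets M1 = sigma_sets UNIV ?E" "sets M2 = sigma_sets UNIV ?E"
      by (simp_all add: borel_eq_box M1_def M2_def)
    let ?A = "\<lambda>n::nat. box (- (real n *\<^sub>R One)) (real n *\<^sub>R One) :: (real^'d) set"
    show "range ?A \<subseteq> ?E" "(\<Union>i. ?A i) = UNIV"
      unfolding UN_box_eq_UNIV by auto
    show "emeasure M1 (?A i) \<noteq> \<infinity>" for i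
    proof -
      have "emeasure M1 (?A i) \<le> emeasure lborel (?A i)"
        unfolding M1_def by (subst emeasure_density)
          (auto simp: indicator_def nn_integral_indicator[symmetric] simp del: nn_integral_indicator intro!: nn_integral_mono)
      also have "\<dots> < \<infinity>" by (rule emeasure_bounded_finite) (rule bounded_box)
      finally show ?thesis by simp
    qed
    show "emeasure M1 X = emeasure M2 X" if "X \<in> ?E" for X
      using that box_eq by auto
  qed
  then have "(\<integral>\<^sup>+x. h x \<partial>M1) = (\<integral>\<^sup>+x. h x \<partial>M2)" by simp
  then show ?thesis
    unfolding M1_def M2_def
    by (simp add: nn_integral_density nn_integral_distr mult.commute)
qed

lemma diag_map_eq: "(\<Sum>j\<in>(Basis::(real^'d) set). (x \<bullet> j * (v \<bullet> j)) *\<^sub>R j) = (\<chi> l. v $ l * x $ l)"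
proof -
  have "x \<bullet> j * (v \<bullet> j) = (\<chi> l. v $ l * x $ l) \<bullet> j" if "j \<in> Basis" for j
    using that by (auto simp: Basis_vec_real inner_axis)
  then have "(\<Sum>j\<in>(Basis::(real^'d) set). (x \<bullet> j * (v \<bullet> j)) *\<^sub>R j) = (\<Sum>j\<in>Basis. ((\<chi> l. v $ l * x $ l) \<bullet> j) *\<^sub>R j)"
    by simp
  then show ?thesis by (simp only: euclidean_representation)
qed

lemma nn_integral_diagonal:
  fixes h :: "real^'d \<Rightarrow> ennreal" and v :: "real^'d"
  assumes [measurable]: "h \<in> borel_measurable borel" and v: "\<And>l. v $ l \<noteq> 0"
  shows "(\<integral>\<^sup>+x. h x \<partial>lborel) = ennreal \<bar>\<Prod>l\<in>UNIV. v $ l\<bar> * (\<integral>\<^sup>+x. h (\<chi> l. v $ l * x $ l) \<partial>lborel)"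
proof -
  have *: "0 + (\<Sum>j\<in>Basis. (v \<bullet> j * (x \<bullet> j)) *\<^sub>R j) = (\<chi> l. v $ l * x $ l)" for x
    using diag_map_eq[of x v] by (simp add: mult.commute)
  have [measurable]: "(\<lambda>x::real^'d. \<chi> l. v $ l * x $ l) \<in> borel_measurable borel"
    by (intro borel_measurable_continuous_onI continuous_intros)
  have "lborel = density (distr lborel borel (\<lambda>x. \<chi> l. v $ l * x $ l)) (\<lambda>_. \<Prod>j\<in>(Basis::(real^'d) set). \<bar>v \<bullet> j\<bar>)"
    unfolding *[symmetric]
    by (rule lborel_affine_euclidean) (use v in \<open>auto simp: Basis_vec_real inner_axis\<close>)
  then have "(\<integral>\<^sup>+x. h x \<partial>lborel) = (\<integral>\<^sup>+x. h x \<partial>density (distr lborel borel (\<lambda>x. \<chi> l. v $ l * x $ l)) (\<lambda>_. \<Prod>j\<in>(Basis::(real^'d) set). \<bar>v \<bullet> j\<bar>))"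
    by simp
  also have "\<dots> = ennreal \<bar>\<Prod>l\<in>UNIV. v $ l\<bar> * (\<integral>\<^sup>+x. h (\<chi> l. v $ l * x $ l) \<partial>lborel)"
    by (simp add: nn_integral_density nn_integral_distr nn_integral_cmult prod_Basis_vec inner_axis abs_prod)
  finally show ?thesis .
qed

lemma nn_integral_orthogonal_matrix:
  fixes C :: "real^'d^'d"
  assumes [measurable]: "h \<in> borel_measurable borel" and C: "orthogonal_matrix C"
  shows "(\<integral>\<^sup>+x. h x \<partial>lborel) = (\<integral>\<^sup>+x. h (C *v x) \<partial>lborel)"
proof -
  have o: "orthogonal_transformation ((*v) C)"
    using C by (simp add: orthogonal_transformation_matrix)
  have [measurable]: "(*v) C \<in> borel_measurable borel"
    by (intro borel_measurable_continuous_onI matrix_vector_mult_linear_continuous_on)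
  have "distr lborel borel ((*v) C) = lborel"
    by (rule lborel_orthogonal) (use o in \<open>auto simp: orthogonal_transformation_norm orthogonal_transformation_surj\<close>)
  then have "(\<integral>\<^sup>+x. h x \<partial>lborel) = (\<integral>\<^sup>+x. h x \<partial>distr lborel borel ((*v) C))" by simp
  then show ?thesis by (simp add: nn_integral_distr)
qed

text \<open>
  Logarithmic coordinates on the image under \<open>C\<close> of the open hyperoctant with signs \<open>e\<close>.
\<close>

definition chart :: "real^'d^'d \<Rightarrow> real^'d \<Rightarrow> real^'d \<Rightarrow> real^'d" where
  "chart C e u = C *v (\<chi> l. e $ l * exp (u $ l))"

lemma chart_measurable [measurable]: "chart C e \<in> borel_measurable borel"
  unfolding chart_def[abs_def]
  by (intro borel_measurable_continuous_onI continuous_intros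
     continuous_on_compose2[OF matrix_vector_mult_linear_continuous_on]) auto

lemma finite_sign_vectors: "finite (sign_vectors :: (real^'d) set)"
proof -
  have "(sign_vectors :: (real^'d) set) = (\<lambda>f. \<chi> l. f l) ` (UNIV \<rightarrow>\<^sub>E {-1, 1::real})"
  proof (intro set_eqI iffI)
    fix e :: "real^'d" assume "e \<in> sign_vectors"
    then show "e \<in> (\<lambda>f. \<chi> l. f l) ` (UNIV \<rightarrow>\<^sub>E {-1, 1::real})"
      by (intro image_eqI[of _ _ "\<lambda>l. e $ l"]) (auto simp: sign_vectors_def)
  qed (auto simp: sign_vectors_def PiE_iff)
  moreover have "finite (UNIV \<rightarrow>\<^sub>E {-1, 1::real} :: ('d \<Rightarrow> real) set)"
    by (rule finite_PiE) auto
  ultimately show ?thesis by (metis finite_imageI)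
qed

text \<open>
  The hyperoctants cover the space up to the coordinate hyperplanes, which are null; orthogonal
  maps and reflections preserve the measure.
\<close>

lemma nn_integral_chart:
  fixes C :: "real^'d^'d" and h :: "real^'d \<Rightarrow> ennreal"
  assumes [measurable]: "h \<in> borel_measurable borel" and C: "orthogonal_matrix C"
  shows "(\<integral>\<^sup>+x. h x \<partial>lborel) = (\<Sum>e\<in>sign_vectors. \<integral>\<^sup>+u. h (chart C e u) * ennreal (jac u) \<partial>lborel)"
proof -
  have [measurable]: "(*v) C \<in> borel_measurable borel"
    by (intro borel_measurable_continuous_onI matrix_vector_mult_linear_continuous_on)
  define O' where "O' e = {x::real^'d. \<forall>l. e $ l * x $ l > 0}" for e
  have [measurable]: "O' e \<in> sets borel" for e unfolding O'_def by measurable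
  have AE: "AE x in lborel. (\<Sum>e\<in>sign_vectors. indicator (O' e) x :: ennreal) = 1"
  proof -
    have "AE x in lborel. \<forall>l\<in>UNIV. (x::real^'d) $ l \<noteq> 0"
    proof (rule AE_finite_allI)
      fix l :: 'd
      have "negligible {x::real^'d. axis l 1 \<bullet> x = 0}"
        by (rule negligible_hyperplane) (simp add: axis_eq_0_iff)
      then have "{x::real^'d. x $ l = 0} \<in> null_sets lborel"
        by (simp add: inner_axis' negligible_iff_null_sets null_sets_completion_iff)
      from AE_not_in[OF this] show "AE x in lborel. (x::real^'d) $ l \<noteq> 0" by simp
    qed simp
    then show ?thesis
    proof eventually_elim
      case (elim x)
      define e0 where "e0 = (\<chi> l. sgn (x $ l))"
      have "e0 \<in> sign_vectors" using elim by (auto simp: e0_def sign_vectors_def sgn_if)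
      moreover have "indicator (O' e) x = (if e = e0 then 1 else 0 :: ennreal)" if "e \<in> sign_vectors" for e
      proof -
        have "(\<forall>l. e $ l * x $ l > 0) \<longleftrightarrow> (\<forall>l. e $ l = sgn (x $ l))"
        proof -
          have "e $ l * x $ l > 0 \<longleftrightarrow> e $ l = sgn (x $ l)" for l
          proof -
            have "e $ l = - 1 \<or> e $ l = 1" "x $ l \<noteq> 0" using that elim by (auto simp: sign_vectors_def)
            then show ?thesis by (auto simp: sgn_if)
          qed
          then show ?thesis by simp
        qed
        then show ?thesis by (auto simp: O'_def indicator_def e0_def vec_eq_iff)
      qed
      ultimately show ?case by (simp add: finite_sign_vectors)
    qed
  qed
  have "(\<integral>\<^sup>+x. h x \<partial>lborel) = (\<integral>\<^sup>+x. h (C *v x) \<partial>lborel)"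
    by (rule nn_integral_orthogonal_matrix[OF _ C]) simp
  also have "\<dots> = (\<integral>\<^sup>+x. h (C *v x) * (\<Sum>e\<in>sign_vectors. indicator (O' e) x) \<partial>lborel)"
    by (rule nn_integral_cong_AE) (use AE in \<open>eventually_elim, simp\<close>)
  also have "\<dots> = (\<Sum>e\<in>sign_vectors. \<integral>\<^sup>+x. h (C *v x) * indicator (O' e) x \<partial>lborel)"
    by (simp add: sum_distrib_left nn_integral_sum)
  also have "\<dots> = (\<Sum>e\<in>sign_vectors. \<integral>\<^sup>+u. h (chart C e u) * ennreal (jac u) \<partial>lborel)"
  proof (rule sum.cong[OF refl])
    fix e :: "real^'d" assume e: "e \<in> sign_vectors"
    then have e2: "e $ l * e $ l = 1" "e $ l \<noteq> 0" "\<bar>e $ l\<bar> = 1" for l by (auto simp: sign_vectors_def dest: spec[of _ l])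
    have [measurable]: "(\<lambda>x::real^'d. \<chi> l. e $ l * x $ l) \<in> borel_measurable borel"
      by (intro borel_measurable_continuous_onI continuous_intros)
    have "(\<integral>\<^sup>+x. h (C *v x) * indicator (O' e) x \<partial>lborel) =
      (\<integral>\<^sup>+x. h (C *v (\<chi> l. e $ l * x $ l)) * indicator (O' e) (\<chi> l. e $ l * x $ l) \<partial>lborel)"
      by (subst nn_integral_diagonal[where v=e]) (auto simp: e2 abs_prod)
    also have "\<dots> = (\<integral>\<^sup>+x. h (C *v (\<chi> l. e $ l * x $ l)) * indicator {x. \<forall>l. x $ l > 0} x \<partial>lborel)"
      by (simp add: O'_def indicator_def e2 flip: mult.assoc)
    also have "\<dots> = (\<integral>\<^sup>+u. h (C *v (\<chi> l. e $ l * exp_vec u $ l)) * ennreal (jac u) \<partial>lborel)"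
      by (rule nn_integral_positive_orthant[where h="\<lambda>x. h (C *v (\<chi> l. e $ l * x $ l))"]) measurable
    finally show "(\<integral>\<^sup>+x. h (C *v x) * indicator (O' e) x \<partial>lborel) = (\<integral>\<^sup>+u. h (chart C e u) * ennreal (jac u) \<partial>lborel)"
      by (simp add: chart_def exp_vec_def)
  qed
  finally show ?thesis .
qed

section \<open>Null vectors of a singular matrix field\<close>

text \<open>
  Row \<open>j\<close> of \<open>A\<close> is replaced by a unit vector, which has the same effect as deleting a row and a
  column but keeps the size, and with it the index type.
\<close>

definition adjugate :: "'a::comm_ring_1^'n^'n \<Rightarrow> 'a^'n^'n" where
  "adjugate A = (\<chi> i j. det (\<chi> r. if r = j then axis i 1 else A $ r))"

text \<open>
  The determinant is linear in row \<open>j\<close>, so an entry of the product is the determinant of \<open>A\<close> with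
  row \<open>j\<close> replaced by row \<open>m\<close>, and this matrix has two equal rows if \<open>m \<noteq> j\<close>.
\<close>

lemma adjugate_right:
  fixes A :: "'a::comm_ring_1^'n^'n"
  shows "A ** adjugate A = mat (det A)"
proof -
  have "(A ** adjugate A) $ m $ j = (mat (det A) :: 'a^'n^'n) $ m $ j" for m j
  proof -
    have "(A ** adjugate A) $ m $ j =
      (\<Sum>i\<in>UNIV. det (\<chi> r. if r = j then A $ m $ i *s axis i 1 else A $ r))"
      unfolding matrix_matrix_mult_def adjugate_def
      by (simp add: det_row_mul)
    also have "\<dots> = det (\<chi> r. if r = j then (\<Sum>i\<in>UNIV. A $ m $ i *s axis i 1) else A $ r)"
      by (rule det_linear_row_sum[symmetric]) simp
    also have "(\<Sum>i\<in>UNIV. A $ m $ i *s axis i 1) = A $ m"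
      by (simp add: vec_eq_iff axis_def if_distrib cong: if_cong)
    also have "det (\<chi> r. if r = j then A $ m else A $ r) = (if m = j then det A else 0)"
    proof (cases "m = j")
      case True
      have "(\<chi> r. if r = j then A $ m else A $ r) = A" using True by (simp add: vec_eq_iff)
      with True show ?thesis by simp
    next
      case False
      have "det (\<chi> r. if r = j then A $ m else A $ r) = 0"
        by (rule det_identical_rows[of m j]) (use False in \<open>auto simp: row_def vec_eq_iff\<close>)
      with False show ?thesis by simp
    qed
    finally show ?thesis by (simp add: mat_def)
  qed
  then show ?thesis by (simp add: vec_eq_iff)
qed

lemma poly_det: "poly (det M) t = det (\<chi> i j. poly (M $ i $ j) t)"
  for M :: "'a::comm_ring_1 poly^'n^'n"
proof -
  have "poly (of_int k) t = (of_int k :: 'a)" for k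
    by (induction k rule: int_induct[where k=0]) auto
  then show ?thesis by (simp add: det_def poly_sum poly_prod)
qed

text \<open>
  The matrix \<open>P + t I\<close>, as a matrix over the polynomials in \<open>t\<close>.
\<close>

definition pencil :: "complex^'n^'n \<Rightarrow> complex poly^'n^'n" where
  "pencil P = (\<chi> i j. [:P $ i $ j, if i = j then 1 else 0:])"

text \<open>
  As a polynomial in \<open>t\<close>, the determinant of \<open>I + t P\<close> is one at \<open>t = 0\<close>. Hence it is nonzero at
  some \<open>t \<noteq> 0\<close>, and there \<open>P + (1 / t) I\<close> is invertible.
\<close>

lemma det_pencil_nonzero:
  fixes P :: "complex^'n^'n"
  shows "det (pencil P) \<noteq> 0"
proof -
  define Q where "Q = det (\<chi> i j. [:if i = j then 1 else 0, P $ i $ j:])"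
  have "poly Q 0 = det (mat 1 :: complex^'n^'n)"
    unfolding Q_def poly_det by (simp add: mat_def)
  then have "Q \<noteq> 0" by auto
  then have "finite ({t. poly Q t = 0} \<union> {0})" by (simp add: poly_roots_finite)
  then obtain t where t: "poly Q t \<noteq> 0" "t \<noteq> 0"
    using infinite_UNIV_char_0[where 'a=complex] by (metis (mono_tags, lifting) UNIV_eq_I UnCI insertI1 mem_Collect_eq)
  have "poly (det (pencil P)) (1 / t) = det (\<chi> i. (1 / t) *s (\<chi> j. (if i = j then 1 else 0) + t * P $ i $ j))"
    unfolding poly_det pencil_def using t by (intro arg_cong[where f=det]) (auto simp: vec_eq_iff field_simps)
  also have "\<dots> = (1 / t) ^ CARD('n) * poly Q t"
    by (subst det_rows_mul) (simp add: Q_def poly_det)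
  finally show ?thesis using t by auto
qed

lemma det_mat: "det (mat x :: complex^'n^'n) = x ^ CARD('n)"
  by (subst det_diagonal) (auto simp: mat_def)

text \<open>
  The coefficient of \<open>t ^ k\<close> in the adjugate of \<open>P + t I\<close>.
\<close>

definition adj_coeff :: "nat \<Rightarrow> complex^'n^'n \<Rightarrow> complex^'n^'n" where
  "adj_coeff k P = (\<chi> i j. coeff (adjugate (pencil P) $ i $ j) k)"

lemma adj_coeff_ex_nonzero:
  fixes P :: "complex^'n^'n"
  shows "\<exists>k. adj_coeff k P \<noteq> 0"
proof (rule ccontr)
  assume "\<not> ?thesis"
  then have "adjugate (pencil P) = 0"
    by (auto simp: adj_coeff_def vec_eq_iff poly_eq_iff)
  then have "mat (det (pencil P)) = (0 :: complex poly^'n^'n)"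
    using adjugate_right[of "pencil P"] by simp
  then have "mat (det (pencil P)) $ i $ i = (0 :: complex poly^'n^'n) $ i $ i" for i by simp
  then show False using det_pencil_nonzero[of P] by (simp add: mat_def)
qed

text \<open>
  Comparing coefficients of \<open>t ^ k\<close> in \<open>(P + t I) adj (P + t I) = det (P + t I) I\<close> gives
  $P B_k + B_{k-1} = d_k I$, where $B_k$ is \<open>adj_coeff k P\<close> and $B_{-1} = 0$. If $B_{k-1} = 0$, taking
  determinants shows that a power of $d_k$ equals $\det P \cdot \det B_k = 0$.
\<close>

lemma mult_adj_coeff:
  fixes P :: "complex^'n^'n"
  assumes P: "det P = 0" and k: "k = 0 \<or> adj_coeff (k - 1) P = 0"
  shows "P ** adj_coeff k P = 0"
proof -
  define d where "d = coeff (det (pencil P)) k"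
  have eq: "P ** adj_coeff k P = mat d"
  proof -
    have "(P ** adj_coeff k P) $ i $ j = (mat d :: complex^'n^'n) $ i $ j" for i j
    proof -
      define a where "a m = adjugate (pencil P) $ m $ j" for m
      have "(\<Sum>m\<in>UNIV. pencil P $ i $ m * a m) = (if i = j then det (pencil P) else 0)"
        using arg_cong[OF adjugate_right[of "pencil P"], of "\<lambda>X. X $ i $ j"]
        by (simp add: matrix_matrix_mult_def mat_def a_def)
      then have "coeff (\<Sum>m\<in>UNIV. pencil P $ i $ m * a m) k = (if i = j then d else 0)"
        by (simp add: d_def)
      also have "coeff (\<Sum>m\<in>UNIV. pencil P $ i $ m * a m) k =
         (\<Sum>m\<in>UNIV. P $ i $ m * coeff (a m) k + (if i = m then (if k = 0 then 0 else coeff (a m) (k - 1)) else 0))"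
        by (auto simp: coeff_sum pencil_def coeff_pCons algebra_simps split: nat.splits intro!: sum.cong)
      also have "\<dots> = (\<Sum>m\<in>UNIV. P $ i $ m * coeff (a m) k) + (if k = 0 then 0 else coeff (a i) (k - 1))"
        by (simp add: sum.distrib)
      also have "(if k = 0 then 0 else coeff (a i) (k - 1)) = 0"
        using k by (auto simp: adj_coeff_def vec_eq_iff a_def)
      finally show ?thesis by (simp add: matrix_matrix_mult_def adj_coeff_def mat_def a_def)
    qed
    then show ?thesis by (simp add: vec_eq_iff)
  qed
  have "d ^ CARD('n) = det P * det (adj_coeff k P)"
    by (metis det_mat eq det_mul)
  then have "d = 0" using P by simp
  with eq show ?thesis by (simp add: mat_0)
qed

text \<open>
  Measurability of a polynomial that depends on a parameter is expressed through its
  coefficients.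
\<close>

lemma borel_measurable_coeff_prod:
  assumes "finite I" "\<And>i k. i \<in> I \<Longrightarrow> (\<lambda>s. coeff (q i s) k) \<in> borel_measurable M"
  shows "(\<lambda>s. coeff (\<Prod>i\<in>I. q i s :: complex poly) k) \<in> borel_measurable M"
  using assms
proof (induction I arbitrary: k rule: finite_induct)
  case empty
  then show ?case by simp
next
  case (insert i I)
  then show ?case
    by (simp add: coeff_mult)
qed

lemma borel_measurable_coeff_det:
  fixes N :: "'s \<Rightarrow> complex poly^'n^'n"
  assumes "\<And>i j k. (\<lambda>s. coeff (N s $ i $ j) k) \<in> borel_measurable M"
  shows "(\<lambda>s. coeff (det (N s)) k) \<in> borel_measurable M"
proof -
  have "of_int m * (p::complex poly) = smult (of_int m) p" for m p
    by (simp add: of_int_poly)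
  then show ?thesis
    unfolding det_def coeff_sum
    by (simp, intro borel_measurable_sum borel_measurable_times borel_measurable_coeff_prod assms) auto
qed

lemma borel_measurable_adj_coeff:
  fixes P :: "'s \<Rightarrow> complex^'n^'n"
  assumes P: "\<And>i j. (\<lambda>s. P s $ i $ j) \<in> borel_measurable M"
  shows "(\<lambda>s. adj_coeff k (P s) $ i $ j) \<in> borel_measurable M"
  unfolding adj_coeff_def adjugate_def vec_lambda_beta
proof (rule borel_measurable_coeff_det)
  fix r c k
  show "(\<lambda>s. coeff ((\<chi> r. if r = j then axis i 1 else pencil (P s) $ r) $ r $ c) k) \<in> borel_measurable M"
    by (cases "r = j"; cases k) (auto simp: pencil_def coeff_pCons intro: P)
qed

text \<open>
  The null vectors are the columns of \<open>adj_coeff k (P s)\<close>, with the same \<open>k\<close> for all \<open>s\<close>: the least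
  one for which this matrix is not almost everywhere zero. This makes them polynomial expressions in
  the entries of \<open>P s\<close>, hence measurable.
\<close>

lemma kernel_field:
  fixes P :: "'s \<Rightarrow> complex^'n^'n"
  assumes P: "\<And>i j. (\<lambda>s. P s $ i $ j) \<in> borel_measurable M"
    and det: "\<And>s. det (P s) = 0" and M: "\<not> (AE s in M. False)"
  obtains v :: "'s \<Rightarrow> complex^'n" where "\<And>i. (\<lambda>s. v s $ i) \<in> borel_measurable M"
    "AE s in M. P s *v v s = 0" "\<not> (AE s in M. v s = 0)"
proof -
  have ex: "\<exists>k. \<not> (AE s in M. adj_coeff k (P s) = 0)"
  proof (rule ccontr)
    assume "\<not> ?thesis"
    then have "AE s in M. \<forall>k. adj_coeff k (P s) = 0" by (simp add: AE_all_countable)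
    then have "AE s in M. False"
      by eventually_elim (use adj_coeff_ex_nonzero in blast)
    with M show False by simp
  qed
  define k where "k = (LEAST k. \<not> (AE s in M. adj_coeff k (P s) = 0))"
  have k: "\<not> (AE s in M. adj_coeff k (P s) = 0)"
    using ex unfolding k_def by (rule LeastI_ex)
  have "AE s in M. k = 0 \<or> adj_coeff (k - 1) (P s) = 0"
  proof (cases "k = 0")
    case False
    then have "k - 1 < k" by simp
    from not_less_Least[OF this[unfolded k_def]] show ?thesis by (fold k_def) simp
  qed simp
  then have z: "AE s in M. P s ** adj_coeff k (P s) = 0"
    by eventually_elim (use mult_adj_coeff det in blast)
  have "\<exists>j. \<not> (AE s in M. column j (adj_coeff k (P s)) = 0)"
  proof (rule ccontr)
    assume "\<not> ?thesis"
    then have "AE s in M. \<forall>j\<in>UNIV. column j (adj_coeff k (P s)) = 0"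
      by (intro AE_finite_allI) auto
    then have "AE s in M. adj_coeff k (P s) = 0"
      by eventually_elim (auto simp: column_def vec_eq_iff)
    with k show False by simp
  qed
  then obtain j where j: "\<not> (AE s in M. column j (adj_coeff k (P s)) = 0)" by blast
  show thesis
  proof
    show "(\<lambda>s. column j (adj_coeff k (P s)) $ i) \<in> borel_measurable M" for i
      unfolding column_def using borel_measurable_adj_coeff[OF P] by simp
    show "AE s in M. P s *v column j (adj_coeff k (P s)) = 0"
      using z
    proof eventually_elim
      case (elim s)
      have "P s *v column j (adj_coeff k (P s)) = column j (P s ** adj_coeff k (P s))"
        by (simp add: vec_eq_iff column_def matrix_vector_mult_def matrix_matrix_mult_def)
      with elim show ?case by (simp add: column_def vec_eq_iff)
    qed
  qed (rule j)
qed

section \<open>Zeros of real analytic functions\<close>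

text \<open>
  Restrictions of real analytic functions to lines have this property. Determinants inherit it from
  their entries, because sums and products of holomorphic functions are holomorphic.
\<close>

definition real_holomorphic :: "(real \<Rightarrow> complex) \<Rightarrow> bool" where
  "real_holomorphic g \<longleftrightarrow> (\<forall>t0. \<exists>r>0. \<exists>F. F holomorphic_on ball (of_real t0) r \<and>
     (\<forall>t. \<bar>t - t0\<bar> < r \<longrightarrow> g t = F (of_real t)))"

lemma real_holomorphic_const: "real_holomorphic (\<lambda>_. c)"
  unfolding real_holomorphic_def by (intro allI exI[of _ 1] conjI exI[of _ "\<lambda>_. c"]) auto

lemma real_holomorphic_binop:
  assumes "real_holomorphic f" "real_holomorphic g"
    and op: "\<And>F G S. F holomorphic_on S \<Longrightarrow> G holomorphic_on S \<Longrightarrow> (\<lambda>x. op (F x) (G x)) holomorphic_on S"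
  shows "real_holomorphic (\<lambda>t. op (f t) (g t))"
  unfolding real_holomorphic_def
proof
  fix t0
  from assms(1) obtain r F where F: "r > 0" "F holomorphic_on ball (of_real t0) r" "\<And>t. \<bar>t - t0\<bar> < r \<Longrightarrow> f t = F (of_real t)"
    unfolding real_holomorphic_def by meson
  from assms(2) obtain r' G where G: "r' > 0" "G holomorphic_on ball (of_real t0) r'" "\<And>t. \<bar>t - t0\<bar> < r' \<Longrightarrow> g t = G (of_real t)"
    unfolding real_holomorphic_def by meson
  show "\<exists>r>0. \<exists>F. F holomorphic_on ball (of_real t0) r \<and> (\<forall>t. \<bar>t - t0\<bar> < r \<longrightarrow> op (f t) (g t) = F (of_real t))"
  proof (intro exI[of _ "min r r'"] exI[of _ "\<lambda>x. op (F x) (G x)"] conjI)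
    show "(\<lambda>x. op (F x) (G x)) holomorphic_on ball (of_real t0) (min r r')"
      by (rule op; rule holomorphic_on_subset[OF F(2)] holomorphic_on_subset[OF G(2)]) auto
  qed (use F G in auto)
qed

lemma real_holomorphic_add: "real_holomorphic f \<Longrightarrow> real_holomorphic g \<Longrightarrow> real_holomorphic (\<lambda>t. f t + g t)"
  by (rule real_holomorphic_binop) (auto intro: holomorphic_intros)

lemma real_holomorphic_mult: "real_holomorphic f \<Longrightarrow> real_holomorphic g \<Longrightarrow> real_holomorphic (\<lambda>t. f t * g t)"
  by (rule real_holomorphic_binop) (auto intro: holomorphic_intros)

lemma real_holomorphic_diff: "real_holomorphic f \<Longrightarrow> real_holomorphic g \<Longrightarrow> real_holomorphic (\<lambda>t. f t - g t)"
  by (rule real_holomorphic_binop) (auto intro: holomorphic_intros)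

lemma real_holomorphic_sum:
  "(\<And>i. i \<in> I \<Longrightarrow> real_holomorphic (f i)) \<Longrightarrow> real_holomorphic (\<lambda>t. \<Sum>i\<in>I. f i t)"
  by (induction I rule: infinite_finite_induct) (auto intro: real_holomorphic_const real_holomorphic_add)

lemma real_holomorphic_prod:
  "(\<And>i. i \<in> I \<Longrightarrow> real_holomorphic (f i)) \<Longrightarrow> real_holomorphic (\<lambda>t. \<Prod>i\<in>I. f i t)"
  by (induction I rule: infinite_finite_induct) (auto intro: real_holomorphic_const real_holomorphic_mult)

lemma real_holomorphic_det:
  fixes M :: "real \<Rightarrow> complex^'n^'n"
  assumes "\<And>i j. real_holomorphic (\<lambda>t. M t $ i $ j)"
  shows "real_holomorphic (\<lambda>t. det (M t))"
  unfolding det_def by (intro real_holomorphic_sum real_holomorphic_mult real_holomorphic_const real_holomorphic_prod assms)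

lemma real_holomorphic_isolated:
  assumes "real_holomorphic g"
  obtains r where "r > 0"
    "(\<forall>t. \<bar>t - t0\<bar> < r \<longrightarrow> g t = 0) \<or> (\<forall>t. \<bar>t - t0\<bar> < r \<longrightarrow> t \<noteq> t0 \<longrightarrow> g t \<noteq> 0)"
proof -
  from assms obtain r F where F: "r > 0" "F holomorphic_on ball (of_real t0) r" "\<And>t. \<bar>t - t0\<bar> < r \<Longrightarrow> g t = F (of_real t)"
    unfolding real_holomorphic_def by meson
  have d: "complex_of_real t \<in> ball (of_real t0) s \<longleftrightarrow> \<bar>t - t0\<bar> < s" for t s
    by (simp add: dist_norm abs_minus_commute flip: of_real_diff)
  show thesis
  proof (cases "F (of_real t0) = 0 \<and> \<not> F constant_on ball (of_real t0) r")
    case False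
    then consider "F (of_real t0) \<noteq> 0" | "F (of_real t0) = 0" "F constant_on ball (of_real t0) r" by blast
    then show thesis
    proof cases
      case 1
      have "continuous_on (ball (of_real t0) r) F" using F(2) by (rule holomorphic_on_imp_continuous_on)
      then have "isCont F (of_real t0)" using F(1) by (simp add: continuous_on_eq_continuous_at)
      then obtain s where s: "s > 0" "\<And>z. dist (of_real t0) z < s \<Longrightarrow> F z \<noteq> 0"
        using continuous_at_avoid[of "of_real t0" F 0] 1 by blast
      show thesis
      proof (rule that[of "min r s"], use F s in simp, intro disjI2 allI impI)
        fix t assume "\<bar>t - t0\<bar> < min r s"
        then show "g t \<noteq> 0" using s(2)[of "of_real t"] F(3)[of t] d[of t s] by simp
      qed
    next
      case 2
      have "F z = 0" if "z \<in> ball (of_real t0) r" for z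
        using 2 that F(1) by (metis centre_in_ball constant_on_def)
      then show thesis using F d by (intro that[of r]) auto
    qed
  next
    case True
    obtain w where w: "w \<in> ball (of_real t0) r" "F w \<noteq> F (of_real t0)"
      using True unfolding constant_on_def by metis
    obtain s where s: "s > 0" "ball (complex_of_real t0) s \<subseteq> ball (of_real t0) r"
      "\<And>z. z \<in> ball (of_real t0) s - {of_real t0} \<Longrightarrow> F z \<noteq> 0"
      by (rule isolated_zeros[OF F(2) open_ball connected_ball, of "of_real t0" w]) (use F(1) True w in auto)
    show thesis
    proof (rule that[of "s"], use F s in simp, intro disjI2 allI impI)
      fix t assume "\<bar>t - t0\<bar> < s" "t \<noteq> t0"
      then show "g t \<noteq> 0" using s(3)[of "of_real t"] subsetD[OF s(2), of "of_real t"] F(3)[of t] d[of t s] d[of t r] by simp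
    qed
  qed
qed

text \<open>
  The points near which \<open>g\<close> vanishes identically form an open and closed set, which is not the
  whole line; so all zeros are isolated.
\<close>

lemma real_holomorphic_zeros_countable:
  assumes g: "real_holomorphic g" and nz: "g t1 \<noteq> 0"
  shows "countable {t. g t = 0}"
proof -
  define S where "S = {t0. \<exists>r>0. \<forall>t. \<bar>t - t0\<bar> < r \<longrightarrow> g t = 0}"
  have "open S"
    unfolding open_dist
  proof
    fix t0 assume "t0 \<in> S"
    then obtain r where r: "r > 0" "\<And>t. \<bar>t - t0\<bar> < r \<Longrightarrow> g t = 0" by (auto simp: S_def)
    show "\<exists>e>0. \<forall>y. dist y t0 < e \<longrightarrow> y \<in> S"
    proof (intro exI[of _ "r/2"] conjI allI impI)
      fix y assume y: "dist y t0 < r / 2"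
      have "g t = 0" if "\<bar>t - y\<bar> < r / 2" for t
      proof (rule r(2))
        show "\<bar>t - t0\<bar> < r" using y that unfolding dist_real_def by arith
      qed
      then show "y \<in> S" unfolding S_def using r(1) by (auto intro!: exI[of _ "r/2"])
    qed (use r in simp)
  qed
  moreover have "open (- S)"
    unfolding open_dist
  proof
    fix t0 assume t0: "t0 \<in> - S"
    obtain r where r: "r > 0"
      "(\<forall>t. \<bar>t - t0\<bar> < r \<longrightarrow> g t = 0) \<or> (\<forall>t. \<bar>t - t0\<bar> < r \<longrightarrow> t \<noteq> t0 \<longrightarrow> g t \<noteq> 0)"
      using real_holomorphic_isolated[OF g, of t0] by blast
    then have nz: "g t \<noteq> 0" if "\<bar>t - t0\<bar> < r" "t \<noteq> t0" for t
      using t0 that unfolding S_def by blast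
    show "\<exists>e>0. \<forall>y. dist y t0 < e \<longrightarrow> y \<in> - S"
    proof (intro exI[of _ r] conjI allI impI)
      fix y assume y: "dist y t0 < r"
      show "y \<in> - S"
      proof (cases "y = t0")
        case False
        then have "g y \<noteq> 0" using nz[of y] y by (simp add: dist_real_def)
        then show ?thesis unfolding S_def by force
      qed (use t0 in simp)
    qed (use r in simp)
  qed
  moreover have "t1 \<notin> S" using nz unfolding S_def by force
  ultimately have "S = {}"
    using connected_UNIV[where 'a=real] unfolding connected_clopen[of UNIV] by (metis UNIV_I closed_open openin_open_eq open_UNIV subtopology_UNIV open_openin closed_closedin)
  have "\<exists>r>0. \<forall>t. \<bar>t - t0\<bar> < r \<longrightarrow> t \<noteq> t0 \<longrightarrow> g t \<noteq> 0" for t0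
  proof -
    obtain r where "r > 0" "(\<forall>t. \<bar>t - t0\<bar> < r \<longrightarrow> g t = 0) \<or> (\<forall>t. \<bar>t - t0\<bar> < r \<longrightarrow> t \<noteq> t0 \<longrightarrow> g t \<noteq> 0)"
      using real_holomorphic_isolated[OF g, of t0] by blast
    moreover have "t0 \<notin> S" using \<open>S = {}\<close> by simp
    ultimately show ?thesis unfolding S_def by blast
  qed
  then have "\<not> t0 islimpt {t. g t = 0}" for t0
    unfolding islimpt_approachable dist_real_def by (metis mem_Collect_eq)
  then have "{t. g t = 0} sparse_in UNIV"
    unfolding sparse_in_def by (intro ballI exI[of _ UNIV]) auto
  then show ?thesis using sparse_imp_countable[of UNIV] by auto
qed

text \<open>
  Integrating \<open>indicator Z (p + t *\<^sub>R x)\<close> over \<open>t\<close> first gives zero for every \<open>x\<close>. In the other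
  order the inner integral is a nonzero multiple of the measure of \<open>Z\<close> for every \<open>t \<noteq> 0\<close>.
\<close>

lemma null_set_if_rays_countable:
  fixes Z :: "'a::euclidean_space set"
  assumes [measurable]: "Z \<in> sets borel"
    and rays: "\<And>x. countable {t. p + t *\<^sub>R x \<in> Z}"
  shows "Z \<in> null_sets lborel"
proof -
  have "(\<integral>\<^sup>+t. (\<integral>\<^sup>+x. indicator Z (p + t *\<^sub>R x) \<partial>lborel) \<partial>(lborel :: real measure)) =
        (\<integral>\<^sup>+x. (\<integral>\<^sup>+t. indicator Z (p + t *\<^sub>R x) \<partial>(lborel :: real measure)) \<partial>lborel)"
    by (rule lborel_pair.Fubini') measurable
  also have "\<dots> = (\<integral>\<^sup>+x. 0 \<partial>(lborel :: 'a measure))"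
  proof (rule nn_integral_cong)
    fix x :: 'a
    have [measurable]: "{t. p + t *\<^sub>R x \<in> Z} \<in> sets borel" by measurable
    have "(\<integral>\<^sup>+t. indicator Z (p + t *\<^sub>R x) \<partial>lborel) = emeasure lborel {t. p + t *\<^sub>R x \<in> Z}"
    proof -
      have "indicator Z (p + t *\<^sub>R x) = (indicator {t. p + t *\<^sub>R x \<in> Z} t :: ennreal)" for t
        by (simp add: indicator_def)
      then show ?thesis by simp
    qed
    also have "\<dots> = 0" by (rule emeasure_lborel_countable[OF rays])
    finally show "(\<integral>\<^sup>+t. indicator Z (p + t *\<^sub>R x) \<partial>lborel) = 0" .
  qed
  finally have "(\<integral>\<^sup>+t. (\<integral>\<^sup>+x. indicator Z (p + t *\<^sub>R x) \<partial>lborel) \<partial>(lborel :: real measure)) = 0"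
    by simp
  then have "AE t in (lborel :: real measure). (\<integral>\<^sup>+x. indicator Z (p + t *\<^sub>R x) \<partial>lborel) = 0"
    by (subst (asm) nn_integral_0_iff_AE) auto
  moreover have "AE t in (lborel :: real measure). t \<noteq> 0"
    by (rule AE_lborel_singleton)
  ultimately have "AE t in (lborel :: real measure). emeasure lborel Z = 0"
  proof eventually_elim
    case (elim t)
    then show ?case
      using nn_integral_lborel_affine[of "indicator Z" t p] by simp
  qed
  then have "emeasure lborel Z = 0"
    by (subst (asm) eventually_const) (auto simp: ae_filter_eq_bot_iff)
  then show ?thesis by auto
qed

text \<open>
  On a line through the centre of the expansion, a monomial of multi-index \<open>m\<close> becomes a multiple of
  the power of \<open>t - t0\<close> with exponent the total degree of \<open>m\<close>. Collecting the terms of equal degree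
  yields a power series, which converges at complex points as well.
\<close>

lemma real_analytic_line:
  fixes f :: "real^'d \<Rightarrow> complex"
  assumes f: "real_analytic f"
  shows "real_holomorphic (\<lambda>t. f (p + t *\<^sub>R x))"
  unfolding real_holomorphic_def
proof
  fix t0
  define q where "q = p + t0 *\<^sub>R x"
  from f obtain r b where r: "r > 0" and b: "\<And>y. y \<in> ball q r \<Longrightarrow>
     ((\<lambda>m. b m * of_real (\<Prod>l\<in>UNIV. (y $ l - q $ l) ^ m l)) has_sum f y) UNIV"
    unfolding real_analytic_def by meson
  \<comment> \<open>adding one covers the direction \<open>x = 0\<close>\<close>
  define R where "R = r / (norm x + 1)"
  have R: "R > 0" using r by (simp add: R_def add_nonneg_pos)
  define \<beta> where "\<beta> m = b m * of_real (\<Prod>l\<in>UNIV. (x $ l) ^ m l)" for m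
  define N where "N m = (\<Sum>l\<in>UNIV. m l)" for m :: "'d \<Rightarrow> nat"
  have line: "((\<lambda>m. \<beta> m * of_real (t - t0) ^ N m) has_sum f (p + t *\<^sub>R x)) UNIV" if "\<bar>t - t0\<bar> < R" for t
  proof -
    have "dist q (p + t *\<^sub>R x) = \<bar>t - t0\<bar> * norm x"
    proof -
      have "q - (p + t *\<^sub>R x) = (t0 - t) *\<^sub>R x" by (simp add: q_def scaleR_left_diff_distrib)
      then show ?thesis by (simp add: dist_norm abs_minus_commute)
    qed
    also have "\<dots> \<le> \<bar>t - t0\<bar> * (norm x + 1)" by (intro mult_left_mono) auto
    also have "\<dots> < r" using that unfolding R_def by (subst (asm) pos_less_divide_eq) (auto simp: add_nonneg_pos)
    finally have "p + t *\<^sub>R x \<in> ball q r" by simp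
    from b[OF this] show ?thesis
      by (rule has_sum_cong[THEN iffD1, rotated])
         (simp add: q_def \<beta>_def N_def power_mult_distrib prod.distrib mult_ac power_sum flip: left_diff_distrib)
  qed
  define F where "F z = (\<Sum>\<^sub>\<infinity>m. \<beta> m * (z - of_real t0) ^ N m)" for z
  show "\<exists>r>0. \<exists>F. F holomorphic_on ball (of_real t0) r \<and> (\<forall>t. \<bar>t - t0\<bar> < r \<longrightarrow> f (p + t *\<^sub>R x) = F (of_real t))"
  proof (intro exI[of _ R] exI[of _ F] conjI allI impI R)
    fix t assume "\<bar>t - t0\<bar> < R"
    from infsumI[OF line[OF this]] show "f (p + t *\<^sub>R x) = F (of_real t)"
      by (simp add: F_def)
  next
    define a where "a n = (\<Sum>\<^sub>\<infinity>m\<in>N -` {n}. \<beta> m)" for n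
    have sums: "(\<lambda>n. a n * (z - of_real t0) ^ n) sums F z" if z: "z \<in> ball (of_real t0) R" for z
    proof -
      have "\<bar>(t0 + dist z (of_real t0)) - t0\<bar> < R" using z by (simp add: dist_commute)
      from line[OF this] have "(\<lambda>m. \<beta> m * of_real (dist z (of_real t0)) ^ N m) summable_on UNIV"
        by (auto simp: summable_on_def)
      then have "(\<lambda>m. norm (\<beta> m * of_real (dist z (of_real t0)) ^ N m)) summable_on UNIV"
        by (rule summable_on_iff_abs_summable_on_complex[THEN iffD1])
      then have abs: "(\<lambda>m. norm (\<beta> m * (z - of_real t0) ^ N m)) summable_on UNIV"
        by (simp add: norm_mult norm_power dist_norm)
      then have s: "(\<lambda>m. \<beta> m * (z - of_real t0) ^ N m) summable_on UNIV"
        by (rule summable_on_iff_abs_summable_on_complex[THEN iffD2])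
      have "((\<lambda>(n, m). \<beta> m * (z - of_real t0) ^ N m) has_sum F z) (SIGMA n:UNIV. N -` {n})"
      proof -
        have "snd ` (SIGMA n:UNIV. N -` {n}) = UNIV" by force
        then have "bij_betw snd (SIGMA n:UNIV. N -` {n}) UNIV"
          by (auto simp: bij_betw_def inj_on_def)
        from has_sum_reindex_bij_betw[OF this, of "\<lambda>m. \<beta> m * (z - of_real t0) ^ N m" "F z"] has_sum_infsum[OF s]
        show ?thesis by (simp add: F_def case_prod_unfold)
      qed
      then have "((\<lambda>n. \<Sum>\<^sub>\<infinity>m\<in>N -` {n}. \<beta> m * (z - of_real t0) ^ N m) has_sum F z) UNIV"
      proof (rule has_sum_Sigma')
        show "((\<lambda>m. case (n, m) of (n, m) \<Rightarrow> \<beta> m * (z - of_real t0) ^ N m) has_sum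
            (\<Sum>\<^sub>\<infinity>m\<in>N -` {n}. \<beta> m * (z - of_real t0) ^ N m)) (N -` {n})" for n
          using summable_on_subset_banach[OF s, of "N -` {n}"] by simp
      qed
      moreover have "(\<Sum>\<^sub>\<infinity>m\<in>N -` {n}. \<beta> m * (z - of_real t0) ^ N m) = a n * (z - of_real t0) ^ n" for n
      proof -
        have "(\<Sum>\<^sub>\<infinity>m\<in>N -` {n}. \<beta> m * (z - of_real t0) ^ N m) = (\<Sum>\<^sub>\<infinity>m\<in>N -` {n}. \<beta> m * (z - of_real t0) ^ n)"
          by (rule infsum_cong) auto
        then show ?thesis by (simp add: a_def infsum_cmult_left')
      qed
      ultimately show ?thesis by (simp add: has_sum_imp_sums)
    qed
    show "F holomorphic_on ball (of_real t0) R"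
      by (rule power_series_holomorphic[OF sums])
  qed
qed

lemma real_analytic_det_dichotomy:
  fixes M :: "real^'d \<Rightarrow> complex^'n^'n"
  assumes M: "real_analytic_matrix M" and meas: "\<And>i j. (\<lambda>s. M s $ i $ j) \<in> borel_measurable borel"
    and s0: "det (M s0 - mat z) \<noteq> 0"
  shows "AE s in lborel. det (M s - mat z) \<noteq> 0"
proof -
  have [measurable]: "(\<lambda>s. det (M s - mat z)) \<in> borel_measurable borel"
    unfolding det_def by (auto intro!: borel_measurable_sum borel_measurable_times borel_measurable_prod borel_measurable_diff meas simp: mat_def)
  have "{s. det (M s - mat z) = 0} \<in> null_sets lborel"
  proof (rule null_set_if_rays_countable[where p=s0])
    fix x
    have "real_holomorphic (\<lambda>t. det (M (s0 + t *\<^sub>R x) - mat z))"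
    proof (rule real_holomorphic_det)
      fix i j
      have "real_holomorphic (\<lambda>t. M (s0 + t *\<^sub>R x) $ i $ j)"
        using M real_analytic_line[where f="\<lambda>s. M s $ i $ j"] by (simp add: real_analytic_matrix_def)
      then show "real_holomorphic (\<lambda>t. (M (s0 + t *\<^sub>R x) - mat z) $ i $ j)"
        by (simp add: real_holomorphic_diff real_holomorphic_const)
    qed
    from real_holomorphic_zeros_countable[OF this, of 0] s0
    show "countable {t. s0 + t *\<^sub>R x \<in> {s. det (M s - mat z) = 0}}" by simp
  qed measurable
  from AE_not_in[OF this] show ?thesis by simp
qed

section \<open>Series and products of functions under the integral\<close>

text \<open>
  Series over the integers are enumerated by \<open>int_decode\<close>, so that the theorems on sequences of
  functions apply; absolute convergence makes the enumeration irrelevant.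
\<close>

lemma summable_on_int_iff:
  fixes f :: "int \<Rightarrow> complex"
  shows "f summable_on UNIV \<longleftrightarrow> summable (\<lambda>n. norm (f (int_decode n)))"
proof -
  have "f summable_on UNIV \<longleftrightarrow> (\<lambda>n. f (int_decode n)) summable_on UNIV"
    by (rule summable_on_reindex_bij_betw[OF bij_int_decode, symmetric])
  also have "\<dots> \<longleftrightarrow> (\<lambda>n. norm (f (int_decode n))) summable_on UNIV"
    by (rule summable_on_iff_abs_summable_on_complex)
  also have "\<dots> \<longleftrightarrow> summable (\<lambda>n. norm (f (int_decode n)))"
    by (auto simp: summable_on_UNIV_nonneg_real_iff)
  finally show ?thesis .
qed

lemma infsum_int_eq:
  fixes f :: "int \<Rightarrow> complex"
  shows "(\<Sum>\<^sub>\<infinity>k. f k) = (if summable (\<lambda>n. norm (f (int_decode n))) then \<Sum>n. f (int_decode n) else 0)"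
proof (cases "f summable_on UNIV")
  case True
  have "((\<lambda>n. f (int_decode n)) has_sum (\<Sum>\<^sub>\<infinity>k. f k)) UNIV"
    using has_sum_infsum[OF True] by (subst has_sum_reindex_bij_betw[OF bij_int_decode])
  then show ?thesis using True by (simp add: summable_on_int_iff sums_unique[OF has_sum_imp_sums])
next
  case False
  then show ?thesis by (simp add: infsum_not_exists summable_on_int_iff)
qed

text \<open>
  The set of points at which the series converges absolutely is measurable, and off this set its
  value is \<open>0\<close>.
\<close>

lemma borel_measurable_infsum_int [measurable (raw)]:
  fixes f :: "int \<Rightarrow> 'a \<Rightarrow> complex"
  assumes [measurable]: "\<And>k. f k \<in> borel_measurable M"
  shows "(\<lambda>x. \<Sum>\<^sub>\<infinity>k. f k x) \<in> borel_measurable M"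
proof -
  have "summable (\<lambda>n. norm (f (int_decode n) x)) \<longleftrightarrow> (\<Sum>n. ennreal (norm (f (int_decode n) x))) \<noteq> top" for x
    by (metis ennreal_suminf_neq_top norm_ge_zero summable_suminf_not_top)
  then have [measurable]: "Measurable.pred M (\<lambda>x. summable (\<lambda>n. norm (f (int_decode n) x)))"
    by simp
  show ?thesis unfolding infsum_int_eq by (intro measurable_If) simp_all
qed

lemma integral_infsum_int:
  fixes f :: "int \<Rightarrow> 'a \<Rightarrow> complex"
  assumes f[measurable]: "\<And>k. integrable M (f k)"
    and s: "(\<lambda>k. \<integral>x. norm (f k x) \<partial>M) summable_on UNIV"
  shows "(\<integral>x. (\<Sum>\<^sub>\<infinity>k. f k x) \<partial>M) = (\<Sum>\<^sub>\<infinity>k. \<integral>x. f k x \<partial>M)"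
proof -
  note [measurable] = f[THEN borel_measurable_integrable]
  define g where "g n = f (int_decode n)" for n
  have s': "summable (\<lambda>n. \<integral>x. norm (g n x) \<partial>M)"
    using summable_on_reindex_bij_betw[OF bij_int_decode, of "\<lambda>k. \<integral>x. norm (f k x) \<partial>M"] s
    unfolding g_def by (simp add: summable_on_UNIV_nonneg_real_iff)
  have gi: "integrable M (g n)" for n unfolding g_def by (rule f)
  note [measurable] = gi[THEN borel_measurable_integrable]
  have "(\<integral>\<^sup>+x. (\<Sum>n. ennreal (norm (g n x))) \<partial>M) = (\<Sum>n. \<integral>\<^sup>+x. ennreal (norm (g n x)) \<partial>M)"
    by (rule nn_integral_suminf) simp
  also have "\<dots> = (\<Sum>n. ennreal (\<integral>x. norm (g n x) \<partial>M))"
    using gi by (simp add: nn_integral_eq_integral)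
  also have "\<dots> \<noteq> top"
    by (rule ennreal_suminf_neq_top[OF s']) simp
  finally have "(\<integral>\<^sup>+x. (\<Sum>n. ennreal (norm (g n x))) \<partial>M) \<noteq> \<infinity>"
    by (simp only: infinity_ennreal_def not_False_eq_True)
  then have "AE x in M. (\<Sum>n. ennreal (norm (g n x))) \<noteq> \<infinity>"
    by (rule nn_integral_PInf_AE[rotated])
       (intro borel_measurable_suminf_order measurable_compose[OF _ measurable_ennreal] borel_measurable_norm
         borel_measurable_integrable integrable_norm gi)
  then have AE: "AE x in M. summable (\<lambda>n. norm (g n x))"
    by eventually_elim (auto intro: summable_suminf_not_top)
  have eq: "AE x in M. (\<Sum>n. g n x) = (\<Sum>\<^sub>\<infinity>k. f k x)"
    using AE by eventually_elim (simp add: infsum_int_eq g_def)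
  have m: "(\<lambda>x. \<Sum>\<^sub>\<infinity>k. f k x) \<in> borel_measurable M" by measurable
  have "summable (\<lambda>n. norm (\<integral>x. g n x \<partial>M))"
    by (rule summable_comparison_test'[OF s']) (simp add: integral_norm_bound)
  then have "(\<Sum>\<^sub>\<infinity>k. \<integral>x. f k x \<partial>M) = (\<Sum>n. \<integral>x. g n x \<partial>M)"
    by (simp add: infsum_int_eq g_def)
  also have "\<dots> = (\<integral>x. (\<Sum>n. g n x) \<partial>M)"
    by (rule integral_suminf[OF gi AE s', symmetric])
  also have "\<dots> = (\<integral>x. (\<Sum>\<^sub>\<infinity>k. f k x) \<partial>M)"
    by (rule integral_cong_AE) (use eq m in auto)
  finally show "(\<integral>x. (\<Sum>\<^sub>\<infinity>k. f k x) \<partial>M) = (\<Sum>\<^sub>\<infinity>k. \<integral>x. f k x \<partial>M)" by simp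
qed

lemma
  fixes f g :: "'a \<Rightarrow> complex"
  assumes [measurable]: "f \<in> borel_measurable M" "g \<in> borel_measurable M"
    and f: "integrable M (\<lambda>x. (cmod (f x))\<^sup>2)" and g: "integrable M (\<lambda>x. (cmod (g x))\<^sup>2)"
  shows integrable_mult_squares: "integrable M (\<lambda>x. f x * g x)"
    and Cauchy_Schwarz_integral: "(\<integral>x. cmod (f x * g x) \<partial>M) \<le>
      sqrt (\<integral>x. (cmod (f x))\<^sup>2 \<partial>M) * sqrt (\<integral>x. (cmod (g x))\<^sup>2 \<partial>M)"
proof -
  have "integrable M (\<lambda>x. (cmod (f x))\<^sup>2 + (cmod (g x))\<^sup>2)" using f g by auto
  then show i: "integrable M (\<lambda>x. f x * g x)"
  proof (rule Bochner_Integration.integrable_bound)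
    have "cmod (f x * g x) \<le> (cmod (f x))\<^sup>2 + (cmod (g x))\<^sup>2" for x
    proof -
      have "2 * (cmod (f x) * cmod (g x)) \<le> (cmod (f x))\<^sup>2 + (cmod (g x))\<^sup>2"
        using sum_squares_bound[of "cmod (f x)" "cmod (g x)"] by (simp add: mult.assoc)
      moreover have "0 \<le> cmod (f x) * cmod (g x)" by simp
      ultimately show ?thesis unfolding norm_mult by linarith
    qed
    then show "AE x in M. norm (f x * g x) \<le> norm ((cmod (f x))\<^sup>2 + (cmod (g x))\<^sup>2)" by simp
  qed measurable
  have sq: "(\<integral>\<^sup>+x. (ennreal (cmod (h x)))\<^sup>2 \<partial>M) = ennreal (\<integral>x. (cmod (h x))\<^sup>2 \<partial>M)"
    if "integrable M (\<lambda>x. (cmod (h x))\<^sup>2)" for h :: "'a \<Rightarrow> complex"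
    using nn_integral_eq_integral[OF that] by (simp add: ennreal_power)
  have "ennreal ((\<integral>x. cmod (f x * g x) \<partial>M)\<^sup>2) = (\<integral>\<^sup>+x. ennreal (cmod (f x)) * ennreal (cmod (g x)) \<partial>M)\<^sup>2"
    using nn_integral_eq_integral[OF integrable_norm[OF i]] by (simp add: norm_mult ennreal_mult ennreal_power)
  also have "\<dots> \<le> (\<integral>\<^sup>+x. (ennreal (cmod (f x)))\<^sup>2 \<partial>M) * (\<integral>\<^sup>+x. (ennreal (cmod (g x)))\<^sup>2 \<partial>M)"
    by (rule Cauchy_Schwarz_nn_integral) auto
  also have "\<dots> = ennreal ((\<integral>x. (cmod (f x))\<^sup>2 \<partial>M) * (\<integral>x. (cmod (g x))\<^sup>2 \<partial>M))"
    by (simp add: sq f g ennreal_mult)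
  finally have "(\<integral>x. cmod (f x * g x) \<partial>M)\<^sup>2 \<le> (\<integral>x. (cmod (f x))\<^sup>2 \<partial>M) * (\<integral>x. (cmod (g x))\<^sup>2 \<partial>M)"
    by (subst (asm) ennreal_le_iff) auto
  then show "(\<integral>x. cmod (f x * g x) \<partial>M) \<le> sqrt (\<integral>x. (cmod (f x))\<^sup>2 \<partial>M) * sqrt (\<integral>x. (cmod (g x))\<^sup>2 \<partial>M)"
    by (simp add: real_le_rsqrt flip: real_sqrt_mult)
qed

lemma has_sum_finite_sum:
  fixes f :: "'j \<Rightarrow> 'k \<Rightarrow> 'a::topological_comm_monoid_add"
  assumes "finite J" "\<And>j. j \<in> J \<Longrightarrow> (f j has_sum s j) A"
  shows "((\<lambda>k. \<Sum>j\<in>J. f j k) has_sum (\<Sum>j\<in>J. s j)) A"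
  using assms by (induction J rule: finite_induct) (auto intro: has_sum_add)

text \<open>
  A class of indices is extended by zero to all indices; then a finite sum of series remains.
\<close>

lemma infsum_split_classes:
  fixes g :: "'n::finite \<Rightarrow> 'k \<Rightarrow> complex"
  assumes "\<And>j. g j summable_on {k. p k = j}"
  shows "(\<Sum>\<^sub>\<infinity>k. g (p k) k) = (\<Sum>j\<in>UNIV. \<Sum>\<^sub>\<infinity>k\<in>{k. p k = j}. g j k)"
proof -
  have "((\<lambda>k. if p k = j then g j k else 0) has_sum (\<Sum>\<^sub>\<infinity>k\<in>{k. p k = j}. g j k)) UNIV" for j
    using has_sum_infsum[OF assms[of j]] by (rule has_sum_cong_neutral[THEN iffD1, rotated -1]) auto
  then have "((\<lambda>k. \<Sum>j\<in>UNIV. if p k = j then g j k else 0) has_sum (\<Sum>j\<in>UNIV. \<Sum>\<^sub>\<infinity>k\<in>{k. p k = j}. g j k)) UNIV"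
    by (intro has_sum_finite_sum) auto
  then show ?thesis by (simp add: infsumI)
qed

section \<open>Systems of shift equations\<close>

text \<open>
  Borel functions are used on the Fourier side, as they stay measurable under composition with
  shifts and charts.
\<close>

definition sq_integrable :: "('a::euclidean_space \<Rightarrow> complex) \<Rightarrow> bool" where
  "sq_integrable f \<longleftrightarrow> f \<in> borel_measurable borel \<and> integrable lborel (\<lambda>x. (cmod (f x))\<^sup>2)"

lemma sq_integrableD [measurable_dest]: "sq_integrable f \<Longrightarrow> f \<in> borel_measurable borel"
  by (simp add: sq_integrable_def)

lemma
  assumes f: "sq_integrable f" and g: "sq_integrable g"
  shows sq_integrable_mult: "integrable lborel (\<lambda>x. f x * g x)"
    and integral_norm_mult_le: "(\<integral>x. cmod (f x * g x) \<partial>lborel) \<le>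
      sqrt (\<integral>x. (cmod (f x))\<^sup>2 \<partial>lborel) * sqrt (\<integral>x. (cmod (g x))\<^sup>2 \<partial>lborel)"
  using integrable_mult_squares[of f lborel g] Cauchy_Schwarz_integral[of f lborel g] f g
  by (auto simp: sq_integrable_def)

lemma sq_integrable_shift:
  assumes f: "sq_integrable f"
  shows "sq_integrable (\<lambda>u. f (u + b))"
    and "(\<integral>u. (cmod (f (u + b)))\<^sup>2 \<partial>lborel) = (\<integral>u. (cmod (f u))\<^sup>2 \<partial>lborel)"
proof -
  have i: "integrable lborel (\<lambda>x. (cmod (f x))\<^sup>2)" and [measurable]: "f \<in> borel_measurable borel"
    using f by (auto simp: sq_integrable_def)
  show "sq_integrable (\<lambda>u. f (u + b))"
    using lborel_integrable_affine[OF i, of 1 b] by (simp add: sq_integrable_def add.commute)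
  show "(\<integral>u. (cmod (f (u + b)))\<^sup>2 \<partial>lborel) = (\<integral>u. (cmod (f u))\<^sup>2 \<partial>lborel)"
    using lborel_integral_affine[OF i, of 1 b] by (simp add: add.commute)
qed

lemma sq_integrable_fourier:
  assumes F: "integrable lborel F" "sq_integrable F"
  shows "sq_integrable (fourier F)"
    and "(\<integral>u. (cmod (fourier F u))\<^sup>2 \<partial>lborel) \<le> (2 * pi) ^ DIM('a::euclidean_space) * (\<integral>s. (cmod (F s))\<^sup>2 \<partial>(lborel :: 'a measure))"
proof -
  note [measurable] = F(1)[THEN borel_measurable_integrable]
  have "(\<integral>\<^sup>+u. (cmod (fourier F u))\<^sup>2 \<partial>lborel) \<le> ennreal ((2 * pi) ^ DIM('a)) * (\<integral>\<^sup>+s. (cmod (F s))\<^sup>2 \<partial>lborel)"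
    by (rule plancherel_le[OF F(1)])
  also have "\<dots> = ennreal ((2 * pi) ^ DIM('a) * (\<integral>s. (cmod (F s))\<^sup>2 \<partial>lborel))"
    using F(2) by (subst nn_integral_eq_integral) (auto simp: sq_integrable_def ennreal_mult)
  finally have le: "(\<integral>\<^sup>+u. (cmod (fourier F u))\<^sup>2 \<partial>lborel) \<le> ennreal ((2 * pi) ^ DIM('a) * (\<integral>s. (cmod (F s))\<^sup>2 \<partial>lborel))" .
  then have i: "integrable lborel (\<lambda>u. (cmod (fourier F u))\<^sup>2)"
    by (intro integrableI_bounded) (auto simp: less_top[symmetric] top_unique)
  then show "sq_integrable (fourier F)" by (simp add: sq_integrable_def)
  have "ennreal (\<integral>u. (cmod (fourier F u))\<^sup>2 \<partial>lborel) = (\<integral>\<^sup>+u. (cmod (fourier F u))\<^sup>2 \<partial>lborel)"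
    by (rule nn_integral_eq_integral[OF i, symmetric]) simp
  with le have "ennreal (\<integral>u. (cmod (fourier F u))\<^sup>2 \<partial>lborel) \<le> ennreal ((2 * pi) ^ DIM('a) * (\<integral>s. (cmod (F s))\<^sup>2 \<partial>lborel))"
    by simp
  then show "(\<integral>u. (cmod (fourier F u))\<^sup>2 \<partial>lborel) \<le> (2 * pi) ^ DIM('a) * (\<integral>s. (cmod (F s))\<^sup>2 \<partial>lborel)"
    by (subst (asm) ennreal_le_iff) (auto intro!: mult_nonneg_nonneg)
qed

lemma continuous_on_fourier:
  fixes F :: "'a::euclidean_space \<Rightarrow> complex"
  assumes F: "integrable lborel F"
  shows "continuous_on UNIV (fourier F)"
  unfolding continuous_on_sequentially comp_def
proof (intro allI ballI impI)
  fix x :: "nat \<Rightarrow> 'a" and a assume x: "(\<forall>n. x n \<in> UNIV) \<and> x \<longlonglongrightarrow> a"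
  note [measurable] = F[THEN borel_measurable_integrable]
  show "(\<lambda>n. fourier F (x n)) \<longlonglongrightarrow> fourier F a"
    unfolding fourier_def
  proof (rule integral_dominated_convergence[where w="\<lambda>s. cmod (F s)"])
    have "(\<lambda>n. cis (s \<bullet> x n)) \<longlonglongrightarrow> cis (s \<bullet> a)" for s
      using x by (auto intro!: tendsto_intros)
    then show "AE s in lborel. (\<lambda>n. F s * cis (s \<bullet> x n)) \<longlonglongrightarrow> F s * cis (s \<bullet> a)"
      by (auto intro!: tendsto_mult)
  qed (use F in \<open>auto simp: norm_mult\<close>)
qed

lemma fourier_shift: "fourier F (u + b) = fourier (\<lambda>s. F s * cis (s \<bullet> b)) u"
  by (simp add: fourier_def inner_add_right mult.assoc cis_mult add.commute)

lemma fourier_gaussian_translate: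
  "fourier (\<lambda>s. of_real (gaussian (s - a))) u = of_real (sqrt (2 * pi) ^ DIM('a) * gaussian u) * cis (u \<bullet> a)"
  for a :: "'a::euclidean_space"
proof -
  have "integrable lborel (\<lambda>s. complex_of_real (gaussian (s - a)) * cis (s \<bullet> u))"
    using lborel_integrable_affine[OF integrable_gaussian, of 1 "- a"]
    by (intro integrable_cis_mult integrable_of_real) auto
  from lborel_integral_affine[OF this, of 1 a]
  have "fourier (\<lambda>s. of_real (gaussian (s - a))) u = (\<integral>s. (of_real (gaussian s) * cis (s \<bullet> u)) * cis (a \<bullet> u) \<partial>lborel)"
    by (simp add: fourier_def inner_add_left cis_mult mult.assoc add.commute)
  also have "\<dots> = fourier (\<lambda>s. of_real (gaussian s)) u * cis (a \<bullet> u)"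
    by (simp add: fourier_def)
  finally show ?thesis by (simp add: fourier_gaussian(2) inner_commute)
qed

lemma mat_mult_vec: "mat z *v v = z *s (v :: complex^'n)"
  by (simp add: vec_eq_iff matrix_vector_mult_def mat_def if_distribR if_distrib[of "\<lambda>x. x * _"] cong: if_cong)

text \<open>
  The operator $f \mapsto g$ with $g_i(u) = \sum_k w_k f_{p(i,k)}(u + b_k)$ on tuples of functions: in
  equation \<open>i\<close>, the term with index \<open>k\<close> shifts the component \<open>p i k\<close> by \<open>b k\<close>.
\<close>

locale shift_system =
  fixes w :: "int \<Rightarrow> complex" and b :: "int \<Rightarrow> 'a::euclidean_space" and p :: "'n::finite \<Rightarrow> int \<Rightarrow> 'n"
  assumes w: "(\<lambda>k. cmod (w k)) summable_on UNIV"
begin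

definition symbol :: "'a \<Rightarrow> complex^'n^'n" where
  "symbol s = (\<chi> i j. \<Sum>\<^sub>\<infinity>k\<in>{k. p i k = j}. w k * cis (- (s \<bullet> b k)))"

definition eigen :: "complex \<Rightarrow> ('n \<Rightarrow> 'a \<Rightarrow> complex) \<Rightarrow> bool" where
  "eigen z f \<longleftrightarrow> (\<forall>i. AE u in lborel. (\<Sum>\<^sub>\<infinity>k. w k * f (p i k) (u + b k)) = z * f i u)"

lemma w_mult_summable:
  assumes "\<And>k. cmod (x k) \<le> c"
  shows "(\<lambda>k. w k * x k) summable_on S"
proof -
  have "(\<lambda>k. norm (w k * x k)) summable_on UNIV"
  proof (rule summable_on_comparison_test[OF summable_on_cmult_left[OF w, of c]])
    show "norm (w k * x k) \<le> cmod (w k) * c" for k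
      using assms by (simp add: norm_mult mult_left_mono)
  qed auto
  then have "(\<lambda>k. w k * x k) summable_on UNIV"
    by (rule summable_on_iff_abs_summable_on_complex[THEN iffD2])
  then show ?thesis by (rule summable_on_subset_banach) auto
qed

lemma w_norm_summable:
  assumes "\<And>k. 0 \<le> x k" "\<And>k. x k \<le> cmod (w k) * c"
  shows "x summable_on UNIV"
  by (rule summable_on_comparison_test[OF summable_on_cmult_left[OF w, of c]]) (use assms in auto)

text \<open>
  The terms of one equation are sorted by the component they act on.
\<close>

lemma symbol_row:
  assumes "\<And>j k. cmod (x j k) \<le> c"
  shows "(\<Sum>\<^sub>\<infinity>k. w k * x (p i k) k) = (\<Sum>j\<in>UNIV. \<Sum>\<^sub>\<infinity>k. (if p i k = j then w k else 0) * x j k)"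
proof -
  have "(\<Sum>\<^sub>\<infinity>k. w k * x (p i k) k) = (\<Sum>j\<in>UNIV. \<Sum>\<^sub>\<infinity>k\<in>{k. p i k = j}. w k * x j k)"
    by (rule infsum_split_classes[where g="\<lambda>j k. w k * x j k"]) (rule w_mult_summable, rule assms)
  also have "\<dots> = (\<Sum>j\<in>UNIV. \<Sum>\<^sub>\<infinity>k. (if p i k = j then w k else 0) * x j k)"
    by (intro sum.cong refl infsum_cong_neutral) auto
  finally show ?thesis .
qed

lemma symbol_eq: "symbol s $ i $ j = (\<Sum>\<^sub>\<infinity>k. (if p i k = j then w k else 0) * cis (- (s \<bullet> b k)))"
  unfolding symbol_def by (simp, rule infsum_cong_neutral) auto

lemma symbol_measurable [measurable]: "(\<lambda>s. symbol s $ i $ j) \<in> borel_measurable borel"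
  unfolding symbol_eq by measurable

lemma symbol_mult_vec:
  "(\<Sum>\<^sub>\<infinity>k. w k * (x (p i k) * cis (- (s \<bullet> b k)))) = (symbol s *v (\<chi> j. x j)) $ i"
proof -
  define c where "c = (\<Sum>j\<in>UNIV. cmod (x j))"
  have "cmod (x j) \<le> c" for j unfolding c_def by (rule member_le_sum) auto
  then have "(\<Sum>\<^sub>\<infinity>k. w k * (x (p i k) * cis (- (s \<bullet> b k)))) =
     (\<Sum>j\<in>UNIV. \<Sum>\<^sub>\<infinity>k. (if p i k = j then w k else 0) * (x j * cis (- (s \<bullet> b k))))"
    by (intro symbol_row[where x="\<lambda>j k. x j * cis (- (s \<bullet> b k))" and c=c]) (simp add: norm_mult)
  also have "\<dots> = (symbol s *v (\<chi> j. x j)) $ i"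
    by (simp add: matrix_vector_mult_def symbol_eq mult.commute mult.left_commute flip: infsum_cmult_right')
       (simp add: mult_ac)
  finally show ?thesis .
qed

text \<open>
  The Fourier transform of a field \<open>F\<close> with \<open>symbol (- s) *v F s = z *s F s\<close> is an eigenfunction, as
  a shift by \<open>b k\<close> multiplies \<open>F\<close> by \<open>cis (s \<bullet> b k)\<close>. Dividing the null vectors of \<open>kernel_field\<close> by one
  plus their norm and multiplying by a Gaussian makes \<open>F\<close> integrable and square integrable.
\<close>

lemma eigen_exists:
  assumes det: "\<And>s. det (symbol s - mat z) = 0"
  obtains f where "eigen z f" "\<And>i. sq_integrable (f i)" "\<not> (\<forall>i. AE u in lborel. f i u = 0)"
proof -
  define P where "P s = symbol (- s) - mat z" for s
  have Pm: "(\<lambda>s. P s $ i $ j) \<in> borel_measurable lborel" for i j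
  proof -
    have "(\<lambda>s. symbol (- s) $ i $ j) \<in> borel_measurable borel"
      using measurable_compose[OF borel_measurable_uminus[OF measurable_ident] symbol_measurable] by simp
    then show ?thesis by (simp add: P_def)
  qed
  have Pd: "det (P s) = 0" for s by (simp add: P_def det)
  have "\<not> (AE s in (lborel::'a measure). False)"
    by (subst eventually_const) (auto simp: ae_filter_eq_bot_iff)
  then obtain v :: "'a \<Rightarrow> complex^'n" where v: "\<And>i. (\<lambda>s. v s $ i) \<in> borel_measurable lborel"
    "AE s in lborel. P s *v v s = 0" "\<not> (AE s in lborel. v s = 0)"
    by (rule kernel_field[OF Pm Pd]) (rule that)
  \<comment> \<open>bounded by the Gaussian, and a nonzero multiple of \<open>v s\<close> at every \<open>s\<close>\<close>
  define F where "F j s = v s $ j / of_real (1 + (\<Sum>i\<in>UNIV. cmod (v s $ i))) * of_real (gaussian s)" for j s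
  have [measurable]: "(\<lambda>s. v s $ i) \<in> borel_measurable borel" for i using v(1) by simp
  have [measurable]: "F j \<in> borel_measurable borel" for j unfolding F_def[abs_def] by measurable
  have Fle: "cmod (F j s) \<le> gaussian s" for j s
  proof -
    have "cmod (v s $ j) \<le> (\<Sum>i\<in>UNIV. cmod (v s $ i))" by (rule member_le_sum) auto
    moreover have "(\<Sum>i\<in>UNIV. cmod (v s $ i)) \<ge> 0" by (rule sum_nonneg) auto
    ultimately have "cmod (v s $ j) / \<bar>1 + (\<Sum>i\<in>UNIV. cmod (v s $ i))\<bar> \<le> 1" by (simp add: divide_le_eq)
    from mult_right_mono[OF this, of "gaussian s"] gaussian_pos[of s] show ?thesis
      unfolding F_def norm_mult norm_divide norm_of_real abs_gaussian by simp
  qed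
  have F1: "integrable lborel (F j)" for j
    by (rule Bochner_Integration.integrable_bound[OF integrable_gaussian]) (use Fle in auto)
  have F2: "sq_integrable (F j)" for j
    unfolding sq_integrable_def
  proof
    show "integrable lborel (\<lambda>x. (cmod (F j x))\<^sup>2)"
    proof (rule Bochner_Integration.integrable_bound[OF integrable_gaussian])
      have "(cmod (F j s))\<^sup>2 \<le> gaussian s" for s
      proof -
        have "cmod (F j s) * cmod (F j s) \<le> gaussian s * gaussian s"
          by (rule mult_mono) (use Fle gaussian_pos[of s] in auto)
        then show ?thesis using gaussian_square_le[of s] by (simp add: power2_eq_square)
      qed
      then show "AE s in lborel. norm ((cmod (F j s))\<^sup>2) \<le> norm (gaussian s)" by simp
    qed simp
  qed simp
  have PF: "AE s in lborel. symbol (- s) *v (\<chi> j. F j s) = z *s (\<chi> j. F j s)"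
    using v(2)
  proof eventually_elim
    case (elim s)
    define r where "r = complex_of_real (gaussian s) / of_real (1 + (\<Sum>i\<in>UNIV. cmod (v s $ i)))"
    have e: "(\<chi> j. F j s) = r *s v s" by (simp add: vec_eq_iff F_def r_def)
    have "symbol (- s) *v v s = z *s v s"
      using elim by (simp add: P_def matrix_vector_mult_diff_rdistrib mat_mult_vec)
    then show ?case unfolding e by (simp add: matrix_vector_mult_scaleR vector_scalar_commute vector_smult_assoc mult.commute)
  qed
  define f where "f j = fourier (F j)" for j
  have "(\<Sum>\<^sub>\<infinity>k. w k * f (p i k) (u + b k)) = z * f i u" for i u
  proof -
    define N where "N = (\<Sum>j\<in>UNIV. \<integral>s. cmod (F j s) \<partial>lborel)"
    have N: "(\<integral>s. cmod (F j s) \<partial>lborel) \<le> N" for j unfolding N_def by (rule member_le_sum) auto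
    let ?g = "\<lambda>k s. w k * (F (p i k) s * cis (s \<bullet> b k) * cis (s \<bullet> u))"
    have gi: "integrable lborel (?g k)" for k
      by (intro integrable_mult_right integrable_cis_mult F1) auto
    have "(\<Sum>\<^sub>\<infinity>k. w k * f (p i k) (u + b k)) = (\<Sum>\<^sub>\<infinity>k. \<integral>s. ?g k s \<partial>lborel)"
      by (simp add: f_def fourier_shift) (simp add: fourier_def)
    also have "\<dots> = (\<integral>s. (\<Sum>\<^sub>\<infinity>k. ?g k s) \<partial>lborel)"
    proof (rule integral_infsum_int[OF gi, symmetric])
      show "(\<lambda>k. \<integral>s. norm (?g k s) \<partial>lborel) summable_on UNIV"
        by (rule w_norm_summable[where c=N]) (use N in \<open>auto simp: norm_mult mult_left_mono\<close>)
    qed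
    also have "\<dots> = (\<integral>s. z * (F i s * cis (s \<bullet> u)) \<partial>lborel)"
    proof (rule integral_cong_AE)
      show "AE s in lborel. (\<Sum>\<^sub>\<infinity>k. ?g k s) = z * (F i s * cis (s \<bullet> u))"
        using PF
      proof eventually_elim
        case (elim s)
        have "(\<Sum>\<^sub>\<infinity>k. ?g k s) = (\<Sum>\<^sub>\<infinity>k. w k * (F (p i k) s * cis (- ((- s) \<bullet> b k)))) * cis (s \<bullet> u)"
          by (simp add: mult.assoc flip: infsum_cmult_left')
        also have "\<dots> = z * (F i s * cis (s \<bullet> u))"
          by (subst symbol_mult_vec) (simp add: elim)
        finally show ?case .
      qed
    qed measurable
    also have "\<dots> = z * f i u" by (simp add: f_def fourier_def)
    finally show ?thesis .
  qed
  then have "eigen z f" by (simp add: eigen_def)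
  moreover have "sq_integrable (f i)" for i unfolding f_def by (rule sq_integrable_fourier[OF F1 F2])
  moreover have "\<not> (\<forall>i. AE u in lborel. f i u = 0)"
  proof
    assume z: "\<forall>i. AE u in lborel. f i u = 0"
    have "AE s in lborel. F i s = 0" for i
    proof (rule fourier_L1_unique[OF F1])
      have "AE s in lebesgue. s \<in> fourier (F i) -` {0}"
        using z by (auto simp: f_def intro: AE_completion)
      moreover have "closed (fourier (F i) -` {0})"
        using continuous_on_fourier[OF F1] by (intro closed_vimage) auto
      ultimately show "fourier (F i) s = 0" for s
        using mem_closed_if_AE_lebesgue by blast
    qed
    then have "AE s in lborel. \<forall>i\<in>UNIV. F i s = 0" by (intro AE_finite_allI) auto
    then have "AE s in lborel. v s = 0"
    proof eventually_elim
      case (elim s)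
      have "(\<Sum>i\<in>UNIV. cmod (v s $ i)) \<ge> 0" by (rule sum_nonneg) auto
      then have "complex_of_real (1 + (\<Sum>i\<in>UNIV. cmod (v s $ i))) \<noteq> 0"
        unfolding of_real_eq_0_iff by linarith
      then show ?case using elim gaussian_pos[of s] by (auto simp: F_def vec_eq_iff)
    qed
    with v(3) show False by simp
  qed
  ultimately show thesis by (rule that)
qed

end

lemma sq_integrable_bounded_mult:
  assumes G: "sq_integrable G" and [measurable]: "h \<in> borel_measurable borel" and h: "\<And>s. cmod (h s) \<le> c"
  shows "sq_integrable (\<lambda>s. h s * G s)"
proof -
  note [measurable] = G[THEN sq_integrableD]
  have "integrable lborel (\<lambda>x. c\<^sup>2 * (cmod (G x))\<^sup>2)" using G by (auto simp: sq_integrable_def)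
  then have "integrable lborel (\<lambda>x. (cmod (h x * G x))\<^sup>2)"
  proof (rule Bochner_Integration.integrable_bound)
    show "AE x in lborel. norm ((cmod (h x * G x))\<^sup>2) \<le> norm (c\<^sup>2 * (cmod (G x))\<^sup>2)"
      using h by (auto intro!: AE_I2 mult_right_mono power_mono simp: norm_mult power_mult_distrib)
  qed measurable
  then show ?thesis by (simp add: sq_integrable_def)
qed

lemma integrable_bounded_mult:
  fixes G :: "'a::euclidean_space \<Rightarrow> complex"
  assumes G: "integrable lborel G" and [measurable]: "h \<in> borel_measurable borel" and h: "\<And>s. cmod (h s) \<le> c"
  shows "integrable lborel (\<lambda>s. h s * G s)"
proof -
  note [measurable] = G[THEN borel_measurable_integrable]
  have "integrable lborel (\<lambda>x. c * cmod (G x))" using G by auto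
  then show ?thesis
  proof (rule Bochner_Integration.integrable_bound)
    show "AE x in lborel. norm (h x * G x) \<le> norm (c * cmod (G x))"
      using h order_trans[OF norm_ge_zero h] by (auto intro!: AE_I2 mult_right_mono simp: norm_mult)
  qed measurable
qed

text \<open>
  The transform of a translated Gaussian is a Gaussian times a character. So the hypothesis says
  that the integrable function \<open>f * gaussian\<close> has vanishing Fourier transform.
\<close>

lemma fourier_L2_unique:
  fixes f :: "'a::euclidean_space \<Rightarrow> complex"
  assumes f: "sq_integrable f"
    and z: "\<And>a. (\<integral>u. f u * fourier (\<lambda>s. of_real (gaussian (s - a))) u \<partial>lborel) = 0"
  shows "AE u in lborel. f u = 0"
proof -
  define c where "c = complex_of_real (sqrt (2 * pi) ^ DIM('a))"
  have g: "sq_integrable (\<lambda>u::'a. complex_of_real (gaussian u))"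
    unfolding sq_integrable_def
  proof
    show "integrable lborel (\<lambda>x::'a. (cmod (complex_of_real (gaussian x)))\<^sup>2)"
      by (intro Bochner_Integration.integrable_bound[OF integrable_gaussian])
         (auto simp: power2_eq_square gaussian_square_le)
  qed simp
  have i: "integrable lborel (\<lambda>u. f u * of_real (gaussian u))" by (rule sq_integrable_mult[OF f g])
  have "AE u in lborel. f u * of_real (gaussian u) = 0"
  proof (rule fourier_L1_unique[OF i])
    fix a
    have "0 = (\<integral>u. f u * fourier (\<lambda>s. of_real (gaussian (s - a))) u \<partial>lborel)" by (simp add: z)
    also have "\<dots> = (\<integral>u. c * (f u * of_real (gaussian u) * cis (u \<bullet> a)) \<partial>lborel)"
      by (simp add: fourier_gaussian_translate c_def mult_ac)
    also have "\<dots> = c * fourier (\<lambda>u. f u * of_real (gaussian u)) a"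
      by (simp add: fourier_def)
    finally show "fourier (\<lambda>u. f u * of_real (gaussian u)) a = 0" by (simp add: c_def)
  qed
  then show ?thesis by eventually_elim (use gaussian_pos in \<open>auto simp: less_le\<close>)
qed

context shift_system
begin

text \<open>
  The eigenvalue equation is multiplied by the transforms of the \<open>F i\<close>, integrated and summed. The
  shifts are then moved from \<open>f\<close> to these transforms, where they become multiplications of \<open>F i\<close> by
  the entries of the symbol.
\<close>

lemma eigen_pairing:
  assumes eig: "eigen z f" and f: "\<And>j. sq_integrable (f j)"
    and F1: "\<And>i. integrable lborel (F i)" and F2: "\<And>i. sq_integrable (F i)"
  shows "(\<Sum>j\<in>UNIV. \<integral>u. f j u * fourier (\<lambda>s. \<Sum>i\<in>UNIV. F i s * (symbol s - mat z) $ i $ j) u \<partial>lborel) = 0"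
proof -
  define g where "g i = fourier (F i)" for i
  have g: "sq_integrable (g i)" for i unfolding g_def by (rule sq_integrable_fourier[OF F1 F2])
  have [measurable]: "f j \<in> borel_measurable borel" "g j \<in> borel_measurable borel" for j
    using f g by (auto simp: sq_integrable_def)
  define B where "B = (\<Sum>j\<in>UNIV. \<integral>u. (cmod (f j u))\<^sup>2 \<partial>lborel) + (\<Sum>j\<in>UNIV. \<integral>u. (cmod (g j u))\<^sup>2 \<partial>lborel)"
  have fgB: "(\<integral>u. cmod (f j u * g i (u + c)) \<partial>lborel) \<le> B" for i j c
  proof -
    define F2 where "F2 = (\<integral>u. (cmod (f j u))\<^sup>2 \<partial>lborel)"
    define G2 where "G2 = (\<integral>u. (cmod (g i u))\<^sup>2 \<partial>lborel)"
    have "F2 \<ge> 0" "G2 \<ge> 0" by (simp_all add: F2_def G2_def)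
    have "(\<integral>u. cmod (f j u * g i (u + c)) \<partial>lborel) \<le> sqrt F2 * sqrt G2"
      using integral_norm_mult_le[OF f sq_integrable_shift(1)[OF g]]
      by (simp add: sq_integrable_shift(2)[OF g] F2_def G2_def)
    also have "\<dots> \<le> F2 + G2"
      using arith_geo_mean_sqrt[OF \<open>F2 \<ge> 0\<close> \<open>G2 \<ge> 0\<close>] \<open>F2 \<ge> 0\<close> \<open>G2 \<ge> 0\<close> by (simp add: real_sqrt_mult)
    also have "\<dots> \<le> B" unfolding B_def F2_def G2_def by (intro add_mono member_le_sum) auto
    finally show ?thesis .
  qed
  have shift: "(\<integral>u. f j (u + c) * g i u \<partial>lborel) = (\<integral>u. f j u * g i (u - c) \<partial>lborel)"
    "(\<integral>u. cmod (f j (u + c) * g i u) \<partial>lborel) = (\<integral>u. cmod (f j u * g i (u - c)) \<partial>lborel)" for i j c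
  proof -
    have i: "integrable lborel (\<lambda>u. f j u * g i (u + - c))"
      by (rule sq_integrable_mult[OF f sq_integrable_shift(1)[OF g]])
    show "(\<integral>u. f j (u + c) * g i u \<partial>lborel) = (\<integral>u. f j u * g i (u - c) \<partial>lborel)"
      using lborel_integral_affine[OF i, of 1 c] by (simp add: add.commute)
    show "(\<integral>u. cmod (f j (u + c) * g i u) \<partial>lborel) = (\<integral>u. cmod (f j u * g i (u - c)) \<partial>lborel)"
      using lborel_integral_affine[OF integrable_norm[OF i], of 1 c] by (simp add: add.commute)
  qed
  define \<phi> where "\<phi> i j s = F i s * symbol s $ i $ j" for i j s
  \<comment> \<open>the entries of the symbol are bounded, so that the products \<open>\<phi> i j\<close> stay square integrable\<close>
  define W where "W = (\<Sum>\<^sub>\<infinity>k. cmod (w k))"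
  have sym_le: "cmod (symbol s $ i $ j) \<le> W" for s i j
  proof -
    have "(\<lambda>k. norm ((if p i k = j then w k else 0) * cis (- (s \<bullet> b k)))) summable_on UNIV"
      by (rule w_norm_summable[where c=1]) (auto simp: norm_mult)
    from norm_infsum_bound[OF this]
    have "cmod (symbol s $ i $ j) \<le> (\<Sum>\<^sub>\<infinity>k. norm ((if p i k = j then w k else 0) * cis (- (s \<bullet> b k))))"
      by (simp add: symbol_eq)
    also have "\<dots> \<le> W" unfolding W_def
      by (rule infsum_mono[OF \<open>_ summable_on UNIV\<close> w]) (auto simp: norm_mult)
    finally show ?thesis .
  qed
  have \<phi>1: "integrable lborel (\<phi> i j)" and \<phi>2: "sq_integrable (\<phi> i j)" for i j
    unfolding \<phi>_def[abs_def]
    using integrable_bounded_mult[OF F1[of i] symbol_measurable sym_le] sq_integrable_bounded_mult[OF F2[of i] symbol_measurable sym_le]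
    by (simp_all add: mult.commute)
  have row: "(\<Sum>\<^sub>\<infinity>k. (if p i k = j then w k else 0) * g i (u - b k)) = fourier (\<phi> i j) u" for i j u
  proof -
    let ?h = "\<lambda>k s. (if p i k = j then w k else 0) * (F i s * cis (- (s \<bullet> b k)) * cis (s \<bullet> u))"
    have hi: "integrable lborel (?h k)" for k by (intro integrable_mult_right integrable_cis_mult F1) auto
    have "(\<Sum>\<^sub>\<infinity>k. (if p i k = j then w k else 0) * g i (u - b k)) = (\<Sum>\<^sub>\<infinity>k. \<integral>s. ?h k s \<partial>lborel)"
      using fourier_shift[of "F i" u "- b k" for k] unfolding g_def by (simp add: fourier_def)
    also have "\<dots> = (\<integral>s. (\<Sum>\<^sub>\<infinity>k. ?h k s) \<partial>lborel)"
    proof (rule integral_infsum_int[OF hi, symmetric])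
      show "(\<lambda>k. \<integral>s. norm (?h k s) \<partial>lborel) summable_on UNIV"
        by (rule w_norm_summable[where c="\<integral>s. cmod (F i s) \<partial>lborel"]) (auto simp: norm_mult)
    qed
    also have "\<dots> = (\<integral>s. \<phi> i j s * cis (s \<bullet> u) \<partial>lborel)"
    proof (rule Bochner_Integration.integral_cong[OF refl])
      fix s
      have "(\<Sum>\<^sub>\<infinity>k. ?h k s) = (\<Sum>\<^sub>\<infinity>k. (if p i k = j then w k else 0) * cis (- (s \<bullet> b k)) * (F i s * cis (s \<bullet> u)))"
        by (simp add: mult_ac)
      also have "\<dots> = symbol s $ i $ j * (F i s * cis (s \<bullet> u))"
        by (simp only: infsum_cmult_left' symbol_eq)
      finally show "(\<Sum>\<^sub>\<infinity>k. ?h k s) = \<phi> i j s * cis (s \<bullet> u)" by (simp add: \<phi>_def mult_ac)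
    qed
    finally show ?thesis by (simp add: fourier_def)
  qed
  have i1: "z * (\<integral>u. f i u * g i u \<partial>lborel) = (\<Sum>j\<in>UNIV. \<integral>u. f j u * fourier (\<phi> i j) u \<partial>lborel)" for i
  proof -
    let ?h = "\<lambda>k u. w k * (f (p i k) (u + b k) * g i u)"
    let ?h' = "\<lambda>k u. w k * (f (p i k) u * g i (u - b k))"
    have hi: "integrable lborel (?h k)" for k
      by (intro integrable_mult_right sq_integrable_mult[OF sq_integrable_shift(1)[OF f] g])
    have hi': "integrable lborel (?h' k)" for k
      using sq_integrable_mult[OF f sq_integrable_shift(1)[OF g, of i "- b k"], of "p i k"]
      by (intro integrable_mult_right) simp
    have "z * (\<integral>u. f i u * g i u \<partial>lborel) = (\<integral>u. z * f i u * g i u \<partial>lborel)"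
      by (simp add: mult.assoc)
    also have "\<dots> = (\<integral>u. (\<Sum>\<^sub>\<infinity>k. ?h k u) \<partial>lborel)"
    proof (rule integral_cong_AE)
      show "AE u in lborel. z * f i u * g i u = (\<Sum>\<^sub>\<infinity>k. ?h k u)"
        using eig[unfolded eigen_def, rule_format, of i]
      proof eventually_elim
        case (elim u)
        show ?case unfolding elim[symmetric] by (simp add: mult.assoc flip: infsum_cmult_left')
      qed
    qed measurable
    also have "\<dots> = (\<Sum>\<^sub>\<infinity>k. \<integral>u. ?h k u \<partial>lborel)"
    proof (rule integral_infsum_int[OF hi])
      show "(\<lambda>k. \<integral>u. norm (?h k u) \<partial>lborel) summable_on UNIV"
        by (rule w_norm_summable[where c=B])
           (use fgB[of "p i k" i "- b k" for k] in \<open>auto simp: norm_mult[of "w _"] shift(2) intro!: mult_left_mono\<close>)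
    qed
    also have "\<dots> = (\<Sum>\<^sub>\<infinity>k. \<integral>u. ?h' k u \<partial>lborel)" by (simp add: shift(1))
    also have "\<dots> = (\<integral>u. (\<Sum>\<^sub>\<infinity>k. ?h' k u) \<partial>lborel)"
    proof (rule integral_infsum_int[OF hi', symmetric])
      show "(\<lambda>k. \<integral>u. norm (?h' k u) \<partial>lborel) summable_on UNIV"
        by (rule w_norm_summable[where c=B])
           (use fgB[of "p i k" i "- b k" for k] in \<open>auto simp: norm_mult[of "w _"] intro!: mult_left_mono\<close>)
    qed
    also have "\<dots> = (\<integral>u. (\<Sum>j\<in>UNIV. f j u * fourier (\<phi> i j) u) \<partial>lborel)"
    proof (rule Bochner_Integration.integral_cong[OF refl])
      fix u
      define c where "c = (\<Sum>j\<in>UNIV. cmod (f j u))"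
      define M where "M = (\<integral>s. cmod (F i s) \<partial>lborel)"
      have "cmod (f j u * g i v) \<le> c * M" for j v
      proof -
        have "cmod (f j u) \<le> c" unfolding c_def by (rule member_le_sum) auto
        moreover have "cmod (g i v) \<le> M" unfolding g_def M_def by (rule norm_fourier_le[OF F1])
        ultimately show ?thesis unfolding norm_mult by (intro mult_mono) (auto simp: c_def intro: sum_nonneg)
      qed
      then have "(\<Sum>\<^sub>\<infinity>k. ?h' k u) = (\<Sum>j\<in>UNIV. \<Sum>\<^sub>\<infinity>k. (if p i k = j then w k else 0) * (f j u * g i (u - b k)))"
        by (intro symbol_row[where x="\<lambda>j k. f j u * g i (u - b k)" and c="c * M"])
      also have "\<dots> = (\<Sum>j\<in>UNIV. \<Sum>\<^sub>\<infinity>k. f j u * ((if p i k = j then w k else 0) * g i (u - b k)))"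
        by (simp only: mult.left_commute)
      finally show "(\<Sum>\<^sub>\<infinity>k. ?h' k u) = (\<Sum>j\<in>UNIV. f j u * fourier (\<phi> i j) u)"
        by (simp add: infsum_cmult_right' row)
    qed
    also have "\<dots> = (\<Sum>j\<in>UNIV. \<integral>u. f j u * fourier (\<phi> i j) u \<partial>lborel)"
      by (intro Bochner_Integration.integral_sum sq_integrable_mult f sq_integrable_fourier(1) \<phi>1 \<phi>2)
    finally show ?thesis .
  qed
  have "(\<integral>u. f j u * fourier (\<lambda>s. \<Sum>i\<in>UNIV. F i s * (symbol s - mat z) $ i $ j) u \<partial>lborel) =
     (\<Sum>i\<in>UNIV. \<integral>u. f j u * fourier (\<phi> i j) u \<partial>lborel) - z * (\<integral>u. f j u * g j u \<partial>lborel)" for j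
  proof -
    have e: "(\<Sum>i\<in>UNIV. F i s * (symbol s - mat z) $ i $ j) = (\<Sum>i\<in>UNIV. \<phi> i j s) - z * F j s" for s
    proof -
      have "(\<Sum>i\<in>UNIV. F i s * (symbol s - mat z) $ i $ j) = (\<Sum>i\<in>UNIV. \<phi> i j s - (if i = j then z * F i s else 0))"
        by (intro sum.cong refl) (auto simp: \<phi>_def mat_def right_diff_distrib)
      then show ?thesis by (simp add: sum_subtractf)
    qed
    have "fourier (\<lambda>s. (\<Sum>i\<in>UNIV. \<phi> i j s) - z * F j s) u = (\<Sum>i\<in>UNIV. fourier (\<phi> i j) u) - z * g j u" for u
    proof -
      have "fourier (\<lambda>s. (\<Sum>i\<in>UNIV. \<phi> i j s) - z * F j s) u =
        (\<integral>s. (\<Sum>i\<in>UNIV. \<phi> i j s * cis (s \<bullet> u)) - z * (F j s * cis (s \<bullet> u)) \<partial>lborel)"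
        by (simp add: fourier_def left_diff_distrib sum_distrib_right mult.assoc)
      also have "\<dots> = (\<integral>s. (\<Sum>i\<in>UNIV. \<phi> i j s * cis (s \<bullet> u)) \<partial>lborel) - (\<integral>s. z * (F j s * cis (s \<bullet> u)) \<partial>lborel)"
        by (intro Bochner_Integration.integral_diff Bochner_Integration.integrable_sum integrable_mult_right integrable_cis_mult \<phi>1 F1) auto
      also have "(\<integral>s. (\<Sum>i\<in>UNIV. \<phi> i j s * cis (s \<bullet> u)) \<partial>lborel) = (\<Sum>i\<in>UNIV. fourier (\<phi> i j) u)"
        unfolding fourier_def by (intro Bochner_Integration.integral_sum integrable_cis_mult \<phi>1) auto
      finally show ?thesis by (simp add: g_def fourier_def)
    qed
    then have "(\<integral>u. f j u * fourier (\<lambda>s. \<Sum>i\<in>UNIV. F i s * (symbol s - mat z) $ i $ j) u \<partial>lborel) =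
      (\<integral>u. (\<Sum>i\<in>UNIV. f j u * fourier (\<phi> i j) u) - z * (f j u * g j u) \<partial>lborel)"
      unfolding e by (simp add: right_diff_distrib sum_distrib_left mult.left_commute)
    also have "\<dots> = (\<integral>u. (\<Sum>i\<in>UNIV. f j u * fourier (\<phi> i j) u) \<partial>lborel) - (\<integral>u. z * (f j u * g j u) \<partial>lborel)"
      by (intro Bochner_Integration.integral_diff Bochner_Integration.integrable_sum integrable_mult_right
          sq_integrable_mult f g sq_integrable_fourier(1) \<phi>1 \<phi>2)
    also have "(\<integral>u. (\<Sum>i\<in>UNIV. f j u * fourier (\<phi> i j) u) \<partial>lborel) = (\<Sum>i\<in>UNIV. \<integral>u. f j u * fourier (\<phi> i j) u \<partial>lborel)"
      by (intro Bochner_Integration.integral_sum sq_integrable_mult f sq_integrable_fourier(1) \<phi>1 \<phi>2)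
    finally show ?thesis by simp
  qed
  then show ?thesis
    by (simp add: sum_subtractf i1) (subst sum.swap, simp)
qed

text \<open>
  In \<open>eigen_pairing\<close> the \<open>F i\<close> are chosen as row \<open>m\<close> of the inverse of \<open>symbol s - mat z\<close>, times a
  Gaussian \<open>G\<close>. Then only the integral of \<open>f m\<close> against the transform of \<open>G\<close> is left. For
  integrability the inverse is cut off where it exceeds \<open>n\<close>; the Plancherel inequality controls the
  error for \<open>n \<rightarrow> \<infinity>\<close>.
\<close>

lemma eigen_unique:
  assumes eig: "eigen z f" and f: "\<And>j. sq_integrable (f j)"
    and det: "AE s in lborel. det (symbol s - mat z) \<noteq> 0"
  shows "AE u in lborel. f m u = 0"
proof (rule fourier_L2_unique[OF f])
  fix a :: 'a
  define G where "G s = complex_of_real (gaussian (s - a))" for s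
  have [measurable]: "G \<in> borel_measurable borel" unfolding G_def[abs_def] by measurable
  have Gint: "integrable lborel (\<lambda>s. gaussian (s - a))"
    using lborel_integrable_affine[OF integrable_gaussian, of 1 "- a"] by simp
  have G1: "integrable lborel G" unfolding G_def[abs_def] using Gint by simp
  have G2: "sq_integrable G"
    unfolding sq_integrable_def
  proof
    show "integrable lborel (\<lambda>x. (cmod (G x))\<^sup>2)"
      unfolding G_def
      by (intro Bochner_Integration.integrable_bound[OF Gint])
         (auto simp: power2_eq_square gaussian_square_le)
  qed simp
  define P where "P s = symbol s - mat z" for s
  have [measurable]: "(\<lambda>s. P s $ i $ j) \<in> borel_measurable borel" for i j
    unfolding P_def by simp
  define Q where "Q i s = adjugate (P s) $ m $ i / det (P s)" for i s
  have det_meas: "(\<lambda>s. det (M s)) \<in> borel_measurable borel"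
    if "\<And>i j. (\<lambda>s. M s $ i $ j) \<in> borel_measurable borel" for M :: "'a \<Rightarrow> complex^'n^'n"
    unfolding det_def using that by (intro borel_measurable_sum borel_measurable_times borel_measurable_prod) auto
  have [measurable]: "(\<lambda>s. det (P s)) \<in> borel_measurable borel" by (rule det_meas) measurable
  have [measurable]: "(\<lambda>s. adjugate (P s) $ i $ j) \<in> borel_measurable borel" for i j
    unfolding adjugate_def vec_lambda_beta
  proof (rule det_meas)
    fix r c show "(\<lambda>s. (\<chi> r. if r = j then axis i 1 else P s $ r) $ r $ c) \<in> borel_measurable borel"
      by (cases "r = j") auto
  qed
  have [measurable]: "Q i \<in> borel_measurable borel" for i unfolding Q_def[abs_def] by measurable
  have QP: "(\<Sum>i\<in>UNIV. Q i s * P s $ i $ j) = (if m = j then 1 else 0)" if "det (P s) \<noteq> 0" for s j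
  proof -
    define R where "R = (\<chi> i j. adjugate (P s) $ i $ j / det (P s))"
    have "P s ** R = mat 1"
    proof -
      have "(P s ** R) $ i $ j = (P s ** adjugate (P s)) $ i $ j / det (P s)" for i j
        by (simp add: R_def matrix_matrix_mult_def sum_divide_distrib)
      then show ?thesis using that by (simp add: vec_eq_iff adjugate_right mat_def)
    qed
    then have "R ** P s = mat 1" by (simp add: matrix_left_right_inverse)
    from arg_cong[OF this, of "\<lambda>X. X $ m $ j"] show ?thesis
      by (simp add: matrix_matrix_mult_def R_def Q_def mat_def)
  qed
  \<comment> \<open>on \<open>E n\<close> the row of the inverse is bounded by \<open>n\<close>; almost every point lies in some \<open>E n\<close>\<close>
  define E where "E n = {s. det (P s) \<noteq> 0 \<and> (\<Sum>i\<in>UNIV. cmod (Q i s)) \<le> real n}" for n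
  have [measurable]: "E n \<in> sets borel" for n unfolding E_def by measurable
  define H where "H n i s = indicator (E n) s * Q i s" for n i s
  have [measurable]: "H n i \<in> borel_measurable borel" for n i unfolding H_def[abs_def] by measurable
  have Hle: "cmod (H n i s) \<le> real n" for n i s
  proof -
    have "cmod (Q i s) \<le> (\<Sum>i\<in>UNIV. cmod (Q i s))" by (rule member_le_sum) auto
    then show ?thesis by (auto simp: H_def E_def indicator_def)
  qed
  define GE where "GE n s = indicator (E n) s * G s" for n s
  have GE1: "integrable lborel (GE n)" and GE2: "sq_integrable (GE n)" for n
    unfolding GE_def[abs_def]
    by (rule integrable_bounded_mult[OF G1, of _ 1] sq_integrable_bounded_mult[OF G2, of _ 1]; simp add: indicator_def)+
  have zero: "(\<integral>u. f m u * fourier (GE n) u \<partial>lborel) = 0" for n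
  proof -
    have HG: "(\<lambda>s. \<Sum>i\<in>UNIV. (H n i s * G s) * (symbol s - mat z) $ i $ j) = (\<lambda>s. if m = j then GE n s else 0)" for j
    proof
      fix s
      have "(\<Sum>i\<in>UNIV. (H n i s * G s) * (symbol s - mat z) $ i $ j) = indicator (E n) s * G s * (\<Sum>i\<in>UNIV. Q i s * P s $ i $ j)"
        by (simp add: sum_distrib_left H_def P_def mult_ac)
      also have "\<dots> = (if m = j then GE n s else 0)"
        by (cases "s \<in> E n") (auto simp: GE_def QP E_def)
      finally show "(\<Sum>i\<in>UNIV. (H n i s * G s) * (symbol s - mat z) $ i $ j) = (if m = j then GE n s else 0)" .
    qed
    have "(\<Sum>j\<in>UNIV. \<integral>u. f j u * fourier (\<lambda>s. \<Sum>i\<in>UNIV. (H n i s * G s) * (symbol s - mat z) $ i $ j) u \<partial>lborel) = 0"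
      by (rule eigen_pairing[OF eig f integrable_bounded_mult[OF G1 _ Hle] sq_integrable_bounded_mult[OF G2 _ Hle]]) measurable
    then have "(\<Sum>j\<in>UNIV. \<integral>u. f j u * fourier (\<lambda>s. if m = j then GE n s else 0) u \<partial>lborel) = 0"
      by (simp only: HG)
    moreover have "(\<integral>u. f j u * fourier (\<lambda>s. if m = j then GE n s else 0) u \<partial>lborel) =
        (if m = j then \<integral>u. f m u * fourier (GE n) u \<partial>lborel else 0)" for j
      by (auto simp: fourier_def)
    ultimately show ?thesis by simp
  qed
  define D where "D n s = G s - GE n s" for n s
  have D1: "integrable lborel (D n)" for n unfolding D_def[abs_def] using G1 GE1 by auto
  have Deq: "D n s = indicator (- E n) s * G s" for n s by (simp add: D_def GE_def indicator_def)
  have D2: "sq_integrable (D n)" for n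
    unfolding Deq[abs_def] by (rule sq_integrable_bounded_mult[OF G2, of _ 1]) (auto simp: indicator_def)
  have lim: "(\<lambda>n. \<integral>s. (cmod (D n s))\<^sup>2 \<partial>lborel) \<longlonglongrightarrow> (\<integral>s. (0::real) \<partial>(lborel::'a measure))"
  proof (rule integral_dominated_convergence[where w="\<lambda>s. (cmod (G s))\<^sup>2"])
    show "AE s in lborel. (\<lambda>n. (cmod (D n s))\<^sup>2) \<longlonglongrightarrow> 0"
      using det
    proof eventually_elim
      case (elim s)
      obtain N :: nat where N: "(\<Sum>i\<in>UNIV. cmod (Q i s)) \<le> real N" using real_arch_simple by blast
      have "\<forall>\<^sub>F n in sequentially. (cmod (D n s))\<^sup>2 = 0"
        by (rule eventually_sequentiallyI[of N]) (use N elim in \<open>auto simp: Deq E_def P_def indicator_def\<close>)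
      then show ?case by (rule tendsto_eventually)
    qed
    show "AE s in lborel. norm ((cmod (D n s))\<^sup>2) \<le> (cmod (G s))\<^sup>2" for n
      by (auto simp: Deq indicator_def)
    show "integrable lborel (\<lambda>s. (cmod (G s))\<^sup>2)" using G2 by (simp add: sq_integrable_def)
  qed (auto simp: Deq)
  define c where "c = (2 * pi) ^ DIM('a)"
  have bound: "cmod (\<integral>u. f m u * fourier G u \<partial>lborel) \<le>
     sqrt (\<integral>u. (cmod (f m u))\<^sup>2 \<partial>lborel) * sqrt (c * (\<integral>s. (cmod (D n s))\<^sup>2 \<partial>lborel))" for n
  proof -
    have fD: "fourier (D n) u = fourier G u - fourier (GE n) u" for u
    proof -
      have "fourier (D n) u = (\<integral>s. G s * cis (s \<bullet> u) - GE n s * cis (s \<bullet> u) \<partial>lborel)"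
        by (simp add: fourier_def D_def left_diff_distrib)
      then show ?thesis unfolding fourier_def
        by (simp add: integrable_cis_mult[OF G1] integrable_cis_mult[OF GE1])
    qed
    have "(\<integral>u. f m u * fourier (D n) u \<partial>lborel) = (\<integral>u. f m u * fourier G u \<partial>lborel) - (\<integral>u. f m u * fourier (GE n) u \<partial>lborel)"
      unfolding fD right_diff_distrib
      by (intro Bochner_Integration.integral_diff sq_integrable_mult f sq_integrable_fourier(1) G1 G2 GE1 GE2)
    then have "cmod (\<integral>u. f m u * fourier G u \<partial>lborel) = cmod (\<integral>u. f m u * fourier (D n) u \<partial>lborel)"
      by (simp add: zero)
    also have "\<dots> \<le> (\<integral>u. cmod (f m u * fourier (D n) u) \<partial>lborel)" by (rule integral_norm_bound)
    also have "\<dots> \<le> sqrt (\<integral>u. (cmod (f m u))\<^sup>2 \<partial>lborel) * sqrt (\<integral>u. (cmod (fourier (D n) u))\<^sup>2 \<partial>lborel)"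
      by (rule integral_norm_mult_le[OF f sq_integrable_fourier(1)[OF D1 D2]])
    also have "\<dots> \<le> sqrt (\<integral>u. (cmod (f m u))\<^sup>2 \<partial>lborel) * sqrt (c * (\<integral>s. (cmod (D n s))\<^sup>2 \<partial>lborel))"
      unfolding c_def by (intro mult_left_mono real_sqrt_le_mono sq_integrable_fourier(2)[OF D1 D2]) auto
    finally show ?thesis .
  qed
  have "(\<lambda>n. sqrt (\<integral>u. (cmod (f m u))\<^sup>2 \<partial>lborel) * sqrt (c * (\<integral>s. (cmod (D n s))\<^sup>2 \<partial>lborel)))
    \<longlonglongrightarrow> sqrt (\<integral>u. (cmod (f m u))\<^sup>2 \<partial>lborel) * sqrt (c * (\<integral>s. (0::real) \<partial>(lborel::'a measure)))"
    by (intro tendsto_intros lim)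
  then have "cmod (\<integral>u. f m u * fourier G u \<partial>lborel) \<le> 0"
    using bound by (intro LIMSEQ_le_const) auto
  then show "(\<integral>u. f m u * fourier (\<lambda>s. complex_of_real (gaussian (s - a))) u \<partial>lborel) = 0"
    by (simp add: G_def[abs_def])
qed

end

section \<open>Resolvents of bounded operators\<close>

lemma L2_measurable: "f \<in> L2 \<Longrightarrow> f \<in> borel_measurable lebesgue"
  and L2_integrable: "f \<in> L2 \<Longrightarrow> integrable lebesgue (\<lambda>x. (cmod (f x))\<^sup>2)"
  by (simp_all add: L2_def)

lemma L2_norm_nonneg: "L2_norm f \<ge> 0" by (simp add: L2_norm_def)

lemma L2_norm_square: "(L2_norm f)\<^sup>2 = (\<integral>x. (cmod (f x))\<^sup>2 \<partial>lebesgue)"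
  by (simp add: L2_norm_def)

lemma L2_norm_le_iff: "c \<ge> 0 \<Longrightarrow> L2_norm f \<le> c \<longleftrightarrow> (\<integral>x. (cmod (f x))\<^sup>2 \<partial>lebesgue) \<le> c\<^sup>2"
  by (simp add: L2_norm_def real_sqrt_le_iff' real_le_lsqrt sqrt_le_D)

lemma cmod_add_square_le: "(cmod (a + b))\<^sup>2 \<le> 2 * (cmod a)\<^sup>2 + 2 * (cmod b)\<^sup>2"
proof -
  have "(cmod (a + b))\<^sup>2 \<le> (cmod a + cmod b)\<^sup>2" by (simp add: norm_triangle_ineq power_mono)
  also have "\<dots> \<le> 2 * (cmod a)\<^sup>2 + 2 * (cmod b)\<^sup>2"
    using sum_squares_bound[of "cmod a" "cmod b"] by (simp add: power2_sum)
  finally show ?thesis .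
qed

lemma L2_lincomb:
  assumes f: "f \<in> L2" and g: "g \<in> L2"
  shows "(\<lambda>x. \<alpha> * f x + \<beta> * g x) \<in> L2"
proof -
  note [measurable] = L2_measurable[OF f] L2_measurable[OF g]
  have "integrable lebesgue (\<lambda>x. (2 * (cmod \<alpha>)\<^sup>2) * (cmod (f x))\<^sup>2 + (2 * (cmod \<beta>)\<^sup>2) * (cmod (g x))\<^sup>2)"
    using L2_integrable[OF f] L2_integrable[OF g] by auto
  then have "integrable lebesgue (\<lambda>x. (cmod (\<alpha> * f x + \<beta> * g x))\<^sup>2)"
  proof (rule Bochner_Integration.integrable_bound)
    show "AE x in lebesgue. norm ((cmod (\<alpha> * f x + \<beta> * g x))\<^sup>2) \<le>
       norm ((2 * (cmod \<alpha>)\<^sup>2) * (cmod (f x))\<^sup>2 + (2 * (cmod \<beta>)\<^sup>2) * (cmod (g x))\<^sup>2)"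
      using cmod_add_square_le[of "\<alpha> * f x" "\<beta> * g x" for x]
      by (auto simp: norm_mult power_mult_distrib mult.assoc intro!: AE_I2 order_trans[OF _ abs_ge_self])
  qed measurable
  then show ?thesis by (simp add: L2_def)
qed

lemma L2_cmult: "f \<in> L2 \<Longrightarrow> (\<lambda>x. \<alpha> * f x) \<in> L2"
  using L2_lincomb[of f f \<alpha> 0] by simp

lemma L2_add: "f \<in> L2 \<Longrightarrow> g \<in> L2 \<Longrightarrow> (\<lambda>x. f x + g x) \<in> L2"
  using L2_lincomb[of f g 1 1] by simp

lemma L2_diff: "f \<in> L2 \<Longrightarrow> g \<in> L2 \<Longrightarrow> (\<lambda>x. f x - g x) \<in> L2"
  using L2_lincomb[of f g 1 "-1"] by simp

lemma L2_zero: "(\<lambda>_. 0) \<in> L2" by (simp add: L2_def)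

lemma L2_sum: "(\<And>i. i \<in> I \<Longrightarrow> f i \<in> L2) \<Longrightarrow> (\<lambda>x. \<Sum>i\<in>I. f i x) \<in> L2"
  by (induction I rule: infinite_finite_induct) (auto intro: L2_add L2_zero)

lemma L2_cong_AE:
  assumes "f \<in> L2" "AE x in lebesgue. f x = g x"
  shows "g \<in> L2"
proof -
  have [measurable]: "g \<in> borel_measurable lebesgue"
    by (rule borel_measurable_AE[OF L2_measurable[OF assms(1)] assms(2)])
  then show ?thesis using assms L2_integrable[OF assms(1)]
    by (auto simp: L2_def intro!: integrable_cong_AE_imp[OF L2_integrable[OF assms(1)]])
qed

lemma L2_norm_cong_AE:
  assumes "f \<in> L2" "AE x in lebesgue. f x = g x"
  shows "L2_norm f = L2_norm g"
proof -
  note [measurable] = L2_measurable[OF assms(1)] L2_measurable[OF L2_cong_AE[OF assms]]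
  have "(\<integral>x. (cmod (f x))\<^sup>2 \<partial>lebesgue) = (\<integral>x. (cmod (g x))\<^sup>2 \<partial>lebesgue)"
    by (rule integral_cong_AE) (use assms(2) in auto)
  then show ?thesis by (simp add: L2_norm_def)
qed

lemma L2_norm_eq_0:
  assumes f: "f \<in> L2" and z: "L2_norm f \<le> 0"
  shows "AE x in lebesgue. f x = 0"
proof -
  have "(\<integral>x. (cmod (f x))\<^sup>2 \<partial>lebesgue) = 0"
    using z L2_norm_nonneg[of f] L2_norm_square[of f] by simp
  then show ?thesis
    by (subst (asm) integral_nonneg_eq_0_iff_AE[OF L2_integrable[OF f]]) auto
qed

lemma L2_norm_0_AE: "AE x in lebesgue. f x = 0 \<Longrightarrow> L2_norm f = 0"
  by (subst L2_norm_cong_AE[OF L2_zero, of f, symmetric]) (auto simp: L2_norm_def)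

lemma L2_norm_cmult: "L2_norm (\<lambda>x. \<alpha> * f x) = cmod \<alpha> * L2_norm f"
  by (simp add: L2_norm_def norm_mult power_mult_distrib real_sqrt_mult)

lemma L2_norm_triangle:
  assumes f: "f \<in> L2" and g: "g \<in> L2"
  shows "L2_norm (\<lambda>x. f x + g x) \<le> L2_norm f + L2_norm g"
proof -
  note [measurable] = L2_measurable[OF f] L2_measurable[OF g]
  note fg_squares = L2_measurable[OF f] L2_measurable[OF g] L2_integrable[OF f] L2_integrable[OF g]
  have fg: "integrable lebesgue (\<lambda>x. cmod (f x) * cmod (g x))"
    using integrable_norm[OF integrable_mult_squares[OF fg_squares]] by (simp add: norm_mult)
  have cs: "(\<integral>x. cmod (f x) * cmod (g x) \<partial>lebesgue) \<le> L2_norm f * L2_norm g"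
    using Cauchy_Schwarz_integral[OF fg_squares] by (simp add: norm_mult L2_norm_def)
  have "(\<integral>x. (cmod (f x + g x))\<^sup>2 \<partial>lebesgue) \<le> (\<integral>x. ((cmod (f x))\<^sup>2 + (cmod (g x))\<^sup>2) + 2 * (cmod (f x) * cmod (g x)) \<partial>lebesgue)"
  proof (rule integral_mono)
    show "integrable lebesgue (\<lambda>x. (cmod (f x + g x))\<^sup>2)" by (rule L2_integrable[OF L2_add[OF f g]])
    show "integrable lebesgue (\<lambda>x. ((cmod (f x))\<^sup>2 + (cmod (g x))\<^sup>2) + 2 * (cmod (f x) * cmod (g x)))"
      using fg L2_integrable[OF f] L2_integrable[OF g] by auto
    fix x
    have "(cmod (f x + g x))\<^sup>2 \<le> (cmod (f x) + cmod (g x))\<^sup>2" by (simp add: norm_triangle_ineq power_mono)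
    then show "(cmod (f x + g x))\<^sup>2 \<le> ((cmod (f x))\<^sup>2 + (cmod (g x))\<^sup>2) + 2 * (cmod (f x) * cmod (g x))"
      by (simp add: power2_sum)
  qed
  also have "\<dots> = (L2_norm f)\<^sup>2 + (L2_norm g)\<^sup>2 + 2 * (\<integral>x. cmod (f x) * cmod (g x) \<partial>lebesgue)"
    using fg L2_integrable[OF f] L2_integrable[OF g] by (simp add: L2_norm_square)
  also have "\<dots> \<le> (L2_norm f + L2_norm g)\<^sup>2"
    using cs by (simp add: power2_sum)
  finally show ?thesis
    by (simp add: L2_norm_le_iff L2_norm_nonneg)
qed

lemma L2_norm_triangle_diff:
  assumes f: "f \<in> L2" and g: "g \<in> L2"
  shows "L2_norm (\<lambda>x. f x - g x) \<le> L2_norm f + L2_norm g"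
  using L2_norm_triangle[OF f L2_cmult[OF g, of "-1"]] by (simp add: L2_norm_cmult[of "-1", simplified])

lemma bounded_op_L2: "bounded_operator_L2 T \<Longrightarrow> f \<in> L2 \<Longrightarrow> T f \<in> L2"
  by (simp add: bounded_operator_L2_def)

lemma bounded_op_lin:
  "bounded_operator_L2 T \<Longrightarrow> f \<in> L2 \<Longrightarrow> g \<in> L2 \<Longrightarrow>
    AE x in lebesgue. T (\<lambda>y. \<alpha> * f y + \<beta> * g y) x = \<alpha> * T f x + \<beta> * T g x"
  by (simp add: bounded_operator_L2_def)

lemma bounded_op_bound:
  assumes "bounded_operator_L2 T"
  obtains K where "K > 0" "\<And>f. f \<in> L2 \<Longrightarrow> L2_norm (T f) \<le> K * L2_norm f"
proof -
  from assms obtain K where K: "\<forall>f\<in>L2. L2_norm (T f) \<le> K * L2_norm f"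
    by (auto simp: bounded_operator_L2_def)
  show thesis
  proof (rule that[of "max K 1"])
    fix f :: "real^'a \<Rightarrow> complex" assume "f \<in> L2"
    then have "L2_norm (T f) \<le> K * L2_norm f" using K by blast
    also have "\<dots> \<le> max K 1 * L2_norm f" by (intro mult_right_mono) (auto simp: L2_norm_nonneg)
    finally show "L2_norm (T f) \<le> max K 1 * L2_norm f" .
  qed simp
qed

lemma bounded_op_diff:
  assumes T: "bounded_operator_L2 T" "f \<in> L2" "g \<in> L2"
  shows "AE x in lebesgue. T (\<lambda>y. f y - g y) x = T f x - T g x"
  using bounded_op_lin[OF T, of 1 "-1"] by simp

text \<open>
  Linearity and boundedness make the image of a function that vanishes almost everywhere vanish
  almost everywhere.
\<close>

lemma bounded_op_cong:
  assumes T: "bounded_operator_L2 T" and f: "f \<in> L2" and fg: "AE x in lebesgue. f x = g x"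
  shows "AE x in lebesgue. T f x = T g x"
proof -
  have g: "g \<in> L2" by (rule L2_cong_AE[OF f fg])
  obtain K where K: "\<And>f. f \<in> L2 \<Longrightarrow> L2_norm (T f) \<le> K * L2_norm f" using bounded_op_bound[OF T] by blast
  have "L2_norm (T (\<lambda>y. f y - g y)) \<le> K * L2_norm (\<lambda>y. f y - g y)" by (intro K L2_diff f g)
  also have "L2_norm (\<lambda>y. f y - g y) = 0" by (rule L2_norm_0_AE) (use fg in auto)
  finally have "AE x in lebesgue. T (\<lambda>y. f y - g y) x = 0"
    by (intro L2_norm_eq_0 bounded_op_L2[OF T] L2_diff f g) simp
  then show ?thesis using bounded_op_diff[OF T f g] by eventually_elim simp
qed

text \<open>
  A right inverse picked arbitrarily is automatically linear, up to null sets, and a left inverse,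
  because \<open>T - z\<close> is injective up to null sets. So existence of a resolvent is a statement on norms
  and on solvability of equations, which is easily carried from one operator to another.
\<close>

lemma resolvent_set_iff:
  assumes T: "bounded_operator_L2 T"
  shows "z \<in> resolvent_set_L2 T \<longleftrightarrow>
    (\<exists>K>0. \<forall>h\<in>L2. L2_norm h \<le> K * L2_norm (\<lambda>x. T h x - z * h x)) \<and>
    (\<forall>f\<in>L2. \<exists>h\<in>L2. AE x in lebesgue. T h x - z * h x = f x)"
proof (intro iffI conjI)
  assume "z \<in> resolvent_set_L2 T"
  then obtain R where R: "bounded_operator_L2 R"
    "\<And>f. f \<in> L2 \<Longrightarrow> AE x in lebesgue. T (R f) x - z * R f x = f x"
    "\<And>f. f \<in> L2 \<Longrightarrow> AE x in lebesgue. R (\<lambda>y. T f y - z * f y) x = f x"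
    by (auto simp: resolvent_set_L2_def)
  show "\<forall>f\<in>L2. \<exists>h\<in>L2. AE x in lebesgue. T h x - z * h x = f x"
    using R bounded_op_L2 by blast
  obtain K where K: "K > 0" "\<And>f. f \<in> L2 \<Longrightarrow> L2_norm (R f) \<le> K * L2_norm f"
    using bounded_op_bound[OF R(1)] by blast
  show "\<exists>K>0. \<forall>h\<in>L2. L2_norm h \<le> K * L2_norm (\<lambda>x. T h x - z * h x)"
  proof (intro exI[of _ K] conjI ballI K(1))
    fix h :: "real^'a \<Rightarrow> complex" assume h: "h \<in> L2"
    then have Th: "(\<lambda>x. T h x - z * h x) \<in> L2" by (intro L2_diff L2_cmult bounded_op_L2[OF T])
    show "L2_norm h \<le> K * L2_norm (\<lambda>x. T h x - z * h x)"
      using K(2)[OF Th] L2_norm_cong_AE[OF bounded_op_L2[OF R(1) Th] R(3)[OF h]] by simp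
  qed
next
  assume a: "(\<exists>K>0. \<forall>h\<in>L2. L2_norm h \<le> K * L2_norm (\<lambda>x. T h x - z * h x)) \<and>
    (\<forall>f\<in>L2. \<exists>h\<in>L2. AE x in lebesgue. T h x - z * h x = f x)"
  then obtain K where K: "K > 0" "\<And>h. h \<in> L2 \<Longrightarrow> L2_norm h \<le> K * L2_norm (\<lambda>x. T h x - z * h x)" by blast
  from a obtain R where R: "\<And>f. f \<in> L2 \<Longrightarrow> R f \<in> L2"
    "\<And>f. f \<in> L2 \<Longrightarrow> AE x in lebesgue. T (R f) x - z * R f x = f x"
    by metis
  have inj: "AE x in lebesgue. h x = h' x"
    if h: "h \<in> L2" "h' \<in> L2" and e: "AE x in lebesgue. T h x - z * h x = T h' x - z * h' x" for h h'
  proof -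
    have "AE x in lebesgue. T (\<lambda>y. h y - h' y) x - z * (h x - h' x) = 0"
      using e bounded_op_diff[OF T h]
    proof eventually_elim
      case (elim x)
      show ?case unfolding elim(2) using elim(1) by (simp add: algebra_simps)
    qed
    then have "L2_norm (\<lambda>x. T (\<lambda>y. h y - h' y) x - z * (h x - h' x)) = 0" by (rule L2_norm_0_AE)
    with K(2)[OF L2_diff[OF h]] have "AE x in lebesgue. h x - h' x = 0"
      by (intro L2_norm_eq_0 L2_diff h) simp
    then show ?thesis by simp
  qed
  show "z \<in> resolvent_set_L2 T"
    unfolding resolvent_set_L2_def bounded_operator_L2_def
  proof (intro CollectI exI[of _ R] conjI ballI allI)
    fix f g :: "real^'a \<Rightarrow> complex" and \<alpha> \<beta> assume f: "f \<in> L2" and g: "g \<in> L2"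
    note fg = L2_lincomb[OF f g, of \<alpha> \<beta>]
    show "AE x in lebesgue. R (\<lambda>y. \<alpha> * f y + \<beta> * g y) x = \<alpha> * R f x + \<beta> * R g x"
    proof (rule inj[OF R(1)[OF fg] L2_lincomb[OF R(1)[OF f] R(1)[OF g]]])
      show "AE x in lebesgue. T (R (\<lambda>y. \<alpha> * f y + \<beta> * g y)) x - z * R (\<lambda>y. \<alpha> * f y + \<beta> * g y) x =
        T (\<lambda>x. \<alpha> * R f x + \<beta> * R g x) x - z * (\<alpha> * R f x + \<beta> * R g x)"
        using R(2)[OF fg] R(2)[OF f] R(2)[OF g] bounded_op_lin[OF T R(1)[OF f] R(1)[OF g], of \<alpha> \<beta>]
      proof eventually_elim
        case (elim x)
        have "T (\<lambda>x. \<alpha> * R f x + \<beta> * R g x) x - z * (\<alpha> * R f x + \<beta> * R g x) =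
          \<alpha> * (T (R f) x - z * R f x) + \<beta> * (T (R g) x - z * R g x)"
          unfolding elim(4) by (simp add: algebra_simps)
        then show ?case unfolding elim(1-3) by simp
      qed
    qed
  next
    show "\<exists>K. \<forall>f\<in>L2. L2_norm (R f) \<le> K * L2_norm f"
    proof (intro exI[of _ K] ballI)
      fix f :: "real^'a \<Rightarrow> complex" assume f: "f \<in> L2"
      have "AE x in lebesgue. f x = T (R f) x - z * R f x" using R(2)[OF f] by (simp add: eq_commute)
      from L2_norm_cong_AE[OF f this] K(2)[OF R(1)[OF f]] show "L2_norm (R f) \<le> K * L2_norm f" by simp
    qed
  next
    fix f :: "real^'a \<Rightarrow> complex" assume f: "f \<in> L2"
    then have Tf: "(\<lambda>x. T f x - z * f x) \<in> L2" by (intro L2_diff L2_cmult bounded_op_L2[OF T])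
    show "AE x in lebesgue. R (\<lambda>y. T f y - z * f y) x = f x"
      by (rule inj[OF R(1)[OF Tf] f R(2)[OF Tf]])
  qed (use R in auto)
qed

text \<open>
  This is the completeness of the space of square-integrable functions, for series with geometric
  decay. By the Cauchy-Schwarz inequality the square of $\sum_n |g_n|$ is at most twice
  $W = \sum_n 2^n |g_n|^2$, which is integrable. So the series converges almost everywhere, and $2W$
  dominates the squares of all its remainders.
\<close>

lemma L2_geometric_series:
  assumes g: "\<And>n. g n \<in> L2" and le: "\<And>n. L2_norm (g n) \<le> c * (1/2) ^ n"
  obtains G where "G \<in> L2" "(\<lambda>n. L2_norm (\<lambda>x. G x - (\<Sum>j<n. g j x))) \<longlonglongrightarrow> 0"
proof -
  note [measurable] = L2_measurable[OF g]
  define W where "W x = (\<Sum>n. ennreal (2 ^ n * (cmod (g n x))\<^sup>2))" for x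
  have [measurable]: "W \<in> borel_measurable lebesgue" unfolding W_def[abs_def] by measurable
  have "(\<integral>\<^sup>+x. W x \<partial>lebesgue) = (\<Sum>n. \<integral>\<^sup>+x. ennreal (2 ^ n * (cmod (g n x))\<^sup>2) \<partial>lebesgue)"
    unfolding W_def by (rule nn_integral_suminf) measurable
  also have "\<dots> = (\<Sum>n. ennreal (2 ^ n * (L2_norm (g n))\<^sup>2))"
    using L2_integrable[OF g] by (subst nn_integral_eq_integral) (auto simp: L2_norm_square)
  also have "\<dots> \<le> (\<Sum>n. ennreal (c\<^sup>2 * (1/2) ^ n))"
  proof (intro suminf_le ennreal_leI)
    fix n
    have "(L2_norm (g n))\<^sup>2 \<le> (c * (1/2) ^ n)\<^sup>2" by (intro power_mono le L2_norm_nonneg)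
    then have "2 ^ n * (L2_norm (g n))\<^sup>2 \<le> 2 ^ n * (c * (1/2) ^ n)\<^sup>2" by simp
    also have "\<dots> = c\<^sup>2 * (1/2) ^ n"
      by (simp add: power_mult_distrib power_divide power2_eq_square field_simps)
    finally show "2 ^ n * (L2_norm (g n))\<^sup>2 \<le> c\<^sup>2 * (1/2) ^ n" .
  qed auto
  also have "\<dots> < top"
    unfolding less_top[symmetric] by (rule ennreal_suminf_neq_top) (auto intro!: summable_mult summable_geometric)
  finally have W_fin: "(\<integral>\<^sup>+x. W x \<partial>lebesgue) < top" .
  then have "AE x in lebesgue. W x \<noteq> \<infinity>"
    by (intro nn_integral_PInf_AE) auto
  then have AE: "AE x in lebesgue. summable (\<lambda>n. 2 ^ n * (cmod (g n x))\<^sup>2)"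
    unfolding W_def by eventually_elim (auto intro: summable_suminf_not_top)
  define w where "w x = enn2real (W x)" for x
  have w: "integrable lebesgue w"
    unfolding w_def[abs_def]
  proof (rule integrableI_bounded)
    have "(\<integral>\<^sup>+x. ennreal (norm (enn2real (W x))) \<partial>lebesgue) \<le> (\<integral>\<^sup>+x. W x \<partial>lebesgue)"
      by (intro nn_integral_mono) (simp add: ennreal_enn2real_if)
    then show "(\<integral>\<^sup>+x. ennreal (norm (enn2real (W x))) \<partial>lebesgue) < \<infinity>" using W_fin by simp
  qed measurable
  define G where "G x = (\<Sum>n. g n x)" for x
  have [measurable]: "G \<in> borel_measurable lebesgue" unfolding G_def[abs_def] by measurable
  define r where "r n x = G x - (\<Sum>j<n. g j x)" for n x
  have [measurable]: "r n \<in> borel_measurable lebesgue" for n unfolding r_def[abs_def] by measurable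
  have pt: "(\<lambda>n. r n x) \<longlonglongrightarrow> 0 \<and> (\<forall>n. (cmod (r n x))\<^sup>2 \<le> 2 * w x)"
    if s: "summable (\<lambda>n. 2 ^ n * (cmod (g n x))\<^sup>2)" for x
  proof -
    have wx: "w x = (\<Sum>n. 2 ^ n * (cmod (g n x))\<^sup>2)"
    proof -
      have "(\<Sum>n. ennreal (2 ^ n * (cmod (g n x))\<^sup>2)) = ennreal (\<Sum>n. 2 ^ n * (cmod (g n x))\<^sup>2)"
        using s by (intro suminf_ennreal2) auto
      moreover have "(\<Sum>n. 2 ^ n * (cmod (g n x))\<^sup>2) \<ge> 0" using s by (intro suminf_nonneg) auto
      ultimately show ?thesis unfolding w_def W_def by simp
    qed
    have fin: "(\<Sum>j\<in>J. cmod (g j x)) \<le> sqrt (2 * w x)" if J: "finite J" for J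
    proof -
      have "(\<Sum>j\<in>J. cmod (g j x))\<^sup>2 = (\<Sum>j\<in>J. sqrt ((1/2) ^ j) * (sqrt (2 ^ j) * cmod (g j x)))\<^sup>2"
        by (simp add: power_divide flip: real_sqrt_mult mult.assoc)
      also have "\<dots> \<le> (\<Sum>j\<in>J. (sqrt ((1/2) ^ j))\<^sup>2) * (\<Sum>j\<in>J. (sqrt (2 ^ j) * cmod (g j x))\<^sup>2)"
        by (rule Cauchy_Schwarz_ineq_sum)
      also have "\<dots> = (\<Sum>j\<in>J. (1/2) ^ j) * (\<Sum>j\<in>J. 2 ^ j * (cmod (g j x))\<^sup>2)"
        by (simp add: power_mult_distrib)
      also have "\<dots> \<le> (\<Sum>j. (1/2::real) ^ j) * w x"
        unfolding wx using J s by (intro mult_mono sum_le_suminf summable_geometric sum_nonneg suminf_nonneg) auto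
      also have "(\<Sum>j. (1/2::real) ^ j) = 2" by (subst suminf_geometric) auto
      finally show ?thesis by (simp add: real_le_rsqrt)
    qed
    have sg: "summable (\<lambda>n. cmod (g n x))"
      by (rule summableI_nonneg_bounded[of _ "sqrt (2 * w x)"]) (auto intro: fin)
    have lim: "(\<lambda>n. r n x) \<longlonglongrightarrow> G x - G x"
      unfolding r_def G_def by (intro tendsto_diff tendsto_const summable_LIMSEQ summable_norm_cancel[OF sg])
    have "cmod (r n x) \<le> sqrt (2 * w x)" for n
    proof -
      have "r n x = (\<Sum>j. g (j + n) x)"
        unfolding r_def G_def using suminf_minus_initial_segment[OF summable_norm_cancel[OF sg], of n] by simp
      also have "cmod \<dots> \<le> (\<Sum>j. cmod (g (j + n) x))"
        by (rule summable_norm) (use sg in \<open>simp add: summable_iff_shift[of "\<lambda>n. cmod (g n x)"]\<close>)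
      also have "\<dots> \<le> sqrt (2 * w x)"
      proof (rule suminf_le_const)
        show "summable (\<lambda>j. cmod (g (j + n) x))" using sg by (simp add: summable_iff_shift[of "\<lambda>n. cmod (g n x)"])
        fix m
        have "(\<Sum>j<m. cmod (g (j + n) x)) = (\<Sum>j\<in>(\<lambda>j. j + n) ` {..<m}. cmod (g j x))"
          by (subst sum.reindex) (auto simp: inj_on_def)
        then show "(\<Sum>j<m. cmod (g (j + n) x)) \<le> sqrt (2 * w x)" using fin[of "(\<lambda>j. j + n) ` {..<m}"] by simp
      qed
      finally show ?thesis .
    qed
    then have "(cmod (r n x))\<^sup>2 \<le> (sqrt (2 * w x))\<^sup>2" for n by (intro power_mono) auto
    moreover have "w x \<ge> 0" by (simp add: w_def)
    ultimately show ?thesis using lim by simp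
  qed
  have w2: "integrable lebesgue (\<lambda>x. 2 * w x)" using w by simp
  have ri: "integrable lebesgue (\<lambda>x. (cmod (r n x))\<^sup>2)" for n
    by (rule Bochner_Integration.integrable_bound[OF w2], measurable)
       (use AE in \<open>eventually_elim, use pt in \<open>force intro: order_trans[OF _ abs_ge_self]\<close>\<close>)
  have "(\<lambda>n. \<integral>x. (cmod (r n x))\<^sup>2 \<partial>lebesgue) \<longlonglongrightarrow> (\<integral>x. 0 \<partial>(lebesgue :: (real^'a) measure))"
  proof (rule integral_dominated_convergence[OF _ _ w2])
    show "AE x in lebesgue. (\<lambda>n. (cmod (r n x))\<^sup>2) \<longlonglongrightarrow> 0"
      using AE by eventually_elim (use pt in \<open>auto intro!: tendsto_eq_intros\<close>)
    show "AE x in lebesgue. norm ((cmod (r n x))\<^sup>2) \<le> 2 * w x" for n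
      using AE by eventually_elim (use pt in auto)
  qed measurable
  then have "(\<lambda>n. L2_norm (r n)) \<longlonglongrightarrow> sqrt (\<integral>x. 0 \<partial>(lebesgue :: (real^'a) measure))"
    unfolding L2_norm_def by (rule tendsto_real_sqrt)
  moreover have "G \<in> L2" using ri[of 0] by (simp add: L2_def r_def)
  ultimately show thesis by (intro that[of G]) (simp_all add: r_def[abs_def])
qed

text \<open>
  The constant \<open>K\<close> bounds the norm of the resolvent at \<open>z\<close>. It is a parameter since it determines how
  large a perturbation is admissible.
\<close>

definition bounded_below_onto :: "real \<Rightarrow> complex \<Rightarrow> ((real ^ 'd \<Rightarrow> complex) \<Rightarrow> (real ^ 'd \<Rightarrow> complex)) \<Rightarrow> bool" where
  "bounded_below_onto K z T \<longleftrightarrow>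
    (\<forall>h\<in>L2. L2_norm h \<le> K * L2_norm (\<lambda>x. T h x - z * h x)) \<and>
    (\<forall>f\<in>L2. \<exists>h\<in>L2. AE x in lebesgue. T h x - z * h x = f x)"

lemma bounded_below_ontoD:
  assumes "bounded_below_onto K z T"
  shows "h \<in> L2 \<Longrightarrow> L2_norm h \<le> K * L2_norm (\<lambda>x. T h x - z * h x)"
    and "f \<in> L2 \<Longrightarrow> \<exists>h\<in>L2. AE x in lebesgue. T h x - z * h x = f x"
  using assms by (auto simp: bounded_below_onto_def)

lemma resolvent_set_iff_bounded_below_onto:
  "bounded_operator_L2 T \<Longrightarrow> z \<in> resolvent_set_L2 T \<longleftrightarrow> (\<exists>K>0. bounded_below_onto K z T)"
  by (auto simp: resolvent_set_iff bounded_below_onto_def)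

text \<open>
  Let \<open>E = S - T\<close> and let \<open>R\<close> be a right inverse of \<open>T - z\<close>, so that \<open>E R\<close> has norm at most \<open>1 / 2\<close>.
  The equation \<open>(S - z) h = f\<close> is solved by \<open>h = R G\<close> where \<open>G + E R G = f\<close>, and \<open>G\<close> is the Neumann
  series $\sum_n (-ER)^n f$.
\<close>

lemma bounded_below_onto_perturb:
  fixes T S :: "(real ^ 'd \<Rightarrow> complex) \<Rightarrow> (real ^ 'd \<Rightarrow> complex)"
  assumes T: "bounded_operator_L2 T" and S: "bounded_operator_L2 S" and K: "K > 0"
    and bT: "bounded_below_onto K z T"
    and close: "\<And>f. f \<in> L2 \<Longrightarrow> L2_norm (\<lambda>x. S f x - T f x) \<le> 1 / (2 * K) * L2_norm f"
  shows "bounded_below_onto (2 * K) z S"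
proof -
  have low: "L2_norm h \<le> K * L2_norm (\<lambda>x. T h x - z * h x)" if "h \<in> L2" for h
    using bT that by (auto simp: bounded_below_onto_def)
  have DT: "(\<lambda>x. T h x - z * h x) \<in> L2" and DS: "(\<lambda>x. S h x - z * h x) \<in> L2"
    and DE: "(\<lambda>x. S h x - T h x) \<in> L2" if "h \<in> L2" for h
    using that by (auto intro!: L2_diff L2_cmult bounded_op_L2[OF T] bounded_op_L2[OF S])
  have lowS: "L2_norm h \<le> 2 * K * L2_norm (\<lambda>x. S h x - z * h x)" if h: "h \<in> L2" for h
  proof -
    have "L2_norm (\<lambda>x. T h x - z * h x) = L2_norm (\<lambda>x. (S h x - z * h x) - (S h x - T h x))" by simp
    also have "\<dots> \<le> L2_norm (\<lambda>x. S h x - z * h x) + L2_norm (\<lambda>x. S h x - T h x)"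
      by (rule L2_norm_triangle_diff[OF DS[OF h] DE[OF h]])
    also have "\<dots> \<le> L2_norm (\<lambda>x. S h x - z * h x) + 1 / (2 * K) * L2_norm h"
      using close[OF h] by simp
    finally have "K * L2_norm (\<lambda>x. T h x - z * h x) \<le> K * (L2_norm (\<lambda>x. S h x - z * h x) + 1 / (2 * K) * L2_norm h)"
      using K by simp
    then have "L2_norm h \<le> K * (L2_norm (\<lambda>x. S h x - z * h x) + 1 / (2 * K) * L2_norm h)"
      using low[OF h] by simp
    also have "\<dots> = K * L2_norm (\<lambda>x. S h x - z * h x) + L2_norm h / 2"
      using K by (simp add: field_simps)
    finally show ?thesis by simp
  qed
  from bT obtain R where R: "\<And>f. f \<in> L2 \<Longrightarrow> R f \<in> L2"
    "\<And>f. f \<in> L2 \<Longrightarrow> AE x in lebesgue. T (R f) x - z * R f x = f x"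
    unfolding bounded_below_onto_def by metis
  have RK: "L2_norm (R f) \<le> K * L2_norm f" if f: "f \<in> L2" for f
    using low[OF R(1)[OF f]] L2_norm_cong_AE[OF DT[OF R(1)[OF f]] R(2)[OF f]] by simp
  have onto: "\<exists>h\<in>L2. AE x in lebesgue. S h x - z * h x = f x" if f: "f \<in> L2" for f
  proof -
    define E where "E h = (\<lambda>x. S h x - T h x)" for h
    have E_L2: "E h \<in> L2" if "h \<in> L2" for h unfolding E_def by (rule DE[OF that])
    \<comment> \<open>the terms $(-ER)^n f$ of the Neumann series\<close>
    define g where "g = rec_nat f (\<lambda>_ u x. - E (R u) x)"
    have g0: "g 0 = f" and gSuc: "g (Suc n) = (\<lambda>x. - E (R (g n)) x)" for n by (simp_all add: g_def)
    have g: "g n \<in> L2" for n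
    proof (induction n)
      case (Suc n)
      show ?case unfolding gSuc using L2_cmult[OF E_L2[OF R(1)[OF Suc]], of "-1"] by simp
    qed (simp add: g0 f)
    have ER: "L2_norm (E (R u)) \<le> L2_norm u / 2" if u: "u \<in> L2" for u
    proof -
      have "L2_norm (E (R u)) \<le> 1 / (2 * K) * L2_norm (R u)" unfolding E_def by (rule close[OF R(1)[OF u]])
      also have "\<dots> \<le> 1 / (2 * K) * (K * L2_norm u)" using RK[OF u] K by (intro mult_left_mono) auto
      also have "\<dots> = L2_norm u / 2" using K by simp
      finally show ?thesis .
    qed
    have gle: "L2_norm (g n) \<le> L2_norm f * (1/2) ^ n" for n
    proof (induction n)
      case (Suc n)
      have "L2_norm (g (Suc n)) = L2_norm (E (R (g n)))"
        unfolding gSuc using L2_norm_cmult[of "-1" "E (R (g n))"] by simp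
      then show ?case using ER[OF g[of n]] Suc by simp
    qed (simp add: g0)
    obtain G where G: "G \<in> L2" "(\<lambda>n. L2_norm (\<lambda>x. G x - (\<Sum>j<n. g j x))) \<longlonglongrightarrow> 0"
      by (rule L2_geometric_series[OF g gle])
    define P where "P n x = (\<Sum>j<n. g j x)" for n x
    have P: "P n \<in> L2" for n unfolding P_def[abs_def] by (intro L2_sum g)
    \<comment> \<open>\<open>R\<close> is additive up to null sets, because \<open>T - z\<close> is injective up to null sets\<close>
    have R_add: "AE x in lebesgue. R (\<lambda>y. u y - v y) x = R u x - R v x" if u: "u \<in> L2" and v: "v \<in> L2" for u v
    proof -
      define d where "d = (\<lambda>x. R (\<lambda>y. u y - v y) x - (R u x - R v x))"
      have d: "d \<in> L2" unfolding d_def by (intro L2_diff R u v)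
      have "AE x in lebesgue. T d x - z * d x = 0"
        using R(2)[OF L2_diff[OF u v]] R(2)[OF u] R(2)[OF v]
          bounded_op_diff[OF T R(1)[OF L2_diff[OF u v]] L2_diff[OF R(1)[OF u] R(1)[OF v]]]
          bounded_op_diff[OF T R(1)[OF u] R(1)[OF v]]
      proof eventually_elim
        case (elim x)
        show ?case unfolding d_def elim(4) elim(5) using elim(1-3) by (simp add: algebra_simps)
      qed
      then have "L2_norm (\<lambda>x. T d x - z * d x) = 0" by (rule L2_norm_0_AE)
      with low[OF d] have "AE x in lebesgue. d x = 0" by (intro L2_norm_eq_0 d) simp
      then show ?thesis by eventually_elim (simp add: d_def)
    qed
    have ER_diff: "AE x in lebesgue. E (R (\<lambda>y. u y - v y)) x = E (R u) x - E (R v) x"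
      if u: "u \<in> L2" and v: "v \<in> L2" for u v
      using bounded_op_cong[OF T R(1)[OF L2_diff[OF u v]] R_add[OF u v]]
        bounded_op_cong[OF S R(1)[OF L2_diff[OF u v]] R_add[OF u v]]
        bounded_op_diff[OF T R(1)[OF u] R(1)[OF v]] bounded_op_diff[OF S R(1)[OF u] R(1)[OF v]]
      unfolding E_def by eventually_elim simp
    have ERP: "AE x in lebesgue. E (R (P n)) x = f x - P (Suc n) x" for n
    proof (induction n)
      case 0
      have "L2_norm (E (R (P 0))) \<le> L2_norm (P 0) / 2" by (rule ER[OF P])
      also have "L2_norm (P 0) = 0" by (simp add: P_def[abs_def] L2_norm_def)
      finally have "AE x in lebesgue. E (R (P 0)) x = 0" by (intro L2_norm_eq_0 E_L2 R P) simp
      moreover have "P (Suc 0) x = f x" for x by (simp add: P_def g0)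
      ultimately show ?case by simp
    next
      case (Suc n)
      have e: "P n = (\<lambda>y. P (Suc n) y - g n y)" by (simp add: P_def fun_eq_iff)
      show ?case
        using Suc ER_diff[OF P[of "Suc n"] g[of n], folded e]
      proof eventually_elim
        case (elim x)
        have "P (Suc (Suc n)) x = P (Suc n) x - E (R (g n)) x"
          unfolding P_def by (subst sum.lessThan_Suc) (simp add: gSuc)
        moreover have "E (R (P (Suc n))) x = (f x - P (Suc n) x) + E (R (g n)) x"
          using elim(2) unfolding elim(1)[symmetric] by simp
        ultimately show ?case by (simp only: diff_diff_eq2 diff_add_eq)
      qed
    qed
    define h where "h = R G"
    have h: "h \<in> L2" unfolding h_def by (rule R(1)[OF G(1)])
    define D where "D x = (G x + E (R G) x) - f x" for x
    have D: "D \<in> L2" unfolding D_def[abs_def] by (intro L2_diff L2_add G E_L2 R f)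
    have Dn: "L2_norm D \<le> L2_norm (\<lambda>x. G x - P (Suc n) x) + L2_norm (\<lambda>x. G x - P n x) / 2" for n
    proof -
      have "AE x in lebesgue. D x = (G x - P (Suc n) x) + E (R (\<lambda>y. G y - P n y)) x"
        using ERP[of n] ER_diff[OF G(1) P[of n]] by eventually_elim (simp add: D_def)
      then have "L2_norm D = L2_norm (\<lambda>x. (G x - P (Suc n) x) + E (R (\<lambda>y. G y - P n y)) x)"
        by (rule L2_norm_cong_AE[OF D])
      also have "\<dots> \<le> L2_norm (\<lambda>x. G x - P (Suc n) x) + L2_norm (E (R (\<lambda>y. G y - P n y)))"
        by (intro L2_norm_triangle L2_diff E_L2 R G P)
      also have "\<dots> \<le> L2_norm (\<lambda>x. G x - P (Suc n) x) + L2_norm (\<lambda>x. G x - P n x) / 2"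
        using ER[OF L2_diff[OF G(1) P[of n]]] by simp
      finally show ?thesis .
    qed
    have lim: "(\<lambda>n. L2_norm (\<lambda>x. G x - P n x)) \<longlonglongrightarrow> 0" using G(2) by (simp add: P_def[abs_def])
    have "(\<lambda>n. L2_norm (\<lambda>x. G x - P (Suc n) x) + L2_norm (\<lambda>x. G x - P n x) / 2) \<longlonglongrightarrow> 0 + 0 / 2"
      by (intro tendsto_add tendsto_divide tendsto_const lim LIMSEQ_Suc[OF lim]) simp
    then have "L2_norm D \<le> 0" using Dn by (intro LIMSEQ_le_const) auto
    then have "AE x in lebesgue. D x = 0" by (rule L2_norm_eq_0[OF D])
    then have "AE x in lebesgue. S h x - z * h x = f x"
      using R(2)[OF G(1)] by eventually_elim (simp add: D_def h_def E_def algebra_simps)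
    with h show ?thesis by blast
  qed
  show ?thesis unfolding bounded_below_onto_def using lowS onto by blast
qed

text \<open>
  Multiplication by the unimodular function \<open>m\<close> preserves norms and intertwines \<open>S\<close> with \<open>T\<close>.
\<close>

lemma bounded_below_onto_conj:
  fixes T S :: "(real ^ 'd \<Rightarrow> complex) \<Rightarrow> (real ^ 'd \<Rightarrow> complex)"
  assumes T: "bounded_operator_L2 T" and S: "bounded_operator_L2 S"
    and m[measurable]: "m \<in> borel_measurable lebesgue" and m1: "\<And>x. cmod (m x) = 1"
    and ST: "\<And>f. f \<in> L2 \<Longrightarrow> AE x in lebesgue. T (\<lambda>y. m y * f y) x = m x * S f x"
    and bS: "bounded_below_onto K z S"
  shows "bounded_below_onto K z T"
proof -
  have mnz: "m x \<noteq> 0" for x using m1[of x] by auto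
  have isom: "(\<lambda>x. n x * f x) \<in> L2" "L2_norm (\<lambda>x. n x * f x) = L2_norm f"
    if n[measurable]: "n \<in> borel_measurable lebesgue" and n1: "\<And>x. cmod (n x) = 1" and f: "f \<in> L2" for n and f :: "real ^ 'd \<Rightarrow> complex"
    using L2_integrable[OF f] L2_measurable[OF f]
    by (auto simp: L2_def L2_norm_def norm_mult n1)
  define m' where "m' x = inverse (m x)" for x
  have m'm: "m'  \<in> borel_measurable lebesgue" unfolding m'_def[abs_def] by measurable
  have m'1: "cmod (m' x) = 1" for x by (simp add: m'_def norm_inverse m1)
  have key: "AE x in lebesgue. T h x - z * h x = m x * (S (\<lambda>y. m' y * h y) x - z * (m' x * h x))" if h: "h \<in> L2" for h
  proof -
    have "(\<lambda>y. m y * (m' y * h y)) = h" by (rule ext) (simp add: m'_def mnz)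
    with ST[OF isom(1)[OF m'm m'1 h]] have "AE x in lebesgue. T h x = m x * S (\<lambda>y. m' y * h y) x" by simp
    then show ?thesis by eventually_elim (simp add: right_diff_distrib m'_def mnz)
  qed
  have DT: "(\<lambda>x. T h x - z * h x) \<in> L2" if "h \<in> L2" for h
    using that by (auto intro!: L2_diff L2_cmult bounded_op_L2[OF T])
  have DS: "(\<lambda>x. S h x - z * h x) \<in> L2" if "h \<in> L2" for h
    using that by (auto intro!: L2_diff L2_cmult bounded_op_L2[OF S])
  show ?thesis
    unfolding bounded_below_onto_def
  proof (intro conjI ballI)
    fix h :: "real ^ 'd \<Rightarrow> complex" assume h: "h \<in> L2"
    note h' = isom[OF m'm m'1 h]
    have "L2_norm h \<le> K * L2_norm (\<lambda>x. S (\<lambda>y. m' y * h y) x - z * (m' x * h x))"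
      using bS h' by (auto simp: bounded_below_onto_def)
    also have "L2_norm (\<lambda>x. S (\<lambda>y. m' y * h y) x - z * (m' x * h x)) = L2_norm (\<lambda>x. T h x - z * h x)"
      using L2_norm_cong_AE[OF DT[OF h] key[OF h]] isom(2)[OF m m1 DS[OF h'(1)]] by simp
    finally show "L2_norm h \<le> K * L2_norm (\<lambda>x. T h x - z * h x)" .
  next
    fix f :: "real ^ 'd \<Rightarrow> complex" assume f: "f \<in> L2"
    from bounded_below_ontoD(2)[OF bS isom(1)[OF m'm m'1 f]]
    obtain h where h: "h \<in> L2" "AE x in lebesgue. S h x - z * h x = m' x * f x" ..
    have "AE x in lebesgue. T (\<lambda>y. m y * h y) x - z * (m x * h x) = f x"
      using ST[OF h(1)] h(2)
    proof eventually_elim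
      case (elim x)
      have "T (\<lambda>y. m y * h y) x - z * (m x * h x) = m x * (S h x - z * h x)"
        unfolding elim(1) by (simp add: algebra_simps)
      then show ?case unfolding elim(2) by (simp add: m'_def mnz)
    qed
    then show "\<exists>h\<in>L2. AE x in lebesgue. T h x - z * h x = f x"
      using isom(1)[OF m m1 h(1)] by (intro bexI[of _ "\<lambda>y. m y * h y"]) auto
  qed
qed

lemma bounded_below_onto_rotate:
  fixes T :: "(real ^ 'd \<Rightarrow> complex) \<Rightarrow> (real ^ 'd \<Rightarrow> complex)"
  assumes T: "bounded_operator_L2 T" and \<zeta>: "cmod \<zeta> = 1" and b: "bounded_below_onto K z T"
  shows "bounded_below_onto K (\<zeta> * z) (\<lambda>f x. \<zeta> * T f x)"
proof -
  have e: "\<zeta> * T h x - \<zeta> * z * h x = \<zeta> * (T h x - z * h x)" for h x by (simp add: algebra_simps)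
  have nz: "\<zeta> \<noteq> 0" using \<zeta> by auto
  show ?thesis
    unfolding bounded_below_onto_def e L2_norm_cmult \<zeta>
  proof (intro conjI ballI)
    fix h :: "real ^ 'd \<Rightarrow> complex" assume "h \<in> L2"
    then show "L2_norm h \<le> K * (1 * L2_norm (\<lambda>x. T h x - z * h x))"
      using b by (simp add: bounded_below_onto_def)
  next
    fix f :: "real ^ 'd \<Rightarrow> complex" assume "f \<in> L2"
    from bounded_below_ontoD(2)[OF b L2_cmult[OF this, of "inverse \<zeta>"]]
    obtain h where h: "h \<in> L2" "AE x in lebesgue. T h x - z * h x = inverse \<zeta> * f x" ..
    from h(2) have "AE x in lebesgue. \<zeta> * (T h x - z * h x) = f x"
      by eventually_elim (simp add: nz)
    with h(1) show "\<exists>h\<in>L2. AE x in lebesgue. \<zeta> * (T h x - z * h x) = f x" by blast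
  qed
qed

section \<open>Hausdorff operators of commuting families\<close>

lemma borel_representative:
  fixes f :: "'a::euclidean_space \<Rightarrow> complex"
  assumes f: "f \<in> borel_measurable lebesgue"
  obtains g where "g \<in> borel_measurable borel" "AE x in lebesgue. f x = g x"
proof -
  have "(\<lambda>x. Re (f x)) \<in> borel_measurable lebesgue" "(\<lambda>x. Im (f x)) \<in> borel_measurable lebesgue"
    using f by auto
  then obtain u v where uv: "u \<in> borel_measurable lborel" "AE x in lborel. Re (f x) = u x"
    "v \<in> borel_measurable lborel" "AE x in lborel. Im (f x) = v x"
    using completion_ex_borel_measurable_real by metis
  have [measurable]: "u \<in> borel_measurable borel" "v \<in> borel_measurable borel" using uv by simp_all
  have "AE x in lborel. f x = Complex (u x) (v x)"
    using uv(2,4) by eventually_elim (simp add: complex_eq_iff)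
  moreover have "(\<lambda>x. Complex (u x) (v x)) \<in> borel_measurable borel"
    unfolding Complex_eq by measurable
  ultimately show thesis by (intro that AE_completion) auto
qed

lemma L2_borel_iff:
  fixes f :: "real^'d \<Rightarrow> complex"
  assumes f: "f \<in> borel_measurable borel"
  shows "f \<in> L2 \<longleftrightarrow> sq_integrable f"
    and "L2_norm f = sqrt (\<integral>x. (cmod (f x))\<^sup>2 \<partial>lborel)"
proof -
  have [measurable]: "(\<lambda>x. (cmod (f x))\<^sup>2) \<in> borel_measurable lborel" using f by simp
  show "f \<in> L2 \<longleftrightarrow> sq_integrable f"
    using f by (simp add: L2_def sq_integrable_def integrable_completion measurable_completion)
  show "L2_norm f = sqrt (\<integral>x. (cmod (f x))\<^sup>2 \<partial>lborel)"
    by (simp add: L2_norm_def integral_completion)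
qed

lemma AE_compose:
  assumes [measurable]: "T \<in> borel_measurable borel" and N: "\<And>N. N \<in> null_sets lborel \<Longrightarrow> (\<integral>\<^sup>+x. indicator N (T x) \<partial>lborel) = 0"
    and P: "AE x in lborel. P x"
  shows "AE x in (lborel :: 'a::euclidean_space measure). P (T x :: 'b::euclidean_space)"
proof -
  obtain N where N': "\<And>x. x \<in> space lborel - N \<Longrightarrow> P x" "N \<in> null_sets lborel"
    using P by (rule AE_E3) blast
  then have [measurable]: "N \<in> sets borel" by auto
  have "AE x in lborel. indicator N (T x) = (0::ennreal)"
    using N[OF N'(2)] by (subst (asm) nn_integral_0_iff_AE) auto
  then show ?thesis by eventually_elim (use N'(1) in \<open>auto simp: indicator_def split: if_splits\<close>)
qed

text \<open>
  Commutation and symmetry of the matrices enter through the common orthogonal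
  diagonalization.
\<close>

locale commuting_family =
  fixes A :: "int \<Rightarrow> real^'d^'d" and C :: "real^'d^'d" and a :: "int \<Rightarrow> real^'d"
  assumes inv: "\<And>k. invertible (A k)" and eig: "eigenvalue_family A C a"
begin

lemma orth: "orthogonal_matrix C" using eig by (simp add: eigenvalue_family_def)

lemma orthT: "orthogonal_matrix (transpose C)" using orth by simp

lemma CTC: "transpose C ** C = mat 1" and CCT: "C ** transpose C = mat 1"
  using orth by (simp_all add: orthogonal_matrix_def)

lemma A_eq: "A k = C ** diagonal_matrix (a k) ** transpose C"
proof -
  have "matrix_inv C = transpose C"
  proof -
    have "C ** matrix_inv C = mat 1"
      unfolding matrix_inv_def using CCT CTC by (rule_tac someI2[where a="transpose C"]) auto
    then have "transpose C ** (C ** matrix_inv C) = transpose C" by simp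
    then show ?thesis by (simp add: matrix_mul_assoc CTC)
  qed
  then have "diagonal_matrix (a k) = transpose C ** A k ** C"
    using eig by (simp add: eigenvalue_family_def)
  then have "C ** diagonal_matrix (a k) ** transpose C = (C ** transpose C) ** A k ** (C ** transpose C)"
    by (simp add: matrix_mul_assoc)
  then show ?thesis by (simp add: CCT)
qed

lemma diagonal_matrix_mult: "diagonal_matrix v *v x = (\<chi> l. v $ l * x $ l)"
  by (simp add: diagonal_matrix_def matrix_vector_mult_def vec_eq_iff if_distribR if_distrib[of "\<lambda>x. x * _"] cong: if_cong)

lemma CTC_vec: "transpose C *v (C *v x) = x"
  by (simp only: matrix_vector_mul_assoc CTC matrix_vector_mul_lid)

lemma A_vec: "A k *v x = C *v (\<chi> l. a k $ l * (transpose C *v x) $ l)"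
  by (simp add: A_eq matrix_vector_mul_assoc[symmetric] diagonal_matrix_mult)

lemma det_A: "det (A k) = (\<Prod>l\<in>UNIV. a k $ l)"
proof -
  have "det (A k) = (det C * det C) * det (diagonal_matrix (a k))"
    by (simp add: A_eq det_mul det_transpose)
  also have "det C * det C = 1" using det_orthogonal_matrix[OF orth] by auto
  also have "det (diagonal_matrix (a k)) = (\<Prod>l\<in>UNIV. a k $ l)"
    by (subst det_diagonal) (auto simp: diagonal_matrix_def)
  finally show ?thesis by simp
qed

lemma det_nz: "det (A k) \<noteq> 0" using inv by (simp add: invertible_det_nz)

lemma a_nz: "a k $ l \<noteq> 0"
  using det_nz[of k] by (auto simp: det_A)

lemma A_measurable [measurable]: "(*v) (A k) \<in> borel_measurable borel"
  and C_measurable [measurable]: "(*v) (transpose C) \<in> borel_measurable borel"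
  by (intro borel_measurable_continuous_onI matrix_vector_mult_linear_continuous_on)+

lemma nn_integral_A:
  assumes [measurable]: "h \<in> borel_measurable borel"
  shows "(\<integral>\<^sup>+x. h x \<partial>lborel) = ennreal \<bar>det (A k)\<bar> * (\<integral>\<^sup>+x. h (A k *v x) \<partial>lborel)"
proof -
  have [measurable]: "(*v) C \<in> borel_measurable borel"
    by (intro borel_measurable_continuous_onI matrix_vector_mult_linear_continuous_on)
  have [measurable]: "(\<lambda>y. \<chi> l. a k $ l * y $ l) \<in> borel_measurable borel"
    by (intro borel_measurable_continuous_onI continuous_intros)
  have "(\<integral>\<^sup>+x. h x \<partial>lborel) = (\<integral>\<^sup>+y. h (C *v y) \<partial>lborel)"
    by (rule nn_integral_orthogonal_matrix[OF _ orth]) simp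
  also have "\<dots> = ennreal \<bar>det (A k)\<bar> * (\<integral>\<^sup>+y. h (C *v (\<chi> l. a k $ l * y $ l)) \<partial>lborel)"
    unfolding det_A by (rule nn_integral_diagonal) (auto simp: a_nz)
  also have "(\<integral>\<^sup>+y. h (C *v (\<chi> l. a k $ l * y $ l)) \<partial>lborel) = (\<integral>\<^sup>+x. h (A k *v x) \<partial>lborel)"
    unfolding A_vec by (rule nn_integral_orthogonal_matrix[OF _ orthT]) measurable
  finally show ?thesis .
qed

lemma AE_A:
  assumes "AE x in lebesgue. P x"
  shows "AE x in lebesgue. P (A k *v x)"
proof -
  have "AE x in lborel. P (A k *v x)"
  proof (rule AE_compose)
    fix N :: "(real^'d) set" assume N: "N \<in> null_sets lborel"
    then have [measurable]: "N \<in> sets borel" by auto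
    have "0 = ennreal \<bar>det (A k)\<bar> * (\<integral>\<^sup>+x. indicator N (A k *v x) \<partial>lborel)"
      using N by (subst nn_integral_A[symmetric]) auto
    then have "ennreal \<bar>det (A k)\<bar> * (\<integral>\<^sup>+x. indicator N (A k *v x) \<partial>lborel) = 0"
      by (rule sym)
    then have "ennreal \<bar>det (A k)\<bar> = 0 \<or> (\<integral>\<^sup>+x. indicator N (A k *v x) \<partial>lborel) = 0"
      by (simp only: mult_eq_0_iff)
    then show "(\<integral>\<^sup>+x. indicator N (A k *v x) \<partial>lborel) = 0"
      using det_nz[of k] by simp
  qed (use assms in \<open>simp_all add: AE_completion_iff\<close>)
  then show ?thesis by (rule AE_completion)
qed

definition N2 :: "(int \<Rightarrow> complex) \<Rightarrow> real" where
  "N2 c = (\<Sum>\<^sub>\<infinity>k. cmod (c k) * \<bar>det (A k)\<bar> powr (- 1 / 2))"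

definition N2_finite :: "(int \<Rightarrow> complex) \<Rightarrow> bool" where
  "N2_finite c \<longleftrightarrow> (\<lambda>k. cmod (c k) * \<bar>det (A k)\<bar> powr (- 1 / 2)) summable_on UNIV"

lemma powr_half: "\<bar>det (A k)\<bar> powr (- 1 / 2) = 1 / sqrt \<bar>det (A k)\<bar>"
proof -
  have "\<bar>det (A k)\<bar> powr (- (1 / 2)) = inverse (sqrt \<bar>det (A k)\<bar>)"
    by (simp only: powr_minus powr_half_sqrt abs_ge_zero)
  then show ?thesis by (simp add: inverse_eq_divide)
qed

lemma N2_nonneg: "N2 c \<ge> 0"
  unfolding N2_def by (intro infsum_nonneg) auto

text \<open>
  With $\omega_k = |c(k)|\,|\det A(k)|^{-1/2}$, the Cauchy-Schwarz inequality bounds the square of the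
  series by \<open>N2 c\<close> times $\sum_k \omega_k |\det A(k)|\,|g(A(k)x)|^2$, and the factor $|\det A(k)|$ cancels
  against the change of variables.
\<close>

lemma nn_integral_series:
  fixes g :: "real^'d \<Rightarrow> complex"
  assumes c: "N2_finite c" and [measurable]: "g \<in> borel_measurable borel"
  shows "(\<integral>\<^sup>+x. (\<Sum>n. ennreal (cmod (c (int_decode n) * g (A (int_decode n) *v x))))\<^sup>2 \<partial>lborel)
    \<le> ennreal ((N2 c)\<^sup>2) * (\<integral>\<^sup>+x. (cmod (g x))\<^sup>2 \<partial>lborel)"
proof -
  define d where "d n = \<bar>det (A (int_decode n))\<bar>" for n
  have d: "d n > 0" for n using det_nz by (simp add: d_def)
  define \<omega> where "\<omega> n = cmod (c (int_decode n)) / sqrt (d n)" for n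
  have \<omega>0: "\<omega> n \<ge> 0" for n using d[of n] by (simp add: \<omega>_def)
  have \<omega>_eq: "cmod (c (int_decode n)) * \<bar>det (A (int_decode n))\<bar> powr (- 1 / 2) = \<omega> n" for n
    by (simp only: powr_half \<omega>_def d_def times_divide_eq_right mult_1_right)
  have "(\<lambda>n. \<omega> n) summable_on UNIV"
    using c summable_on_reindex_bij_betw[OF bij_int_decode, of "\<lambda>k. cmod (c k) * \<bar>det (A k)\<bar> powr (- 1 / 2)"]
    unfolding N2_finite_def \<omega>_eq by simp
  then have \<omega>s: "summable \<omega>" and "\<omega> sums (infsum \<omega> UNIV)"
    by (auto intro: summable_on_imp_summable has_sum_imp_sums has_sum_infsum)
  moreover have "infsum \<omega> UNIV = N2 c"
    unfolding N2_def using infsum_reindex_bij_betw[OF bij_int_decode, of "\<lambda>k. cmod (c k) * \<bar>det (A k)\<bar> powr (- 1 / 2)"]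
    unfolding \<omega>_eq by simp
  ultimately have \<omega>N: "(\<Sum>n. ennreal (\<omega> n)) = ennreal (N2 c)"
    by (subst suminf_ennreal2[OF \<omega>0 \<omega>s]) (simp add: sums_unique[symmetric])
  define q where "q n x = (cmod (g (A (int_decode n) *v x)))\<^sup>2" for n x
  have [measurable]: "(\<lambda>x. q n x) \<in> borel_measurable borel" for n unfolding q_def by measurable
  have cs: "(\<Sum>n. ennreal (cmod (c (int_decode n) * g (A (int_decode n) *v x))))\<^sup>2
      \<le> ennreal (N2 c) * (\<Sum>n. ennreal (\<omega> n * d n) * ennreal (q n x))" for x
  proof -
    define u where "u n = ennreal (sqrt (\<omega> n))" for n
    define v where "v n = ennreal (sqrt (\<omega> n * d n) * cmod (g (A (int_decode n) *v x)))" for n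
    have uv: "ennreal (cmod (c (int_decode n) * g (A (int_decode n) *v x))) = u n * v n" for n
    proof -
      have "cmod (c (int_decode n)) = sqrt (\<omega> n) * sqrt (\<omega> n * d n)"
        using d[of n] \<omega>0[of n] by (simp add: \<omega>_def real_sqrt_mult[symmetric] real_sqrt_mult)
      then show ?thesis using \<omega>0[of n] d[of n] by (simp add: u_def v_def norm_mult mult.assoc flip: ennreal_mult)
    qed
    have u2: "(u n)\<^sup>2 = ennreal (\<omega> n)" and v2: "(v n)\<^sup>2 = ennreal (\<omega> n * d n) * ennreal (q n x)" for n
      using \<omega>0[of n] d[of n]
      by (simp_all add: u_def v_def q_def ennreal_power power_mult_distrib flip: ennreal_mult)
    have "(\<integral>\<^sup>+n. u n * v n \<partial>count_space UNIV)\<^sup>2 \<le> (\<integral>\<^sup>+n. (u n)\<^sup>2 \<partial>count_space UNIV) * (\<integral>\<^sup>+n. (v n)\<^sup>2 \<partial>count_space UNIV)"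
      by (rule Cauchy_Schwarz_nn_integral) auto
    then show ?thesis
      unfolding nn_integral_count_space_nat uv u2 v2 \<omega>N .
  qed
  have q_int: "ennreal (d n) * (\<integral>\<^sup>+x. ennreal (q n x) \<partial>lborel) = (\<integral>\<^sup>+x. (cmod (g x))\<^sup>2 \<partial>lborel)" for n
    unfolding d_def q_def by (rule nn_integral_A[symmetric]) measurable
  have "(\<integral>\<^sup>+x. (\<Sum>n. ennreal (cmod (c (int_decode n) * g (A (int_decode n) *v x))))\<^sup>2 \<partial>lborel)
    \<le> (\<integral>\<^sup>+x. ennreal (N2 c) * (\<Sum>n. ennreal (\<omega> n * d n) * ennreal (q n x)) \<partial>lborel)"
    by (intro nn_integral_mono cs)
  also have "\<dots> = ennreal (N2 c) * (\<Sum>n. ennreal (\<omega> n * d n) * (\<integral>\<^sup>+x. ennreal (q n x) \<partial>lborel))"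
    by (subst nn_integral_cmult, measurable) (subst nn_integral_suminf, measurable, simp add: nn_integral_cmult)
  also have "(\<Sum>n. ennreal (\<omega> n * d n) * (\<integral>\<^sup>+x. ennreal (q n x) \<partial>lborel)) = (\<Sum>n. ennreal (\<omega> n) * (\<integral>\<^sup>+x. (cmod (g x))\<^sup>2 \<partial>lborel))"
    using \<omega>0 d by (simp add: ennreal_mult less_imp_le mult.assoc q_int)
  also have "\<dots> = ennreal (N2 c) * (\<integral>\<^sup>+x. (cmod (g x))\<^sup>2 \<partial>lborel)"
    by (simp add: ennreal_suminf_multc \<omega>N)
  finally show ?thesis
    by (simp add: power2_eq_square ennreal_mult N2_nonneg mult.assoc)
qed

lemma hausdorff_borel [measurable (raw)]:
  fixes g :: "real^'d \<Rightarrow> complex"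
  assumes [measurable]: "g \<in> borel_measurable borel"
  shows "hausdorff_op c A g \<in> borel_measurable borel"
  unfolding hausdorff_op_def by measurable

lemma
  fixes g :: "real^'d \<Rightarrow> complex"
  assumes c: "N2_finite c" and g: "sq_integrable g"
  shows hausdorff_sq_integrable: "sq_integrable (hausdorff_op c A g)"
    and hausdorff_norm_le: "(\<integral>x. (cmod (hausdorff_op c A g x))\<^sup>2 \<partial>lborel) \<le> (N2 c)\<^sup>2 * (\<integral>x. (cmod (g x))\<^sup>2 \<partial>lborel)"
    and hausdorff_AE_summable: "AE x in lborel. (\<lambda>k. c k * g (A k *v x)) summable_on UNIV"
proof -
  have [measurable]: "g \<in> borel_measurable borel" using g by (simp add: sq_integrable_def)
  define S where "S x = (\<Sum>n. ennreal (cmod (c (int_decode n) * g (A (int_decode n) *v x))))" for x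
  have [measurable]: "S \<in> borel_measurable borel" unfolding S_def[abs_def] by measurable
  have le: "(\<integral>\<^sup>+x. (S x)\<^sup>2 \<partial>lborel) \<le> ennreal ((N2 c)\<^sup>2 * (\<integral>x. (cmod (g x))\<^sup>2 \<partial>lborel))"
  proof -
    have "(\<integral>\<^sup>+x. (S x)\<^sup>2 \<partial>lborel) \<le> ennreal ((N2 c)\<^sup>2) * (\<integral>\<^sup>+x. (cmod (g x))\<^sup>2 \<partial>lborel)"
      unfolding S_def by (rule nn_integral_series[OF c]) simp
    also have "\<dots> = ennreal ((N2 c)\<^sup>2 * (\<integral>x. (cmod (g x))\<^sup>2 \<partial>lborel))"
      using g by (subst nn_integral_eq_integral) (auto simp: sq_integrable_def ennreal_mult)
    finally show ?thesis .
  qed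
  have fin: "AE x in lborel. (S x)\<^sup>2 \<noteq> \<infinity>"
  proof (rule nn_integral_PInf_AE)
    show "(\<integral>\<^sup>+x. (S x)\<^sup>2 \<partial>lborel) \<noteq> \<infinity>" using le by (metis ennreal_neq_top infinity_ennreal_def top.extremum_uniqueI)
  qed measurable
  then show "AE x in lborel. (\<lambda>k. c k * g (A k *v x)) summable_on UNIV"
  proof eventually_elim
    case (elim x)
    then have "S x \<noteq> top" by (auto simp: power2_eq_square)
    then show ?case unfolding summable_on_int_iff S_def by (intro summable_suminf_not_top) auto
  qed
  have HS: "ennreal ((cmod (hausdorff_op c A g x))\<^sup>2) \<le> (S x)\<^sup>2" for x
  proof (cases "summable (\<lambda>n. norm (c (int_decode n) * g (A (int_decode n) *v x)))")
    case True
    then have "ennreal (cmod (hausdorff_op c A g x)) \<le> ennreal (\<Sum>n. norm (c (int_decode n) * g (A (int_decode n) *v x)))"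
      unfolding hausdorff_op_def infsum_int_eq by (auto intro!: ennreal_leI summable_norm)
    also have "\<dots> = S x" unfolding S_def by (rule suminf_ennreal2[symmetric, OF _ True]) simp
    finally show ?thesis by (simp add: power2_eq_square ennreal_mult mult_mono)
  next
    case False
    then show ?thesis by (simp add: hausdorff_op_def infsum_int_eq)
  qed
  have le2: "(\<integral>\<^sup>+x. (cmod (hausdorff_op c A g x))\<^sup>2 \<partial>lborel) \<le> ennreal ((N2 c)\<^sup>2 * (\<integral>x. (cmod (g x))\<^sup>2 \<partial>lborel))"
    by (rule order_trans[OF nn_integral_mono le]) (rule HS)
  then have i: "integrable lborel (\<lambda>x. (cmod (hausdorff_op c A g x))\<^sup>2)"
    by (intro integrableI_bounded) (auto intro: le_less_trans)
  then show "sq_integrable (hausdorff_op c A g)" by (simp add: sq_integrable_def hausdorff_borel)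
  have "ennreal (\<integral>x. (cmod (hausdorff_op c A g x))\<^sup>2 \<partial>lborel) \<le> ennreal ((N2 c)\<^sup>2 * (\<integral>x. (cmod (g x))\<^sup>2 \<partial>lborel))"
    using le2 by (subst (asm) nn_integral_eq_integral[OF i]) auto
  then show "(\<integral>x. (cmod (hausdorff_op c A g x))\<^sup>2 \<partial>lborel) \<le> (N2 c)\<^sup>2 * (\<integral>x. (cmod (g x))\<^sup>2 \<partial>lborel)"
    by (subst (asm) ennreal_le_iff) auto
qed

lemma hausdorff_cong_AE:
  assumes "AE x in lebesgue. f x = g x"
  shows "AE x in lebesgue. hausdorff_op c A f x = hausdorff_op c A g x"
proof -
  have "AE x in lebesgue. \<forall>k. f (A k *v x) = g (A k *v x)"
    unfolding AE_all_countable using AE_A[OF assms] by blast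
  then show ?thesis by eventually_elim (simp add: hausdorff_op_def)
qed

lemma
  assumes c: "N2_finite c" and f: "f \<in> L2"
  shows hausdorff_L2: "hausdorff_op c A f \<in> L2"
    and hausdorff_L2_norm: "L2_norm (hausdorff_op c A f) \<le> N2 c * L2_norm f"
    and hausdorff_summable: "AE x in lebesgue. (\<lambda>k. c k * f (A k *v x)) summable_on UNIV"
proof -
  obtain g where g[measurable]: "g \<in> borel_measurable borel" and fg: "AE x in lebesgue. f x = g x"
    using borel_representative[OF L2_measurable[OF f]] by blast
  have gs: "sq_integrable g" using L2_cong_AE[OF f fg] L2_borel_iff(1)[OF g] by simp
  have gf: "AE x in lebesgue. g x = f x" using fg by (simp add: eq_commute)
  note H = hausdorff_cong_AE[OF gf, of c]
  have Hg: "hausdorff_op c A g \<in> L2"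
    using hausdorff_sq_integrable[OF c gs] by (subst L2_borel_iff) measurable
  show "hausdorff_op c A f \<in> L2" by (rule L2_cong_AE[OF Hg H])
  have "L2_norm (hausdorff_op c A f) = L2_norm (hausdorff_op c A g)" by (rule L2_norm_cong_AE[OF Hg H, symmetric])
  also have "\<dots> \<le> sqrt ((N2 c)\<^sup>2 * (\<integral>x. (cmod (g x))\<^sup>2 \<partial>lborel))"
    by (subst L2_borel_iff(2), measurable) (intro real_sqrt_le_mono hausdorff_norm_le[OF c gs])
  also have "\<dots> = N2 c * L2_norm g"
    by (simp add: real_sqrt_mult N2_nonneg L2_borel_iff(2)[OF g])
  also have "L2_norm g = L2_norm f" by (rule L2_norm_cong_AE[OF f fg, symmetric])
  finally show "L2_norm (hausdorff_op c A f) \<le> N2 c * L2_norm f" .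
  have "AE x in lebesgue. \<forall>k. f (A k *v x) = g (A k *v x)"
    unfolding AE_all_countable using AE_A[OF fg] by blast
  with AE_completion[OF hausdorff_AE_summable[OF c gs]]
  show "AE x in lebesgue. (\<lambda>k. c k * f (A k *v x)) summable_on UNIV"
    by eventually_elim simp
qed

lemma hausdorff_bounded:
  assumes c: "N2_finite c"
  shows "bounded_operator_L2 (hausdorff_op c A)"
  unfolding bounded_operator_L2_def
proof (intro conjI ballI allI)
  fix f g :: "real^'d \<Rightarrow> complex" and \<alpha> \<beta> assume f: "f \<in> L2" and g: "g \<in> L2"
  show "AE x in lebesgue. hausdorff_op c A (\<lambda>y. \<alpha> * f y + \<beta> * g y) x = \<alpha> * hausdorff_op c A f x + \<beta> * hausdorff_op c A g x"
    using hausdorff_summable[OF c f] hausdorff_summable[OF c g]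
  proof eventually_elim
    case (elim x)
    have "hausdorff_op c A (\<lambda>y. \<alpha> * f y + \<beta> * g y) x = (\<Sum>\<^sub>\<infinity>k. \<alpha> * (c k * f (A k *v x)) + \<beta> * (c k * g (A k *v x)))"
      by (simp add: hausdorff_op_def algebra_simps)
    also have "\<dots> = (\<Sum>\<^sub>\<infinity>k. \<alpha> * (c k * f (A k *v x))) + (\<Sum>\<^sub>\<infinity>k. \<beta> * (c k * g (A k *v x)))"
      by (intro infsum_add summable_on_cmult_right elim)
    finally show ?case by (simp add: hausdorff_op_def infsum_cmult_right')
  qed
qed (use hausdorff_L2[OF c] hausdorff_L2_norm[OF c] in auto)

lemma hausdorff_coeff_diff:
  assumes c: "N2_finite c" and c': "N2_finite c'" and f: "f \<in> L2"
  shows "AE x in lebesgue. hausdorff_op c A f x - hausdorff_op c' A f x = hausdorff_op (\<lambda>k. c k - c' k) A f x"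
  using hausdorff_summable[OF c f] hausdorff_summable[OF c' f]
proof eventually_elim
  case (elim x)
  have "(\<Sum>\<^sub>\<infinity>k. (c k - c' k) * f (A k *v x)) = (\<Sum>\<^sub>\<infinity>k. c k * f (A k *v x) + (- 1) * (c' k * f (A k *v x)))"
    by (simp add: left_diff_distrib)
  also have "\<dots> = (\<Sum>\<^sub>\<infinity>k. c k * f (A k *v x)) + (\<Sum>\<^sub>\<infinity>k. (- 1) * (c' k * f (A k *v x)))"
    by (intro infsum_add summable_on_cmult_right elim)
  finally show ?case by (simp add: hausdorff_op_def infsum_uminus)
qed

end

section \<open>Rotational invariance of the spectrum\<close>

text \<open>
  Kronecker's theorem is applied to the numbers \<open>r k\<close> and to the argument of \<open>\<zeta>\<close>, measured in full
  turns.
\<close>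

lemma kronecker_cis:
  fixes r :: "'k \<Rightarrow> real"
  assumes r: "linearly_independent_over_int r" and F: "finite F" and \<epsilon>: "\<epsilon> > 0" and \<zeta>: "cmod \<zeta> = 1"
  obtains t where "\<And>k. k \<in> F \<Longrightarrow> cmod (cis (t * r k) - \<zeta>) < \<epsilon>"
proof -
  interpret M: Modules.module "(\<lambda>r. (*) (real_of_int r))"
    by (simp add: Modules.module.intro distrib_left mult.commute)
  have inj: "inj r"
  proof (rule injI, rule ccontr)
    fix k k' assume e: "r k = r k'" "k \<noteq> k'"
    let ?l = "\<lambda>i. if i = k then 1 else (-1::int)"
    have "(\<Sum>i\<in>{k, k'}. of_int (?l i) * r i) = 0" using e by simp
    then have "\<forall>i\<in>{k, k'}. ?l i = 0"
      using r[unfolded linearly_independent_over_int_def, rule_format, of "{k, k'}" ?l] by blast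
    then show False by simp
  qed
  have indep: "M.independent (r ` F)"
  proof
    assume "M.dependent (r ` F)"
    then have "\<exists>T u. finite T \<and> T \<subseteq> r ` F \<and> (\<Sum>v\<in>T. real_of_int (u v) * v) = 0 \<and> (\<exists>v\<in>T. u v \<noteq> 0)"
      by (simp only: M.dependent_explicit)
    then obtain T u where T: "finite T" "T \<subseteq> r ` F" "(\<Sum>v\<in>T. real_of_int (u v) * v) = 0" "\<exists>v\<in>T. u v \<noteq> 0"
      by (elim exE conjE)
    obtain F' where F': "T = r ` F'" using T(2) by (metis subset_image_iff)
    then have "finite F'" using T(1) inj by (metis finite_imageD inj_on_subset subset_UNIV)
    moreover have "(\<Sum>k\<in>F'. of_int (u (r k)) * r k) = 0"
      using T(3) unfolding F' by (subst (asm) sum.reindex) (use inj in \<open>auto intro: inj_on_subset simp: o_def\<close>)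
    ultimately have "\<forall>k\<in>F'. u (r k) = 0"
      using r[unfolded linearly_independent_over_int_def, rule_format, of F' "\<lambda>k. u (r k)"] by blast
    then show False using T(4) F' by auto
  qed
  obtain e where e: "bij_betw e {..<card F} F"
    using ex_bij_betw_nat_finite[OF F] by (auto simp: atLeast0LessThan)
  have im: "(\<lambda>i. r (e i)) ` {..<card F} = r ` F"
    using e by (auto simp: bij_betw_def image_image[symmetric])
  have inj': "inj_on (\<lambda>i. r (e i)) {..<card F}"
    using e inj by (auto simp: bij_betw_def inj_on_def)
  obtain \<alpha> where \<alpha>: "\<zeta> = cis (2 * pi * \<alpha>)"
  proof
    show "\<zeta> = cis (2 * pi * (Arg \<zeta> / (2 * pi)))" using \<zeta> rcis_cmod_Arg[of \<zeta>] by (simp add: rcis_def)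
  qed
  define \<delta> where "\<delta> = \<epsilon> / (2 * pi)"
  have \<delta>: "\<delta> > 0" using \<epsilon> by (simp add: \<delta>_def)
  obtain t h where th: "\<And>i. i < card F \<Longrightarrow> \<bar>t * r (e i) - of_int (h i) - \<alpha>\<bar> < \<delta>"
    using Kronecker_thm_1[OF _ inj' \<delta>, of "\<lambda>_. \<alpha>"] indep unfolding im by blast
  show thesis
  proof (rule that[of "2 * pi * t"])
    fix k assume "k \<in> F"
    then obtain i where i: "i < card F" "k = e i" using e by (auto simp: bij_betw_def)
    define x where "x = t * r k - of_int (h i)"
    have x: "\<bar>x - \<alpha>\<bar> < \<delta>" using th[OF i(1)] by (simp add: x_def i)
    have "cis (2 * pi * t * r k) = cis (2 * pi * x + 2 * pi * of_int (h i))"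
      by (simp add: x_def algebra_simps)
    also have "\<dots> = cis (2 * pi * x)"
      by (simp add: cis_mult[symmetric] cis_multiple_2pi)
    finally have "cmod (cis (2 * pi * t * r k) - \<zeta>) = cmod (cis (2 * pi * x) - cis (2 * pi * \<alpha>))" by (simp add: \<alpha>)
    also have "\<dots> \<le> \<bar>2 * pi * x - 2 * pi * \<alpha>\<bar>"
    proof -
      have "cis (2 * pi * x) - cis (2 * pi * \<alpha>) = cis (2 * pi * \<alpha>) * (cis (2 * pi * x - 2 * pi * \<alpha>) - 1)"
        by (simp add: right_diff_distrib cis_mult)
      then have "cmod (cis (2 * pi * x) - cis (2 * pi * \<alpha>)) = cmod (cis (2 * pi * x - 2 * pi * \<alpha>) - 1)"
        by (simp add: norm_mult)
      also have "\<dots> \<le> \<bar>2 * pi * x - 2 * pi * \<alpha>\<bar>"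
        using iexp_approx1[of "2 * pi * x - 2 * pi * \<alpha>" 0] by (simp add: cis_conv_exp)
      finally show ?thesis .
    qed
    also have "\<dots> = 2 * pi * \<bar>x - \<alpha>\<bar>" by (simp add: abs_mult flip: right_diff_distrib)
    also have "\<dots> < 2 * pi * \<delta>" using x by simp
    also have "\<dots> = \<epsilon>" by (simp add: \<delta>_def)
    finally show "cmod (cis (2 * pi * t * r k) - \<zeta>) < \<epsilon>" .
  qed
qed

context commuting_family
begin

lemma N2_finite_mult:
  assumes c: "N2_finite c" and m: "\<And>k. cmod (m k) \<le> B"
  shows "N2_finite (\<lambda>k. c k * m k)"
  unfolding N2_finite_def
proof (rule summable_on_comparison_test[OF summable_on_cmult_right[OF c[unfolded N2_finite_def], of B]])
  fix k
  have "cmod (m k) * (cmod (c k) * \<bar>det (A k)\<bar> powr (- 1 / 2)) \<le> B * (cmod (c k) * \<bar>det (A k)\<bar> powr (- 1 / 2))"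
    by (intro mult_right_mono m) auto
  then show "cmod (c k * m k) * \<bar>det (A k)\<bar> powr (- 1 / 2) \<le> B * (cmod (c k) * \<bar>det (A k)\<bar> powr (- 1 / 2))"
    by (simp add: norm_mult mult_ac)
qed auto

lemma AE_coordinate_nz: "AE x in lebesgue. (transpose C *v x) $ \<nu> \<noteq> 0"
proof -
  have "negligible {x. (C *v axis \<nu> 1) \<bullet> x = 0}"
  proof (rule negligible_hyperplane)
    have "C *v axis \<nu> 1 \<noteq> 0"
    proof
      assume "C *v axis \<nu> 1 = 0"
      then have "transpose C *v (C *v axis \<nu> 1) = 0" by simp
      then show False unfolding CTC_vec by (simp add: axis_eq_0_iff)
    qed
    then show "C *v axis \<nu> 1 \<noteq> 0 \<or> (0::real) \<noteq> 0" by simp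
  qed
  moreover have "(C *v axis \<nu> 1) \<bullet> x = (transpose C *v x) $ \<nu>" for x
    by (simp add: inner_commute[of _ x] inner_axis flip: dot_lmul_matrix)
  ultimately have "{x. (transpose C *v x) $ \<nu> = 0} \<in> null_sets lebesgue"
    by (simp add: negligible_iff_null_sets)
  from AE_not_in[OF this] show ?thesis by simp
qed

text \<open>
  The function $|y_\nu|^{it}$ with $y = C^T x$. As \<open>ln 0 = 0\<close>, its value is \<open>1\<close> where $y_\nu = 0$, so that
  it has modulus one everywhere.
\<close>

definition modulation :: "real \<Rightarrow> 'd \<Rightarrow> real^'d \<Rightarrow> complex" where
  "modulation t \<nu> x = cis (t * ln \<bar>(transpose C *v x) $ \<nu>\<bar>)"

lemma modulation_measurable: "modulation t \<nu> \<in> borel_measurable lebesgue"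
proof -
  have [measurable]: "(\<lambda>x. (transpose C *v x) $ \<nu>) \<in> borel_measurable borel"
    by (intro borel_measurable_continuous_onI continuous_intros matrix_vector_mult_linear_continuous_on)
  then have "modulation t \<nu> \<in> borel_measurable borel"
    unfolding modulation_def[abs_def] by measurable
  then show ?thesis by (simp add: measurable_completion)
qed

lemma modulation_A:
  assumes "(transpose C *v x) $ \<nu> \<noteq> 0"
  shows "modulation t \<nu> (A k *v x) = modulation t \<nu> x * cis (t * ln \<bar>a k $ \<nu>\<bar>)"
proof -
  have "(transpose C *v (A k *v x)) $ \<nu> = a k $ \<nu> * (transpose C *v x) $ \<nu>"
    unfolding A_vec CTC_vec by simp
  then have "ln \<bar>(transpose C *v (A k *v x)) $ \<nu>\<bar> = ln \<bar>a k $ \<nu>\<bar> + ln \<bar>(transpose C *v x) $ \<nu>\<bar>"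
    using assms a_nz[of k \<nu>] by (simp add: abs_mult ln_mult)
  then show ?thesis by (simp add: modulation_def cis_mult algebra_simps)
qed

text \<open>
  The coordinate \<open>\<nu>\<close> of \<open>A k *v x\<close> is \<open>a k $ \<nu>\<close> times that of \<open>x\<close>, so its modulus to the power
  \<open>\<i> * t\<close> is multiplicative wherever the coordinate does not vanish.
\<close>

lemma hausdorff_modulation:
  "AE x in lebesgue. hausdorff_op c A (\<lambda>y. modulation t \<nu> y * f y) x =
     modulation t \<nu> x * hausdorff_op (\<lambda>k. c k * cis (t * ln \<bar>a k $ \<nu>\<bar>)) A f x"
  using AE_coordinate_nz[of \<nu>]
proof eventually_elim
  case (elim x)
  show ?case unfolding hausdorff_op_def modulation_A[OF elim]
    by (subst infsum_cmult_right'[symmetric]) (simp add: mult_ac)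
qed

text \<open>
  All but finitely many terms contribute little since \<open>cis (t * r k) - \<zeta>\<close> has modulus
  at most two; for the others \<open>kronecker_cis\<close> provides \<open>t\<close>.
\<close>

lemma N2_close:
  assumes c: "N2_finite c" and r: "linearly_independent_over_int r" and \<zeta>: "cmod \<zeta> = 1" and \<eta>: "\<eta> > 0"
  obtains t where "N2 (\<lambda>k. c k * (cis (t * r k) - \<zeta>)) \<le> \<eta>"
proof -
  define \<omega> where "\<omega> k = cmod (c k) * \<bar>det (A k)\<bar> powr (- 1 / 2)" for k
  have \<omega>0: "\<omega> k \<ge> 0" for k by (simp add: \<omega>_def)
  have \<omega>: "\<omega> summable_on UNIV" using c by (simp add: N2_finite_def \<omega>_def[abs_def])
  have \<omega>s: "\<omega> summable_on S" for S by (rule summable_on_subset_banach[OF \<omega>]) simp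
  have "(sum \<omega> \<longlongrightarrow> infsum \<omega> UNIV) (finite_subsets_at_top UNIV)"
    using has_sum_infsum[OF \<omega>] by (simp add: has_sum_def)
  from order_tendstoD(1)[OF this, of "infsum \<omega> UNIV - \<eta> / 4"] \<eta>
  have "\<forall>\<^sub>F X in finite_subsets_at_top UNIV. infsum \<omega> UNIV - \<eta> / 4 < sum \<omega> X" by simp
  then obtain F where F: "finite F" "infsum \<omega> UNIV - \<eta> / 4 < sum \<omega> F"
    unfolding eventually_finite_subsets_at_top by blast
  have tail: "infsum \<omega> (- F) \<le> \<eta> / 4"
  proof -
    have "infsum \<omega> (F \<union> - F) = infsum \<omega> F + infsum \<omega> (- F)"
      by (rule infsum_Un_disjoint) (auto intro: \<omega>s)
    then show ?thesis using F by simp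
  qed
  \<comment> \<open>adding one keeps the divisor in \<open>\<epsilon>\<close> positive even if all coefficients vanish\<close>
  define W where "W = infsum \<omega> UNIV + 1"
  have W: "W > 0" unfolding W_def using infsum_nonneg[of UNIV \<omega>] \<omega>0 by (simp add: add_nonneg_pos)
  define \<epsilon> where "\<epsilon> = \<eta> / (2 * W)"
  have \<epsilon>: "\<epsilon> > 0" using \<eta> W by (simp add: \<epsilon>_def)
  obtain t where t: "\<And>k. k \<in> F \<Longrightarrow> cmod (cis (t * r k) - \<zeta>) < \<epsilon>"
    using kronecker_cis[OF r F(1) \<epsilon> \<zeta>] by blast
  have b2: "cmod (cis (t * r k) - \<zeta>) \<le> 2" for k
    using norm_triangle_ineq4[of "cis (t * r k)" \<zeta>] \<zeta> by simp
  let ?f = "\<lambda>k. \<omega> k * cmod (cis (t * r k) - \<zeta>)"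
  have N2_finite': "N2_finite (\<lambda>k. c k * (cis (t * r k) - \<zeta>))"
    by (rule N2_finite_mult[OF c b2])
  then have fs: "?f summable_on UNIV"
    by (simp add: N2_finite_def \<omega>_def norm_mult mult_ac)
  have fs': "?f summable_on S" for S by (rule summable_on_subset_banach[OF fs]) simp
  have "N2 (\<lambda>k. c k * (cis (t * r k) - \<zeta>)) = infsum ?f (F \<union> - F)"
    by (simp add: N2_def \<omega>_def norm_mult mult_ac)
  also have "\<dots> = infsum ?f F + infsum ?f (- F)"
    by (rule infsum_Un_disjoint) (auto intro: fs')
  also have "infsum ?f F \<le> infsum (\<lambda>k. \<omega> k * \<epsilon>) F"
    by (rule infsum_mono) (use F(1) less_imp_le[OF t] \<omega>0 in \<open>auto intro!: mult_left_mono\<close>)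
  also have "\<dots> = infsum \<omega> F * \<epsilon>" by (simp add: infsum_cmult_left')
  also have "\<dots> \<le> W * \<epsilon>"
  proof -
    have "infsum \<omega> F \<le> infsum \<omega> UNIV" by (rule infsum_mono2[OF \<omega>s \<omega>]) (use \<omega>0 in auto)
    then show ?thesis using \<epsilon> by (intro mult_right_mono) (auto simp: W_def)
  qed
  also have "\<dots> = \<eta> / 2" using W by (simp add: \<epsilon>_def)
  also have "infsum ?f (- F) \<le> infsum (\<lambda>k. \<omega> k * 2) (- F)"
    by (rule infsum_mono[OF fs' summable_on_cmult_left[OF \<omega>s]]) (use \<omega>0 b2 in \<open>auto intro!: mult_left_mono\<close>)
  also have "\<dots> = infsum \<omega> (- F) * 2" by (simp add: infsum_cmult_left')
  also have "\<dots> \<le> \<eta> / 2" using tail by simp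
  finally show thesis by (intro that[of t]) simp
qed

text \<open>
  The coefficients \<open>c'\<close> of the conjugated operator are close to \<open>\<zeta> * c\<close>. The resolvent at \<open>\<zeta> * z\<close> is
  carried from \<open>\<zeta> * H\<close> to the conjugated operator by the Neumann series and from there to \<open>H\<close> by
  conjugation.
\<close>

lemma resolvent_rotate:
  assumes c: "N2_finite c" and r: "linearly_independent_over_int (\<lambda>k. ln \<bar>a k $ \<nu>\<bar>)"
    and \<zeta>: "cmod \<zeta> = 1" and z: "z \<in> resolvent_set_L2 (hausdorff_op c A)"
  shows "\<zeta> * z \<in> resolvent_set_L2 (hausdorff_op c A)"
proof -
  let ?H = "hausdorff_op c A"
  have H: "bounded_operator_L2 ?H" by (rule hausdorff_bounded[OF c])
  obtain K where K: "K > 0" "bounded_below_onto K z ?H" using z resolvent_set_iff_bounded_below_onto[OF H] by blast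
  obtain t where t: "N2 (\<lambda>k. c k * (cis (t * ln \<bar>a k $ \<nu>\<bar>) - \<zeta>)) \<le> 1 / (2 * K)"
    using N2_close[OF c r \<zeta>, of "1 / (2 * K)"] K by auto
  define c' where "c' k = c k * cis (t * ln \<bar>a k $ \<nu>\<bar>)" for k
  have c': "N2_finite c'" unfolding c'_def by (rule N2_finite_mult[OF c, of _ 1]) simp
  have c\<zeta>: "N2_finite (\<lambda>k. c k * \<zeta>)" by (rule N2_finite_mult[OF c, of _ 1]) (simp add: \<zeta>)
  have cd: "N2_finite (\<lambda>k. c k * (cis (t * ln \<bar>a k $ \<nu>\<bar>) - \<zeta>))"
    by (rule N2_finite_mult[OF c, of _ 2]) (use \<zeta> in \<open>auto intro: order_trans[OF norm_triangle_ineq4]\<close>)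
  have H': "bounded_operator_L2 (hausdorff_op c' A)" by (rule hausdorff_bounded[OF c'])
  have \<zeta>H: "(\<lambda>f x. \<zeta> * ?H f x) = hausdorff_op (\<lambda>k. c k * \<zeta>) A"
    by (simp add: fun_eq_iff hausdorff_op_def mult_ac flip: infsum_cmult_right')
  have "bounded_below_onto K (\<zeta> * z) (hausdorff_op (\<lambda>k. c k * \<zeta>) A)"
    using bounded_below_onto_rotate[OF H \<zeta> K(2)] by (simp add: \<zeta>H)
  then have "bounded_below_onto (2 * K) (\<zeta> * z) (hausdorff_op c' A)"
  proof (rule bounded_below_onto_perturb[OF hausdorff_bounded[OF c\<zeta>] H' K(1)])
    fix f :: "real^'d \<Rightarrow> complex" assume f: "f \<in> L2"
    have e: "(\<lambda>k. c' k - c k * \<zeta>) = (\<lambda>k. c k * (cis (t * ln \<bar>a k $ \<nu>\<bar>) - \<zeta>))"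
      by (simp add: c'_def right_diff_distrib)
    have "L2_norm (\<lambda>x. hausdorff_op c' A f x - hausdorff_op (\<lambda>k. c k * \<zeta>) A f x) =
       L2_norm (hausdorff_op (\<lambda>k. c k * (cis (t * ln \<bar>a k $ \<nu>\<bar>) - \<zeta>)) A f)"
      using hausdorff_coeff_diff[OF c' c\<zeta> f] unfolding e
      by (intro L2_norm_cong_AE L2_diff hausdorff_L2 c' c\<zeta> f)
    also have "\<dots> \<le> N2 (\<lambda>k. c k * (cis (t * ln \<bar>a k $ \<nu>\<bar>) - \<zeta>)) * L2_norm f"
      by (rule hausdorff_L2_norm[OF cd f])
    also have "\<dots> \<le> 1 / (2 * K) * L2_norm f" by (intro mult_right_mono t L2_norm_nonneg)
    finally show "L2_norm (\<lambda>x. hausdorff_op c' A f x - hausdorff_op (\<lambda>k. c k * \<zeta>) A f x) \<le> 1 / (2 * K) * L2_norm f" .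
  qed
  then have "bounded_below_onto (2 * K) (\<zeta> * z) ?H"
    by (rule bounded_below_onto_conj[OF H H' modulation_measurable[of t \<nu>], rotated -1])
       (use hausdorff_modulation[of c t \<nu>] in \<open>auto simp: modulation_def c'_def[abs_def]\<close>)
  then show ?thesis using resolvent_set_iff_bounded_below_onto[OF H] K(1) by (metis mult_pos_pos zero_less_numeral)
qed

lemma spectrum_rotationally_invariant:
  assumes c: "N2_finite c" and r: "linearly_independent_over_int (\<lambda>k. ln \<bar>a k $ \<nu>\<bar>)"
  shows "rotationally_invariant (spectrum_L2 (hausdorff_op c A))"
proof -
  have sub: "\<zeta> * z \<in> spectrum_L2 (hausdorff_op c A)" if \<zeta>: "cmod \<zeta> = 1" and z: "z \<in> spectrum_L2 (hausdorff_op c A)" for \<zeta> z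
  proof (rule ccontr)
    assume "\<zeta> * z \<notin> spectrum_L2 (hausdorff_op c A)"
    then have "\<zeta> * z \<in> resolvent_set_L2 (hausdorff_op c A)" by (simp add: spectrum_L2_def)
    then have "inverse \<zeta> * (\<zeta> * z) \<in> resolvent_set_L2 (hausdorff_op c A)"
      by (rule resolvent_rotate[OF c r, rotated]) (simp add: norm_inverse \<zeta>)
    moreover have "\<zeta> \<noteq> 0" using \<zeta> by auto
    then have "inverse \<zeta> * (\<zeta> * z) = z" by simp
    ultimately show False using z by (simp add: spectrum_L2_def)
  qed
  show ?thesis
    unfolding rotationally_invariant_def
  proof (intro allI impI equalityI subsetI)
    fix \<zeta> z assume \<zeta>: "cmod \<zeta> = 1" and z: "z \<in> spectrum_L2 (hausdorff_op c A)"
    have "inverse \<zeta> * z \<in> spectrum_L2 (hausdorff_op c A)" by (rule sub[OF _ z]) (simp add: norm_inverse \<zeta>)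
    moreover have "\<zeta> \<noteq> 0" using \<zeta> by auto
    ultimately show "z \<in> (\<lambda>z. \<zeta> * z) ` spectrum_L2 (hausdorff_op c A)"
      by (intro image_eqI[of _ _ "inverse \<zeta> * z"]) auto
  qed (auto intro: sub)
qed

end

section \<open>The matrix symbol and the point spectrum\<close>

lemma jac_pos: "jac u > 0" and jac_nz [simp]: "jac u \<noteq> 0" "\<not> jac u \<le> 0" by (simp_all add: jac_def)

lemma log_abs_measurable [measurable]: "(log_abs :: real^'d \<Rightarrow> real^'d) \<in> borel_measurable borel"
  unfolding borel_measurable_euclidean_space[where f="log_abs :: real^'d \<Rightarrow> real^'d"]
proof
  fix b :: "real^'d" assume "b \<in> Basis"
  then obtain l where "b = axis l 1" by (auto simp: Basis_vec_real)
  then have "(\<lambda>v. log_abs v \<bullet> b) = (\<lambda>v. ln \<bar>v $ l\<bar>)" by (simp add: log_abs_def inner_axis fun_eq_iff)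
  then show "(\<lambda>v. log_abs v \<bullet> b) \<in> borel_measurable borel" by simp
qed

lemma sign_vector_square: "e \<in> sign_vectors \<Longrightarrow> e $ l * e $ l = 1"
  by (auto simp: sign_vectors_def dest!: spec[of _ l])

lemma octant_inj:
  assumes "e \<in> sign_vectors" "e' \<in> sign_vectors"
    and "{x::real^'d. \<forall>l. e $ l * x $ l > 0} = {x. \<forall>l. e' $ l * x $ l > 0}"
  shows "e = e'"
proof -
  have "e \<in> {x. \<forall>l. e $ l * x $ l > 0}" using assms(1) by (simp add: sign_vector_square)
  then have pos: "e' $ l * e $ l > 0" for l using assms(3) by auto
  have "e $ l = e' $ l" for l
  proof -
    have "e $ l = -1 \<or> e $ l = 1" "e' $ l = -1 \<or> e' $ l = 1" using assms(1,2) by (auto simp: sign_vectors_def)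
    then show ?thesis using pos[of l] by (elim disjE) simp_all
  qed
  then show ?thesis by (simp add: vec_eq_iff)
qed

lemma sign_mult_octant:
  assumes e: "e \<in> sign_vectors" and e': "(e'::real^'d) \<in> sign_vectors"
  shows "(\<lambda>x. \<chi> l. e' $ l * x $ l) ` {x. \<forall>l. e $ l * x $ l > 0} = {x. \<forall>l. (e' $ l * e $ l) * x $ l > 0}"
proof (intro set_eqI iffI)
  fix y assume y: "y \<in> {x. \<forall>l. (e' $ l * e $ l) * x $ l > 0}"
  define x where "x = (\<chi> l. e' $ l * y $ l)"
  have "e $ l * x $ l > 0" for l
  proof -
    have "e $ l * x $ l = (e' $ l * e $ l) * y $ l" by (simp add: x_def)
    also have "\<dots> > 0" using y by blast
    finally show ?thesis .
  qed
  then have "\<forall>l. e $ l * x $ l > 0" by blast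
  moreover have "e' $ l * x $ l = y $ l" for l
  proof -
    have "e' $ l * x $ l = (e' $ l * e' $ l) * y $ l" by (simp add: x_def)
    then show ?thesis by (simp add: sign_vector_square[OF e'])
  qed
  then have "y = (\<chi> l. e' $ l * x $ l)" by (simp add: vec_eq_iff)
  ultimately show "y \<in> (\<lambda>x. \<chi> l. e' $ l * x $ l) ` {x. \<forall>l. e $ l * x $ l > 0}" by blast
next
  fix y assume "y \<in> (\<lambda>x. \<chi> l. e' $ l * x $ l) ` {x. \<forall>l. e $ l * x $ l > 0}"
  then obtain x where x: "\<forall>l. e $ l * x $ l > 0" "y = (\<chi> l. e' $ l * x $ l)" by auto
  have "(e' $ l * e $ l) * y $ l = (e' $ l * e' $ l) * (e $ l * x $ l)" for l by (simp add: x mult_ac)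
  then have "(e' $ l * e $ l) * y $ l = e $ l * x $ l" for l by (simp only: sign_vector_square[OF e'] mult_1)
  then have "(e' $ l * e $ l) * y $ l > 0" for l using x(1) by (simp only:)
  then show "y \<in> {x. \<forall>l. (e' $ l * e $ l) * x $ l > 0}" by blast
qed

text \<open>
  The reflection that maps one hyperoctant onto another is unique since a hyperoctant determines
  its sign vector.
\<close>

lemma octant_sign_eq:
  assumes e: "e \<in> sign_vectors" and e': "(e'::real^'d) \<in> sign_vectors"
  shows "octant_sign {x. \<forall>l. e $ l * x $ l > 0} {x. \<forall>l. e' $ l * x $ l > 0} = (\<chi> l. e $ l * e' $ l)"
  unfolding octant_sign_def
proof (rule the_equality)
  have s: "(\<chi> l. e $ l * e' $ l) \<in> sign_vectors" if "e \<in> sign_vectors" "e' \<in> sign_vectors" for e e' :: "real^'d"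
    using that unfolding sign_vectors_def by (auto) (metis mult_minus1 mult_1 add.inverse_inverse mult_minus_left)+
  have t: "((\<chi> l. e $ l * e' $ l) $ l * e $ l) = e' $ l" for l
    using sign_vector_square[OF e, of l] by (simp add: mult_ac flip: mult.assoc)
  show "(\<chi> l. e $ l * e' $ l) \<in> sign_vectors \<and>
    (\<lambda>x. \<chi> l. (\<chi> l. e $ l * e' $ l) $ l * x $ l) ` {x. \<forall>l. e $ l * x $ l > 0} = {x. \<forall>l. e' $ l * x $ l > 0}"
    using s[OF e e'] by (subst sign_mult_octant[OF e s[OF e e']]) (simp only: t)
  fix d assume d: "d \<in> sign_vectors \<and> (\<lambda>x. \<chi> l. d $ l * x $ l) ` {x. \<forall>l. e $ l * x $ l > 0} = {x. \<forall>l. e' $ l * x $ l > 0}"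
  then have "{x. \<forall>l. (\<chi> l. d $ l * e $ l) $ l * x $ l > 0} = {x. \<forall>l. e' $ l * x $ l > 0}"
    using sign_mult_octant[OF e, of d] by simp
  then have "(\<chi> l. d $ l * e $ l) = e'" using d by (intro octant_inj s e e') auto
  then have "d $ l * e $ l = e' $ l" for l by auto
  then show "d = (\<chi> l. e $ l * e' $ l)"
    using sign_vector_square[OF e] by (simp add: vec_eq_iff) (metis mult.commute mult.left_commute mult_1_right)
qed

locale hausdorff_symbol = commuting_family A C a
  for A :: "int \<Rightarrow> real^'d^'d" and C :: "real^'d^'d" and a :: "int \<Rightarrow> real^'d" +
  fixes c :: "int \<Rightarrow> complex" and U :: "'n::finite \<Rightarrow> (real^'d) set"
  assumes c: "N2_finite c" and U: "bij_betw U UNIV open_hyperoctants"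
begin

definition signs :: "'n \<Rightarrow> real^'d" where
  "signs j = (SOME e. e \<in> sign_vectors \<and> U j = {x. \<forall>l. e $ l * x $ l > 0})"

lemma signs: "signs j \<in> sign_vectors" "U j = {x. \<forall>l. signs j $ l * x $ l > 0}"
proof -
  have "U j \<in> open_hyperoctants" using U by (auto simp: bij_betw_def)
  then have "\<exists>e. e \<in> sign_vectors \<and> U j = {x. \<forall>l. e $ l * x $ l > 0}"
    unfolding open_hyperoctants_def by blast
  from someI_ex[OF this] show "signs j \<in> sign_vectors" "U j = {x. \<forall>l. signs j $ l * x $ l > 0}"
    unfolding signs_def[symmetric] by blast+
qed

lemma signs_bij: "bij_betw signs UNIV sign_vectors"
  unfolding bij_betw_def
proof
  show "inj signs"
    using U signs(2) unfolding bij_betw_def inj_def by metis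
  show "range signs = sign_vectors"
  proof (intro equalityI subsetI)
    fix e :: "real^'d" assume e: "e \<in> sign_vectors"
    then have "{x. \<forall>l. e $ l * x $ l > 0} \<in> range U"
      using U unfolding bij_betw_def open_hyperoctants_def by blast
    then obtain j where "{x. \<forall>l. e $ l * x $ l > 0} = U j" by blast
    then have "e = signs j" using e signs by (intro octant_inj) auto
    then show "e \<in> range signs" by blast
  qed (use signs in auto)
qed

lemma signs_square: "signs j $ l * signs j $ l = 1" by (rule sign_vector_square[OF signs(1)])

definition octant_index :: "real^'d \<Rightarrow> 'n" where
  "octant_index e = the_inv signs e"

lemma signs_octant_index: "e \<in> sign_vectors \<Longrightarrow> signs (octant_index e) = e"
  unfolding octant_index_def using signs_bij by (metis bij_betw_def f_the_inv_into_f)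

lemma octant_index_signs: "octant_index (signs j) = j"
  unfolding octant_index_def using signs_bij by (simp add: bij_betw_def the_inv_f_f)

text \<open>
  The map \<open>A k\<close> sends the hyperoctant \<open>U i\<close>, moved by \<open>C\<close>, to the hyperoctant with index
  \<open>target i k\<close>.
\<close>

definition target :: "'n \<Rightarrow> int \<Rightarrow> 'n" where
  "target i k = octant_index (\<chi> l. signs i $ l * sgn (a k $ l))"

lemma sgn_sign: "(\<chi> l. sgn (a k $ l)) \<in> sign_vectors"
  using a_nz[of k] by (auto simp: sign_vectors_def sgn_if)

lemma sign_mult: "e \<in> sign_vectors \<Longrightarrow> e' \<in> sign_vectors \<Longrightarrow> (\<chi> l. e $ l * e' $ l) \<in> sign_vectors"
  unfolding sign_vectors_def by auto (metis mult_minus1 mult_1 add.inverse_inverse mult_minus_left)+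

lemma signs_target: "signs (target i k) $ l = signs i $ l * sgn (a k $ l)"
  using signs_octant_index[OF sign_mult[OF signs(1) sgn_sign], of i k] by (simp add: target_def)

lemma Omega_eq: "Omega a U i j = {k. target i k = j}"
proof -
  have "(\<chi> l. sgn (a k $ l)) = octant_sign (U i) (U j) \<longleftrightarrow> target i k = j" for k
  proof -
    have "octant_sign (U i) (U j) = (\<chi> l. signs i $ l * signs j $ l)"
      using octant_sign_eq[OF signs(1)[of i] signs(1)[of j]] by (simp only: signs(2)[symmetric])
    moreover have "sgn (a k $ l) = signs i $ l * signs j $ l \<longleftrightarrow> signs (target i k) $ l = signs j $ l" for l
      unfolding signs_target using signs_square[of i l] by (metis mult.assoc mult_1)
    moreover have "target i k = j \<longleftrightarrow> signs (target i k) = signs j" by (metis octant_index_signs)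
    ultimately show ?thesis by (simp add: vec_eq_iff)
  qed
  then show ?thesis by (simp add: Omega_def)
qed

definition weight :: "int \<Rightarrow> complex" where
  "weight k = c k / of_real (sqrt \<bar>det (A k)\<bar>)"

sublocale shift_system weight "\<lambda>k. log_abs (a k)" target
proof
  show "(\<lambda>k. cmod (weight k)) summable_on UNIV"
    using c unfolding N2_finite_def powr_half weight_def by (simp add: norm_divide)
qed

lemma matrix_symbol_eq: "matrix_symbol c A a U s = symbol s"
  unfolding matrix_symbol_def symbol_def Omega_eq
  by (simp add: weight_def cis_conv_exp)

text \<open>
  The square root of the Jacobian makes the passage to logarithmic coordinates isometric.
\<close>

definition lift :: "(real^'d \<Rightarrow> complex) \<Rightarrow> 'n \<Rightarrow> real^'d \<Rightarrow> complex" where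
  "lift f j u = f (chart C (signs j) u) * of_real (sqrt (jac u))"

lemma A_chart: "A k *v chart C (signs i) u = chart C (signs (target i k)) (u + log_abs (a k))"
proof -
  have "a k $ l * (signs i $ l * exp (u $ l)) = signs (target i k) $ l * exp (u $ l + ln \<bar>a k $ l\<bar>)" for l
    using a_nz[of k l] by (simp add: signs_target exp_add mult_ac sgn_if)
  then show ?thesis
    unfolding A_vec chart_def CTC_vec by (simp add: log_abs_def)
qed

lemma jac_shift: "jac (u + log_abs (a k)) = jac u * \<bar>det (A k)\<bar>"
  using a_nz by (simp add: jac_def log_abs_def sum.distrib exp_add exp_sum det_A abs_prod)

text \<open>
  In logarithmic coordinates \<open>A k\<close> is the translation by \<open>log_abs (a k)\<close> together with a change of
  hyperoctant, and the Jacobian picks up the factor \<open>|det (A k)|\<close>. The identity holds at every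
  point.
\<close>

lemma lift_hausdorff: "lift (hausdorff_op c A f) i u = (\<Sum>\<^sub>\<infinity>k. weight k * lift f (target i k) (u + log_abs (a k)))"
proof -
  have "weight k * lift f (target i k) (u + log_abs (a k)) = c k * f (A k *v chart C (signs i) u) * of_real (sqrt (jac u))" for k
    using det_nz[of k] by (simp add: lift_def weight_def A_chart jac_shift real_sqrt_mult)
  then show ?thesis
    by (simp add: hausdorff_op_def lift_def infsum_cmult_left')
qed

lemma nn_integral_charts:
  assumes [measurable]: "h \<in> borel_measurable borel"
  shows "(\<integral>\<^sup>+x. h x \<partial>lborel) = (\<Sum>j\<in>UNIV. \<integral>\<^sup>+u. h (chart C (signs j) u) * ennreal (jac u) \<partial>lborel)"
  by (subst nn_integral_chart[OF _ orth]) (auto simp: sum.reindex_bij_betw[OF signs_bij, symmetric])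

lemma AE_chart:
  assumes "AE x in lborel. P x"
  shows "AE u in lborel. P (chart C (signs j) u)"
proof (rule AE_compose[OF _ _ assms])
  fix N :: "(real^'d) set" assume N: "N \<in> null_sets lborel"
  then have [measurable]: "N \<in> sets borel" by auto
  have "(\<Sum>j\<in>UNIV. \<integral>\<^sup>+u. indicator N (chart C (signs j) u) * ennreal (jac u) \<partial>lborel) = emeasure lborel N"
    by (subst nn_integral_charts[symmetric]) auto
  also have "\<dots> = 0" using N by auto
  finally have "\<forall>j\<in>UNIV. (\<integral>\<^sup>+u. indicator N (chart C (signs j) u) * ennreal (jac u) \<partial>lborel) = 0"
    by (subst (asm) sum_nonneg_eq_0_iff) auto
  then have "(\<integral>\<^sup>+u. indicator N (chart C (signs j) u) * ennreal (jac u) \<partial>lborel) = 0"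
    by blast
  then have "AE u in lborel. indicator N (chart C (signs j) u) * ennreal (jac u) = 0"
    by (subst (asm) nn_integral_0_iff_AE) auto
  then have "AE u in lborel. indicator N (chart C (signs j) u) = (0::ennreal)"
    by eventually_elim (auto simp: ennreal_eq_0_iff)
  then show "(\<integral>\<^sup>+u. indicator N (chart C (signs j) u) \<partial>lborel) = 0"
    by (subst nn_integral_0_iff_AE) auto
qed measurable

lemma AE_from_charts:
  assumes [measurable]: "Measurable.pred borel P" and P: "\<And>j. AE u in lborel. P (chart C (signs j) u)"
  shows "AE x in lborel. P x"
proof -
  have "(\<integral>\<^sup>+x. indicator {x. \<not> P x} x \<partial>lborel) =
    (\<Sum>j\<in>UNIV. \<integral>\<^sup>+u. indicator {x. \<not> P x} (chart C (signs j) u) * ennreal (jac u) \<partial>lborel)"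
    by (rule nn_integral_charts) measurable
  also have "\<dots> = (\<Sum>j\<in>(UNIV::'n set). 0)"
  proof (rule sum.cong[OF refl])
    fix j
    show "(\<integral>\<^sup>+u. indicator {x. \<not> P x} (chart C (signs j) u) * ennreal (jac u) \<partial>lborel) = 0"
      by (subst nn_integral_0_iff_AE, measurable) (use P[of j] in \<open>eventually_elim, simp\<close>)
  qed
  finally have "(\<integral>\<^sup>+x. indicator {x. \<not> P x} x \<partial>lborel) = 0" by simp
  then have "AE x in lborel. indicator {x. \<not> P x} x = (0::ennreal)"
    by (subst (asm) nn_integral_0_iff_AE) measurable
  then show ?thesis by eventually_elim (auto simp: indicator_def split: if_splits)
qed

lemma lift_measurable:
  assumes [measurable]: "f \<in> borel_measurable borel"
  shows "lift f j \<in> borel_measurable borel"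
  unfolding lift_def[abs_def] by measurable

lemma nn_integral_lift:
  assumes [measurable]: "f \<in> borel_measurable borel"
  shows "(\<integral>\<^sup>+x. (cmod (f x))\<^sup>2 \<partial>lborel) = (\<Sum>j\<in>UNIV. \<integral>\<^sup>+u. (cmod (lift f j u))\<^sup>2 \<partial>lborel)"
  by (subst nn_integral_charts)
     (auto simp: lift_def norm_mult power_mult_distrib jac_pos less_imp_le ennreal_mult)

lemma sq_integrable_iff:
  "sq_integrable g \<longleftrightarrow> g \<in> borel_measurable borel \<and> (\<integral>\<^sup>+x. (cmod (g x))\<^sup>2 \<partial>lborel) < \<infinity>"
  by (auto simp: sq_integrable_def integrable_iff_bounded)

lemma sq_integrable_lift_iff:
  assumes f: "f \<in> borel_measurable borel"
  shows "sq_integrable f \<longleftrightarrow> (\<forall>j. sq_integrable (lift f j))"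
proof -
  have "(\<Sum>j\<in>UNIV. \<integral>\<^sup>+u. (cmod (lift f j u))\<^sup>2 \<partial>lborel) < \<infinity> \<longleftrightarrow> (\<forall>j. (\<integral>\<^sup>+u. (cmod (lift f j u))\<^sup>2 \<partial>lborel) < \<infinity>)"
    unfolding infinity_ennreal_def by (subst ennreal_sum_less_top) auto
  then show ?thesis using f lift_measurable[OF f] unfolding sq_integrable_iff nn_integral_lift[OF f] by blast
qed

lemma eigen_lift:
  assumes "AE x in lborel. hausdorff_op c A f x = z * f x"
  shows "eigen z (lift f)"
  unfolding eigen_def
proof
  fix i
  show "AE u in lborel. (\<Sum>\<^sub>\<infinity>k. weight k * lift f (target i k) (u + log_abs (a k))) = z * lift f i u"
    using AE_chart[OF assms, of i] unfolding lift_hausdorff[symmetric]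
    by eventually_elim (simp add: lift_def)
qed

lemma eigen_unlift:
  assumes f[measurable]: "f \<in> borel_measurable borel" and e: "eigen z (lift f)"
  shows "AE x in lborel. hausdorff_op c A f x = z * f x"
proof (rule AE_from_charts)
  fix i
  have "AE u in lborel. lift (hausdorff_op c A f) i u = z * lift f i u"
    using e unfolding eigen_def lift_hausdorff by blast
  then show "AE u in lborel. hausdorff_op c A f (chart C (signs i) u) = z * f (chart C (signs i) u)"
    by eventually_elim (use jac_pos in \<open>simp add: lift_def less_imp_neq[symmetric]\<close>)
qed measurable

lemma log_abs_chart: "log_abs (transpose C *v chart C (signs j) u) = u"
proof -
  have "\<bar>signs j $ l\<bar> = 1" for l using signs(1)[of j] by (auto simp: sign_vectors_def dest!: spec[of _ l])
  then show ?thesis unfolding chart_def CTC_vec by (simp add: log_abs_def abs_mult vec_eq_iff)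
qed

lemma unlift_exists:
  assumes g[measurable]: "\<And>j. g j \<in> borel_measurable borel"
  obtains f where "f \<in> borel_measurable borel" "lift f = g"
proof -
  define f where "f x = (\<Sum>j\<in>UNIV. indicator {y. \<forall>l. signs j $ l * y $ l > 0} (transpose C *v x) *
     (g j (log_abs (transpose C *v x)) / of_real (sqrt (jac (log_abs (transpose C *v x))))))" for x
  have [measurable]: "{y. \<forall>l. signs j $ l * y $ l > 0} \<in> sets borel" for j by measurable
  have "f \<in> borel_measurable borel" unfolding f_def[abs_def] by measurable
  moreover have "lift f i u = g i u" for i u
  proof -
    have "indicator {y. \<forall>l. signs j $ l * y $ l > 0} (transpose C *v chart C (signs i) u) = (if j = i then 1 else 0 :: complex)" for j
    proof -
      have "(\<forall>l. signs j $ l * (signs i $ l * exp (u $ l)) > 0) \<longleftrightarrow> j = i"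
      proof
        assume pos: "\<forall>l. signs j $ l * (signs i $ l * exp (u $ l)) > 0"
        have "signs j $ l = signs i $ l" for l
        proof -
          have "signs j $ l * signs i $ l > 0" using pos[rule_format, of l] by (simp add: zero_less_mult_iff mult_less_0_iff)
          moreover have "signs j $ l \<in> {-1, 1}" "signs i $ l \<in> {-1, 1}" using signs(1) by (auto simp: sign_vectors_def)
          ultimately show ?thesis by auto
        qed
        then have "signs j = signs i" by (simp add: vec_eq_iff)
        then show "j = i" by (metis octant_index_signs)
      qed (simp add: mult.assoc[symmetric] signs_square)
      then show ?thesis unfolding chart_def CTC_vec by (simp add: indicator_def)
    qed
    then have "f (chart C (signs i) u) = g i u / of_real (sqrt (jac u))"
      unfolding f_def log_abs_chart by (simp add: if_distrib[of "\<lambda>x. x * _"] cong: if_cong)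
        (simp add: if_distrib[of "\<lambda>x. x / _"] cong: if_cong)
    then show ?thesis using jac_pos[of u] by (simp add: lift_def)
  qed
  ultimately show thesis by (intro that[of f]) (auto simp: fun_eq_iff)
qed

text \<open>
  An eigenvalue equation for \<open>hausdorff_op c A\<close> and the one for the shift system correspond under
  \<open>lift\<close>. For the first one a Borel representative of the eigenfunction is used.
\<close>

theorem point_spectrum_iff:
  assumes an: "real_analytic_matrix (matrix_symbol c A a U)"
  shows "z \<in> point_spectrum_L2 (hausdorff_op c A) \<longleftrightarrow> (\<forall>s. matrix_eigenvalue (matrix_symbol c A a U s) z)"
proof -
  have ev: "matrix_eigenvalue M z \<longleftrightarrow> det (M - mat z) = 0" for M :: "complex^'n^'n"
  proof -
    have "M *v v = z *s v \<longleftrightarrow> (M - mat z) *v v = 0" for v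
      by (simp add: matrix_vector_mult_diff_rdistrib mat_mult_vec)
    then have "matrix_eigenvalue M z \<longleftrightarrow> \<not> (\<forall>v. (M - mat z) *v v = 0 \<longrightarrow> v = 0)"
      unfolding matrix_eigenvalue_def by blast
    also have "\<dots> \<longleftrightarrow> \<not> invertible (M - mat z)"
      by (metis matrix_left_invertible_ker invertible_left_inverse)
    also have "\<dots> \<longleftrightarrow> det (M - mat z) = 0" by (simp add: invertible_det_nz)
    finally show ?thesis .
  qed
  have sym: "matrix_symbol c A a U = symbol" by (simp add: fun_eq_iff matrix_symbol_eq)
  show ?thesis
    unfolding ev sym
  proof
    assume "z \<in> point_spectrum_L2 (hausdorff_op c A)"
    then obtain f where f: "f \<in> L2" "\<not> (AE x in lebesgue. f x = 0)" "AE x in lebesgue. hausdorff_op c A f x = z * f x"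
      by (auto simp: point_spectrum_L2_def)
    obtain g where g: "g \<in> borel_measurable borel" and fg: "AE x in lebesgue. f x = g x"
      using borel_representative[OF L2_measurable[OF f(1)]] by blast
    have gs: "sq_integrable g" using L2_cong_AE[OF f(1) fg] L2_borel_iff(1)[OF g] by simp
    have "AE x in lebesgue. hausdorff_op c A g x = z * g x"
      using f(3) fg hausdorff_cong_AE[OF fg, of c] by eventually_elim simp
    then have "eigen z (lift g)" by (intro eigen_lift) (simp add: AE_completion_iff)
    show "\<forall>s. det (symbol s - mat z) = 0"
    proof (rule ccontr)
      assume "\<not> ?thesis"
      then obtain s0 where "det (symbol s0 - mat z) \<noteq> 0" by blast
      then have "AE s in lborel. det (symbol s - mat z) \<noteq> 0"
        by (rule real_analytic_det_dichotomy[OF an[unfolded sym] symbol_measurable])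
      then have "AE u in lborel. lift g j u = 0" for j
        using eigen_unique[OF \<open>eigen z (lift g)\<close>] gs sq_integrable_lift_iff[OF g] by blast
      then have "AE u in lborel. g (chart C (signs j) u) = 0" for j
        using jac_pos by (auto simp: lift_def less_imp_neq[symmetric])
      then have "AE x in lborel. g x = 0"
        by (rule AE_from_charts[rotated]) (use g in measurable)
      then have "AE x in lebesgue. g x = 0" by (rule AE_completion)
      then have "AE x in lebesgue. f x = 0" using fg by eventually_elim simp
      then show False using f(2) by simp
    qed
  next
    assume det: "\<forall>s. det (symbol s - mat z) = 0"
    obtain g where g: "eigen z g" "\<And>i. sq_integrable (g i)" "\<not> (\<forall>i. AE u in lborel. g i u = 0)"
      using eigen_exists[of z] det by blast
    obtain f where f: "f \<in> borel_measurable borel" "lift f = g"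
      using unlift_exists[of g] g(2) sq_integrableD by blast
    have "f \<in> L2" using g(2) f by (simp add: L2_borel_iff(1) sq_integrable_lift_iff)
    moreover have "\<not> (AE x in lebesgue. f x = 0)"
    proof
      assume "AE x in lebesgue. f x = 0"
      then have "AE x in lborel. f x = 0" by (simp add: AE_completion_iff)
      from AE_chart[OF this] have "AE u in lborel. g j u = 0" for j
        unfolding f(2)[symmetric] lift_def by simp
      with g(3) show False by blast
    qed
    moreover have "AE x in lebesgue. hausdorff_op c A f x = z * f x"
      using eigen_unlift[OF f(1), of z] g(1) f(2) by (intro AE_completion) simp
    ultimately show "z \<in> point_spectrum_L2 (hausdorff_op c A)"
      unfolding point_spectrum_L2_def by blast
  qed
qed

end

theorem theorem4:
  fixes A :: "int \<Rightarrow> real ^ 'd ^ 'd"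
    and c :: "int \<Rightarrow> complex"
    and C :: "real ^ 'd ^ 'd"
    and a :: "int \<Rightarrow> real ^ 'd"
  assumes invertible: "\<And>k. invertible (A k)"
    and self_adjoint: "\<And>k. transpose (A k) = A k"
    and commuting: "\<And>k m. A k ** A m = A m ** A k"
    and N2_finite: "(\<lambda>k. cmod (c k) * \<bar>det (A k)\<bar> powr (- 1 / 2)) summable_on UNIV"
    and eigenvalues: "eigenvalue_family A C a"
  shows "((\<exists>\<nu>. linearly_independent_over_int (\<lambda>k. ln \<bar>a k $ \<nu>\<bar>)) \<longrightarrow>
            rotationally_invariant (spectrum_L2 (hausdorff_op c A)))
       \<and> (\<forall>U :: 'n::finite \<Rightarrow> (real ^ 'd) set.
            bij_betw U UNIV open_hyperoctants \<longrightarrow>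
            real_analytic_matrix (matrix_symbol c A a U) \<longrightarrow>
            (\<forall>z. z \<in> point_spectrum_L2 (hausdorff_op c A) \<longleftrightarrow>
                 (\<forall>s. matrix_eigenvalue (matrix_symbol c A a U s) z)))"
proof -
  interpret commuting_family A C a
    by standard (fact invertible, fact eigenvalues)
  have c: "N2_finite c" using N2_finite by (simp add: N2_finite_def)
  show ?thesis
  proof (intro conjI impI allI)
    assume "\<exists>\<nu>. linearly_independent_over_int (\<lambda>k. ln \<bar>a k $ \<nu>\<bar>)"
    then show "rotationally_invariant (spectrum_L2 (hausdorff_op c A))"
      using spectrum_rotationally_invariant[OF c] by blast
  next
    fix U :: "'n \<Rightarrow> (real ^ 'd) set" and z
    assume U: "bij_betw U UNIV open_hyperoctants" and an: "real_analytic_matrix (matrix_symbol c A a U)"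
    interpret hausdorff_symbol A C a c U by standard (fact c, fact U)
    show "z \<in> point_spectrum_L2 (hausdorff_op c A) \<longleftrightarrow>
                 (\<forall>s. matrix_eigenvalue (matrix_symbol c A a U s) z)"
      by (rule point_spectrum_iff[OF an])
  qed
qed

end
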